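(* Let $\Bbbk$ be an algebraically closed field of characteristic $0$, $H$ a finite-dimensional Hopf algebra over $\Bbbk$, $S$ a finite-dimensional $H$-simple left $H$-module algebra and $W\neq 0$ a finite-dimensional left $S$-module. Then $\mathrm{Stab}_{\mathrm{Stab}_S(W)}(W)$ is isomorphic to $S$ as $H$-module algebras.
   Context: $\mathcal{S}$ is the antipode of $H$; Sweedler notation is used for coproducts and coactions. Left $H$-module algebras are the same as right $H^*$-comodule algebras: $h\cdot s=\langle s_{(1)},h\rangle s_{(0)}$, where $s\mapsto s_{(0)}\otimes s_{(1)}\in S\otimes H^*$ is the coaction. $S$ is $H$-simple if it has no non-trivial $H$-stable two-sided ideal. Actions: for $\alpha\in H^*$, $h,a\in H$: $\alpha\rightharpoondown h=\langle\alpha,\mathcal{S}^{-1}(h_{(1)})\rangle h_{(2)}$; $h\leftharpoondown\alpha=\langle\alpha,\mathcal{S}^{-1}(h_{(2)})\rangle h_{(1)}$; $\langle h\rightharpoonup\alpha,a\rangle=\langle\alpha,ah\rangle$; $\langle h\rightharpoondown\alpha,a\rangle=\langle\alpha,\mathcal{S}^{-1}(h)a\rangle$. (Stabilizer for a right $H^*$-comodule algebra.) Let $S$ be a right $H^*$-comodule algebra and $W$ a left $S$-module. $W\otimes H$ is a left $S$-module by $s\cdot(w\otimes h)=s_{(0)}\cdot w\otimes(s_{(1)}\rightharpoondown h)$. Let $\mathcal{R}:\mathrm{End}(W)\otimes H\to\mathrm{End}(W\otimes H)$, $\mathcal{R}(f\otimes h)(w\otimes t)=f(w)\otimes th$ (injective).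 The Yan–Zhu stabilizer is $\mathrm{Stab}_S(W)=\mathrm{End}_S(W\otimes H)\cap\mathcal{R}(\mathrm{End}(W)\otimes H)$, an algebra under composition. Identified with a subspace of $\mathrm{End}(W)\otimes H$, it is a left $H$-comodule algebra with coaction corresponding to the right $H^*$-action $(f\otimes h)\cdot\alpha=f\otimes(h\leftharpoondown\alpha)$, that is $f\otimes h\mapsto\mathcal{S}^{-1}(h_{(2)})\otimes(f\otimes h_{(1)})$. $W$ is a left $\mathrm{Stab}_S(W)$-module via $(f\otimes h)\cdot w=\varepsilon(h)f(w)$. (Stabilizer for a left $H$-comodule algebra.) Let $K$ be a left $H$-comodule algebra with coaction $k\mapsto k_{(-1)}\otimes k_{(0)}\in H\otimes K$ and $W$ a left $K$-module. $H^*\otimes W$ is a left $K$-module by $k\cdot(\beta\otimes w)=(k_{(-1)}\rightharpoondown\beta)\otimes k_{(0)}\cdot w$. Let $\mathcal{L}:H^*\otimes\mathrm{End}(W)\to\mathrm{End}(H^*\otimes W)$, $\mathcal{L}(\alpha\otimes f)(\beta\otimes w)=\alpha\beta\otimes f(w)$ (injective). Then $\mathrm{Stab}_K(W)=\mathrm{End}_K(H^*\otimes W)\cap\mathcal{L}(H^*\otimes\mathrm{End}(W))$, an algebra under composition. It is a left $H$-module algebra (equivalently a right $H^*$-comodule algebra) with $h\cdot(\alpha\otimes f)=(h\rightharpoonup\alpha)\otimes f$ under the identification with a subspace of $H^*\otimes\mathrm{End}(W)$. $\mathrm{Stab}_{\mathrm{Stab}_S(W)}(W)$ is the second construction applied to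 $K=\mathrm{Stab}_S(W)$ and its module $W$. *)

theory Defs
  imports
    "HOL-Library.Function_Algebras"
    "HOL-Computational_Algebra.Polynomial"
begin

section \<open>Vector spaces, linear maps, tensor products\<close>

text \<open>A vector space is a subspace \<open>carr\<close> of an ambient type which is itself a vector space
  under \<open>scal\<close>. Function types are vector spaces under the pointwise operations.\<close>

record ('k, 'v) vspace =
  carr :: "'v set"
  scal :: "'k \<Rightarrow> 'v \<Rightarrow> 'v"

definition whole :: "('k \<Rightarrow> 'v \<Rightarrow> 'v) \<Rightarrow> ('k, 'v) vspace"
  where "whole s = \<lparr>carr = UNIV, scal = s\<rparr>"

definition fin_dim :: "('k::field \<Rightarrow> 'v::ab_group_add \<Rightarrow> 'v) \<Rightarrow> bool"
  where "fin_dim s \<longleftrightarrow> (\<exists>B. finite_dimensional_vector_space s B)"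

definition is_vspace :: "('k::field, 'v::ab_group_add, 'x) vspace_scheme \<Rightarrow> bool"
  where "is_vspace V \<longleftrightarrow> vector_space (scal V) \<and> module.subspace (scal V) (carr V)"

definition fscale :: "('k \<Rightarrow> 'b \<Rightarrow> 'b) \<Rightarrow> 'k \<Rightarrow> ('a \<Rightarrow> 'b) \<Rightarrow> 'a \<Rightarrow> 'b"
  where "fscale s c f = (\<lambda>x. s c (f x))"

definition linear_on ::
  "('k, 'v::ab_group_add, 'x) vspace_scheme \<Rightarrow> ('k, 'w::ab_group_add, 'y) vspace_scheme \<Rightarrow>
    ('v \<Rightarrow> 'w) \<Rightarrow> bool"
  where "linear_on V W f \<longleftrightarrow>
    (\<forall>x\<in>carr V. f x \<in> carr W) \<and>
    (\<forall>x\<in>carr V. \<forall>y\<in>carr V. f (x + y) = f x + f y) \<and>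
    (\<forall>c. \<forall>x\<in>carr V. f (scal V c x) = scal W c (f x))"

text \<open>Linear maps are normalised to be zero outside the carrier, so that equality of maps is
  equality of functions.\<close>

definition Hom ::
  "('k, 'v::ab_group_add, 'x) vspace_scheme \<Rightarrow> ('k, 'w::ab_group_add, 'y) vspace_scheme \<Rightarrow>
    ('k, 'v \<Rightarrow> 'w) vspace"
  where "Hom V W =
    \<lparr>carr = {f. linear_on V W f \<and> (\<forall>x. x \<notin> carr V \<longrightarrow> f x = 0)}, scal = fscale (scal W)\<rparr>"

abbreviation End :: "('k, 'v::ab_group_add, 'x) vspace_scheme \<Rightarrow> ('k, 'v \<Rightarrow> 'v) vspace"
  where "End V \<equiv> Hom V V"

abbreviation dual :: "('k::field, 'v::ab_group_add, 'x) vspace_scheme \<Rightarrow> ('k, 'v \<Rightarrow> 'k) vspace"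
  where "dual V \<equiv> Hom V (whole (*))"

definition ident :: "('k, 'v::ab_group_add, 'x) vspace_scheme \<Rightarrow> 'v \<Rightarrow> 'v"
  where "ident V = (\<lambda>x. if x \<in> carr V then x else 0)"

text \<open>The tensor \<open>v \<otimes> w\<close> is realised as evaluation at \<open>(v, w)\<close> on the bilinear forms, and the
  tensor product as the span of these evaluations; over a field this is the usual tensor product.
  The forms live on the ambient spaces, so for subspaces \<open>V' \<subseteq> V\<close>, \<open>W' \<subseteq> W\<close> the inclusion
  \<open>V' \<otimes> W' \<subseteq> V \<otimes> W\<close> is an inclusion of sets.\<close>

type_synonym ('v, 'w, 'k) tensor = "('v \<Rightarrow> 'w \<Rightarrow> 'k) \<Rightarrow> 'k"

definition bilinear_form ::
  "('k::field, 'v::ab_group_add, 'x) vspace_scheme \<Rightarrow>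
    ('k, 'w::ab_group_add, 'y) vspace_scheme \<Rightarrow> ('v \<Rightarrow> 'w \<Rightarrow> 'k) \<Rightarrow> bool"
  where "bilinear_form V W \<beta> \<longleftrightarrow>
    (\<forall>v. Vector_Spaces.linear (scal W) (*) (\<beta> v)) \<and>
    (\<forall>w. Vector_Spaces.linear (scal V) (*) (\<lambda>v. \<beta> v w))"

definition tensor ::
  "('k::field, 'v::ab_group_add, 'x) vspace_scheme \<Rightarrow>
    ('k, 'w::ab_group_add, 'y) vspace_scheme \<Rightarrow> 'v \<Rightarrow> 'w \<Rightarrow> ('v, 'w, 'k) tensor"
  where "tensor V W v w = (\<lambda>\<beta>. if bilinear_form V W \<beta> then \<beta> v w else 0)"

definition tprod ::
  "('k::field, 'v::ab_group_add, 'x) vspace_scheme \<Rightarrow>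
    ('k, 'w::ab_group_add, 'y) vspace_scheme \<Rightarrow> ('k, ('v, 'w, 'k) tensor) vspace"
  where "tprod V W =
    \<lparr>carr = module.span (fscale (*)) {tensor V W v w | v w. v \<in> carr V \<and> w \<in> carr W},
     scal = fscale (*)\<rparr>"

text \<open>\<open>tlift V W \<beta>\<close> is the linear map on \<open>V \<otimes> W\<close> with \<open>v \<otimes> w \<mapsto> \<beta> v w\<close>, for \<open>\<beta>\<close> bilinear
  on the carriers; see \<open>tlift_sum\<close> and \<open>tprod_sumE\<close> below.\<close>

definition tlift ::
  "('k::field, 'v::ab_group_add, 'x) vspace_scheme \<Rightarrow>
    ('k, 'w::ab_group_add, 'y) vspace_scheme \<Rightarrow>
    ('v \<Rightarrow> 'w \<Rightarrow> 'z::ab_group_add) \<Rightarrow> ('v, 'w, 'k) tensor \<Rightarrow> 'z"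
  where "tlift V W \<beta> x =
    (if x \<in> carr (tprod V W)
     then THE z. \<exists>xs. set xs \<subseteq> carr V \<times> carr W \<and>
       x = (\<Sum>(v, w)\<leftarrow>xs. tensor V W v w) \<and> z = (\<Sum>(v, w)\<leftarrow>xs. \<beta> v w)
     else 0)"

definition bilinear_on ::
  "('k, 'v::ab_group_add, 'x) vspace_scheme \<Rightarrow> ('k, 'w::ab_group_add, 'y) vspace_scheme \<Rightarrow>
    ('k \<Rightarrow> 'z \<Rightarrow> 'z) \<Rightarrow> ('v \<Rightarrow> 'w \<Rightarrow> 'z::ab_group_add) \<Rightarrow> bool"
  where "bilinear_on V W s \<beta> \<longleftrightarrow>
    (\<forall>v\<in>carr V. linear_on W (whole s) (\<beta> v)) \<and>
    (\<forall>w\<in>carr W. linear_on V (whole s) (\<lambda>v. \<beta> v w))"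


section \<open>Hopf algebras and their module algebras\<close>

definition algebra_over :: "('k::field \<Rightarrow> 'a::ring_1 \<Rightarrow> 'a) \<Rightarrow> bool"
  where "algebra_over s \<longleftrightarrow> vector_space s \<and>
    (\<forall>c x y. s c x * y = s c (x * y)) \<and> (\<forall>c x y. x * s c y = s c (x * y))"

text \<open>Multiplication and unit of the Hopf algebra are those of the type \<open>'h\<close>.\<close>

record ('k, 'h) hopf =
  hscale :: "'k \<Rightarrow> 'h \<Rightarrow> 'h"
  comult :: "'h \<Rightarrow> ('h, 'h, 'k) tensor"
  counit :: "'h \<Rightarrow> 'k"
  antipode :: "'h \<Rightarrow> 'h"

abbreviation hsp :: "('k, 'h) hopf \<Rightarrow> ('k, 'h) vspace"
  where "hsp H \<equiv> whole (hscale H)"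

text \<open>Sweedler notation: \<open>sweedler H h \<beta>\<close> is \<open>\<beta> h\<^sub>(\<^sub>1\<^sub>) h\<^sub>(\<^sub>2\<^sub>)\<close>.\<close>

definition sweedler ::
  "('k::field, 'h::ab_group_add) hopf \<Rightarrow> 'h \<Rightarrow> ('h \<Rightarrow> 'h \<Rightarrow> 'z::ab_group_add) \<Rightarrow> 'z"
  where "sweedler H h \<beta> = tlift (hsp H) (hsp H) \<beta> (comult H h)"

definition hopf_algebra :: "('k::field, 'h::ring_1) hopf \<Rightarrow> bool"
  where "hopf_algebra H \<longleftrightarrow>
    algebra_over (hscale H) \<and>
    linear_on (hsp H) (tprod (hsp H) (hsp H)) (comult H) \<and>
    comult H 1 = tensor (hsp H) (hsp H) 1 1 \<and>
    (\<forall>g h. comult H (g * h) =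
      sweedler H g (\<lambda>a b. sweedler H h (\<lambda>c d. tensor (hsp H) (hsp H) (a * c) (b * d)))) \<and>
    (\<forall>h. sweedler H h (\<lambda>a b. tensor (tprod (hsp H) (hsp H)) (hsp H) (comult H a) b) =
         sweedler H h (\<lambda>a b. sweedler H b (\<lambda>c d.
           tensor (tprod (hsp H) (hsp H)) (hsp H) (tensor (hsp H) (hsp H) a c) d))) \<and>
    Vector_Spaces.linear (hscale H) (*) (counit H) \<and>
    counit H 1 = 1 \<and> (\<forall>g h. counit H (g * h) = counit H g * counit H h) \<and>
    (\<forall>h. sweedler H h (\<lambda>a b. hscale H (counit H a) b) = h) \<and>
    (\<forall>h. sweedler H h (\<lambda>a b. hscale H (counit H b) a) = h) \<and>
    Vector_Spaces.linear (hscale H) (hscale H) (antipode H) \<and>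
    (\<forall>h. sweedler H h (\<lambda>a b. antipode H a * b) = hscale H (counit H h) 1) \<and>
    (\<forall>h. sweedler H h (\<lambda>a b. a * antipode H b) = hscale H (counit H h) 1)"

text \<open>The antipode of a finite-dimensional Hopf algebra is bijective.\<close>

abbreviation antipode_inv :: "('k, 'h) hopf \<Rightarrow> 'h \<Rightarrow> 'h"
  where "antipode_inv H \<equiv> inv (antipode H)"

definition left_module ::
  "('k::field \<Rightarrow> 'a::ring_1 \<Rightarrow> 'a) \<Rightarrow> ('k \<Rightarrow> 'w::ab_group_add \<Rightarrow> 'w) \<Rightarrow> ('a \<Rightarrow> 'w \<Rightarrow> 'w) \<Rightarrow> bool"
  where "left_module sA sW act \<longleftrightarrow>
    (\<forall>a. Vector_Spaces.linear sW sW (act a)) \<and>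
    (\<forall>w. Vector_Spaces.linear sA sW (\<lambda>a. act a w)) \<and>
    (\<forall>w. act 1 w = w) \<and> (\<forall>a b w. act (a * b) w = act a (act b w))"

definition module_algebra ::
  "('k::field, 'h::ring_1) hopf \<Rightarrow> ('k \<Rightarrow> 's::ring_1 \<Rightarrow> 's) \<Rightarrow> ('h \<Rightarrow> 's \<Rightarrow> 's) \<Rightarrow> bool"
  where "module_algebra H sS act \<longleftrightarrow>
    algebra_over sS \<and> left_module (hscale H) sS act \<and>
    (\<forall>h. act h 1 = sS (counit H h) 1) \<and>
    (\<forall>h s t. act h (s * t) = sweedler H h (\<lambda>a b. act a s * act b t))"

definition two_sided_ideal :: "'s::ring_1 set \<Rightarrow> bool"
  where "two_sided_ideal I \<longleftrightarrow> 0 \<in> I \<and> (\<forall>x\<in>I. \<forall>y\<in>I. x + y \<in> I) \<and>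
    (\<forall>x\<in>I. \<forall>s. s * x \<in> I \<and> x * s \<in> I)"

text \<open>Here \<open>S \<noteq> 0\<close> is automatic, because \<open>0 \<noteq> 1\<close> in \<open>ring_1\<close>.\<close>

definition H_simple :: "('h \<Rightarrow> 's::ring_1 \<Rightarrow> 's) \<Rightarrow> bool"
  where "H_simple act \<longleftrightarrow>
    (\<forall>I. two_sided_ideal I \<and> (\<forall>h. \<forall>x\<in>I. act h x \<in> I) \<longrightarrow> I = {0} \<or> I = UNIV)"

text \<open>Algebras whose multiplication is not that of the ambient type, with \<open>H\<close>-action, right
  \<open>H\<^sup>*\<close>-coaction or left \<open>H\<close>-coaction.\<close>

record ('k, 'a) alg = "('k, 'a) vspace" +
  amult :: "'a \<Rightarrow> 'a \<Rightarrow> 'a"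
  aone :: 'a

record ('k, 'h, 'a) modalg = "('k, 'a) alg" +
  hact :: "'h \<Rightarrow> 'a \<Rightarrow> 'a"

record ('k, 'h, 'a) rcomodalg = "('k, 'a) alg" +
  rcoact :: "'a \<Rightarrow> ('a, 'h \<Rightarrow> 'k, 'k) tensor"

record ('k, 'h, 'a) lcomodalg = "('k, 'a) alg" +
  lcoact :: "'a \<Rightarrow> ('h, 'a, 'k) tensor"

definition to_modalg ::
  "('k \<Rightarrow> 's::ring_1 \<Rightarrow> 's) \<Rightarrow> ('h \<Rightarrow> 's \<Rightarrow> 's) \<Rightarrow> ('k, 'h, 's) modalg"
  where "to_modalg sS act =
    \<lparr>carr = UNIV, scal = sS, amult = (*), aone = 1, hact = act\<rparr>"

text \<open>The right \<open>H\<^sup>*\<close>-coaction of a left \<open>H\<close>-module algebra is determined by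
  \<open>h \<cdot> s = \<langle>s\<^sub>(\<^sub>1\<^sub>), h\<rangle> s\<^sub>(\<^sub>0\<^sub>)\<close>.\<close>

definition module_to_comodule ::
  "('k::field, 'h::ring_1) hopf \<Rightarrow> ('k, 'h, 's::ab_group_add) modalg \<Rightarrow> ('k, 'h, 's) rcomodalg"
  where "module_to_comodule H S =
    \<lparr>carr = carr S, scal = scal S, amult = amult S, aone = aone S,
     rcoact = (\<lambda>s. THE x. x \<in> carr (tprod S (dual (hsp H))) \<and>
       (\<forall>h. hact S h s = tlift S (dual (hsp H)) (\<lambda>s0 \<alpha>. scal S (\<alpha> h) s0) x))\<rparr>"

definition modalg_isomorphic ::
  "('k, 'h, 'a::ab_group_add) modalg \<Rightarrow> ('k, 'h, 'b::ab_group_add) modalg \<Rightarrow> bool"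
  where "modalg_isomorphic A B \<longleftrightarrow> (\<exists>\<phi>.
    bij_betw \<phi> (carr A) (carr B) \<and> linear_on A B \<phi> \<and>
    (\<forall>x\<in>carr A. \<forall>y\<in>carr A. \<phi> (amult A x y) = amult B (\<phi> x) (\<phi> y)) \<and>
    \<phi> (aone A) = aone B \<and>
    (\<forall>h. \<forall>x\<in>carr A. \<phi> (hact A h x) = hact B h (\<phi> x)))"


section \<open>Actions between the Hopf algebra and its dual\<close>

text \<open>\<open>conv\<close> is the multiplication of \<open>H\<^sup>*\<close>. The action of \<open>H\<close> on itself written
  \<open>\<alpha> \<rightharpoondown> h\<close> is \<open>lharp\<close>, \<open>h \<rightharpoondown> \<alpha>\<close> is \<open>dharp\<close> and \<open>h \<rightharpoonup> \<alpha>\<close> is \<open>uharp\<close>.\<close>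

definition conv :: "('k::field, 'h::ring_1) hopf \<Rightarrow> ('h \<Rightarrow> 'k) \<Rightarrow> ('h \<Rightarrow> 'k) \<Rightarrow> 'h \<Rightarrow> 'k"
  where "conv H \<alpha> \<beta> = (\<lambda>h. sweedler H h (\<lambda>a b. \<alpha> a * \<beta> b))"

definition lharp :: "('k::field, 'h::ring_1) hopf \<Rightarrow> ('h \<Rightarrow> 'k) \<Rightarrow> 'h \<Rightarrow> 'h"
  where "lharp H \<alpha> h = sweedler H h (\<lambda>a b. hscale H (\<alpha> (antipode_inv H a)) b)"

definition dharp :: "('k::field, 'h::ring_1) hopf \<Rightarrow> 'h \<Rightarrow> ('h \<Rightarrow> 'k) \<Rightarrow> 'h \<Rightarrow> 'k"
  where "dharp H h \<alpha> = (\<lambda>a. \<alpha> (antipode_inv H h * a))"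

definition uharp :: "'h::ring_1 \<Rightarrow> ('h \<Rightarrow> 'k) \<Rightarrow> 'h \<Rightarrow> 'k"
  where "uharp h \<alpha> = (\<lambda>a. \<alpha> (a * h))"


section \<open>Stabilizers\<close>

text \<open>\<open>End_over X M act\<close> consists of the linear endomorphisms of \<open>M\<close> commuting with the action
  of the elements of \<open>X\<close>.\<close>

definition End_over ::
  "'a set \<Rightarrow> ('k, 'm::ab_group_add, 'x) vspace_scheme \<Rightarrow> ('a \<Rightarrow> 'm \<Rightarrow> 'm) \<Rightarrow> ('m \<Rightarrow> 'm) set"
  where "End_over X M act =
    {F \<in> carr (End M). \<forall>a\<in>X. \<forall>m\<in>carr M. F (act a m) = act a (F m)}"

subsection \<open>Right \<open>H\<^sup>*\<close>-comodule algebras\<close>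

context
  fixes H :: "('k::field, 'h::ring_1) hopf"
    and W :: "('k, 'w::ab_group_add) vspace"
begin

definition WH_act ::
  "('k, 'h, 's::ab_group_add) rcomodalg \<Rightarrow> ('s \<Rightarrow> 'w \<Rightarrow> 'w) \<Rightarrow> 's \<Rightarrow>
    ('w, 'h, 'k) tensor \<Rightarrow> ('w, 'h, 'k) tensor"
  where "WH_act S act s x =
    tlift S (dual (hsp H))
      (\<lambda>s0 s1. tlift W (hsp H) (\<lambda>w h. tensor W (hsp H) (act s0 w) (lharp H s1 h)) x)
      (rcoact S s)"

definition R_map ::
  "('w \<Rightarrow> 'w, 'h, 'k) tensor \<Rightarrow> ('w, 'h, 'k) tensor \<Rightarrow> ('w, 'h, 'k) tensor"
  where "R_map y = (\<lambda>x. tlift (End W) (hsp H)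
    (\<lambda>f h. tlift W (hsp H) (\<lambda>w t. tensor W (hsp H) (f w) (t * h)) x) y)"

abbreviation R_inv ::
  "(('w, 'h, 'k) tensor \<Rightarrow> ('w, 'h, 'k) tensor) \<Rightarrow> ('w \<Rightarrow> 'w, 'h, 'k) tensor"
  where "R_inv \<equiv> the_inv_into (carr (tprod (End W) (hsp H))) R_map"

text \<open>The coaction is \<open>f \<otimes> h \<mapsto> \<S>\<^sup>-\<^sup>1(h\<^sub>(\<^sub>2\<^sub>)) \<otimes> (f \<otimes> h\<^sub>(\<^sub>1\<^sub>))\<close>, transported along \<open>R_map\<close>.\<close>

definition Stab_right ::
  "('k, 'h, 's::ab_group_add) rcomodalg \<Rightarrow> ('s \<Rightarrow> 'w \<Rightarrow> 'w) \<Rightarrow>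
    ('k, 'h, ('w, 'h, 'k) tensor \<Rightarrow> ('w, 'h, 'k) tensor) lcomodalg"
  where "Stab_right S act =
    \<lparr>carr = End_over (carr S) (tprod W (hsp H)) (WH_act S act) \<inter>
            R_map ` carr (tprod (End W) (hsp H)),
     scal = scal (End (tprod W (hsp H))),
     amult = (\<circ>),
     aone = ident (tprod W (hsp H)),
     lcoact = (\<lambda>F. tlift (End W) (hsp H)
       (\<lambda>f h. sweedler H h (\<lambda>a b.
         tensor (hsp H) (End (tprod W (hsp H)))
           (antipode_inv H b) (R_map (tensor (End W) (hsp H) f a))))
       (R_inv F))\<rparr>"

definition Stab_right_act ::
  "(('w, 'h, 'k) tensor \<Rightarrow> ('w, 'h, 'k) tensor) \<Rightarrow> 'w \<Rightarrow> 'w"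
  where "Stab_right_act F w =
    tlift (End W) (hsp H) (\<lambda>f h. scal W (counit H h) (f w)) (R_inv F)"

subsection \<open>Left \<open>H\<close>-comodule algebras\<close>

definition HW_act ::
  "('k, 'h, 'a::ab_group_add) lcomodalg \<Rightarrow> ('a \<Rightarrow> 'w \<Rightarrow> 'w) \<Rightarrow> 'a \<Rightarrow>
    ('h \<Rightarrow> 'k, 'w, 'k) tensor \<Rightarrow> ('h \<Rightarrow> 'k, 'w, 'k) tensor"
  where "HW_act K act k x =
    tlift (hsp H) K
      (\<lambda>h k0. tlift (dual (hsp H)) W
        (\<lambda>\<beta> w. tensor (dual (hsp H)) W (dharp H h \<beta>) (act k0 w)) x)
      (lcoact K k)"

definition L_map ::
  "('h \<Rightarrow> 'k, 'w \<Rightarrow> 'w, 'k) tensor \<Rightarrow> ('h \<Rightarrow> 'k, 'w, 'k) tensor \<Rightarrow> ('h \<Rightarrow> 'k, 'w, 'k) tensor"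
  where "L_map y = (\<lambda>x. tlift (dual (hsp H)) (End W)
    (\<lambda>\<alpha> f. tlift (dual (hsp H)) W
      (\<lambda>\<beta> w. tensor (dual (hsp H)) W (conv H \<alpha> \<beta>) (f w)) x) y)"

abbreviation L_inv ::
  "(('h \<Rightarrow> 'k, 'w, 'k) tensor \<Rightarrow> ('h \<Rightarrow> 'k, 'w, 'k) tensor) \<Rightarrow> ('h \<Rightarrow> 'k, 'w \<Rightarrow> 'w, 'k) tensor"
  where "L_inv \<equiv> the_inv_into (carr (tprod (dual (hsp H)) (End W))) L_map"

definition Stab_left ::
  "('k, 'h, 'a::ab_group_add) lcomodalg \<Rightarrow> ('a \<Rightarrow> 'w \<Rightarrow> 'w) \<Rightarrow>
    ('k, 'h, ('h \<Rightarrow> 'k, 'w, 'k) tensor \<Rightarrow> ('h \<Rightarrow> 'k, 'w, 'k) tensor) modalg"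
  where "Stab_left K act =
    \<lparr>carr = End_over (carr K) (tprod (dual (hsp H)) W) (HW_act K act) \<inter>
            L_map ` carr (tprod (dual (hsp H)) (End W)),
     scal = scal (End (tprod (dual (hsp H)) W)),
     amult = (\<circ>),
     aone = ident (tprod (dual (hsp H)) W),
     hact = (\<lambda>h F. L_map (tlift (dual (hsp H)) (End W)
       (\<lambda>\<alpha> f. tensor (dual (hsp H)) (End W) (uharp h \<alpha>) f) (L_inv F)))\<rparr>"

end


section \<open>Tensor products are well defined\<close>

lemma vector_space_fscale: "vector_space s \<Longrightarrow> vector_space (fscale s)"
  unfolding vector_space_def fscale_def by (auto simp: fun_eq_iff)

lemma vector_space_field: "vector_space ((*) :: 'k::field \<Rightarrow> 'k \<Rightarrow> 'k)"
  by unfold_locales (auto simp: algebra_simps)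

lemma is_vspace_whole: "vector_space s \<Longrightarrow> is_vspace (whole s)"
proof -
  assume "vector_space s"
  then interpret vector_space s .
  show ?thesis by (simp add: is_vspace_def whole_def subspace_UNIV vector_space_axioms)
qed

lemma ex_projection:
  assumes "is_vspace V"
  obtains p where "Vector_Spaces.linear (scal V) (scal V) p" "range p \<subseteq> carr V"
    "\<And>v. v \<in> carr V \<Longrightarrow> p v = v"
proof -
  interpret vector_space "scal V" using assms by (simp add: is_vspace_def)
  interpret vector_space_pair "scal V" "scal V" ..
  have "\<exists>g. g ` UNIV \<subseteq> carr V \<and> Vector_Spaces.linear (scal V) (scal V) g \<and>
      (\<forall>v\<in>carr V. g (id v) = v)"
    by (rule linear_exists_left_inverse_on)
      (use assms in \<open>auto simp: is_vspace_def linear_id[unfolded id_def]\<close>)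
  then show thesis using that by auto
qed

lemma ex_functional:
  assumes "vector_space s" "d \<noteq> 0"
  obtains l where "Vector_Spaces.linear s (*) l" "l d = (1 :: 'k::field)"
proof -
  interpret vector_space s by fact
  interpret vector_space_pair s "(*) :: 'k \<Rightarrow> 'k \<Rightarrow> 'k"
    using vector_space_field assms(1) by (simp add: vector_space_pair_def)
  have "independent {d}" using assms(2) by simp
  from linear_independent_extend[OF this, of "\<lambda>_. 1"] show thesis using that by auto
qed

lemma sum_list_tensor_apply:
  "(\<Sum>(v, w)\<leftarrow>xs. tensor V W v w) \<gamma> = (\<Sum>(v, w)\<leftarrow>xs. tensor V W v w \<gamma>)"
  by (induction xs) (auto simp: case_prod_unfold)

lemma tensor_sum_eqD:
  assumes V: "is_vspace V" and W: "is_vspace W" and s: "vector_space s"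
    and \<beta>: "bilinear_on V W s \<beta>"
    and xs: "set xs \<subseteq> carr V \<times> carr W" and ys: "set ys \<subseteq> carr V \<times> carr W"
    and eq: "(\<Sum>(v, w)\<leftarrow>xs. tensor V W v w) = (\<Sum>(v, w)\<leftarrow>ys. tensor V W v w)"
  shows "(\<Sum>(v, w)\<leftarrow>xs. \<beta> v w) = (\<Sum>(v, w)\<leftarrow>ys. \<beta> v w)"
proof (rule ccontr)
  assume "\<not> ?thesis"
  then have "(\<Sum>(v, w)\<leftarrow>xs. \<beta> v w) - (\<Sum>(v, w)\<leftarrow>ys. \<beta> v w) \<noteq> 0" by simp
  from ex_functional[OF s this] obtain l where l: "Vector_Spaces.linear s (*) l"
    and l1: "l ((\<Sum>(v, w)\<leftarrow>xs. \<beta> v w) - (\<Sum>(v, w)\<leftarrow>ys. \<beta> v w)) = 1" by blast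
  interpret l: Vector_Spaces.linear s "(*)" l by fact
  obtain p where p: "Vector_Spaces.linear (scal V) (scal V) p" "range p \<subseteq> carr V"
    "\<And>v. v \<in> carr V \<Longrightarrow> p v = v" using ex_projection[OF V] by blast
  obtain q where q: "Vector_Spaces.linear (scal W) (scal W) q" "range q \<subseteq> carr W"
    "\<And>v. v \<in> carr W \<Longrightarrow> q v = v" using ex_projection[OF W] by blast
  interpret p: Vector_Spaces.linear "scal V" "scal V" p by fact
  interpret q: Vector_Spaces.linear "scal W" "scal W" q by fact
  define \<gamma> where "\<gamma> = (\<lambda>v w. l (\<beta> (p v) (q w)))"
  have pc: "p v \<in> carr V" and qc: "q w \<in> carr W" for v w using p(2) q(2) by auto
  have \<gamma>: "bilinear_form V W \<gamma>"
    unfolding bilinear_form_def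
  proof (intro conjI allI)
    fix v
    show "Vector_Spaces.linear (scal W) (*) (\<gamma> v)"
      by unfold_locales
        (use \<beta> pc qc in \<open>auto simp: \<gamma>_def bilinear_on_def linear_on_def whole_def
          p.add q.add p.scale q.scale l.add l.scale algebra_simps\<close>)
  next
    fix w
    show "Vector_Spaces.linear (scal V) (*) (\<lambda>v. \<gamma> v w)"
      by unfold_locales
        (use \<beta> pc qc in \<open>auto simp: \<gamma>_def bilinear_on_def linear_on_def whole_def
          p.add q.add p.scale q.scale l.add l.scale algebra_simps\<close>)
  qed
  have *: "(\<Sum>(v, w)\<leftarrow>zs. tensor V W v w) \<gamma> = l (\<Sum>(v, w)\<leftarrow>zs. \<beta> v w)"
    if "set zs \<subseteq> carr V \<times> carr W" for zs
    unfolding sum_list_tensor_apply using that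
    by (induction zs)
      (auto simp: tensor_def \<gamma> l.add l.zero, auto simp: \<gamma>_def p(3) q(3))
  from eq *[OF xs] *[OF ys] have "l (\<Sum>(v, w)\<leftarrow>xs. \<beta> v w) = l (\<Sum>(v, w)\<leftarrow>ys. \<beta> v w)"
    by simp
  with l1 show False by (simp add: l.diff)
qed

lemma vector_space_tensor: "vector_space (fscale ((*) :: 'k::field \<Rightarrow> 'k \<Rightarrow> 'k))"
  by (rule vector_space_fscale[OF vector_space_field])

lemma tensor_sum_in_tprod:
  fixes V :: "('k::field, 'v::ab_group_add, 'x) vspace_scheme"
  assumes "set xs \<subseteq> carr V \<times> carr W"
  shows "(\<Sum>(v, w)\<leftarrow>xs. tensor V W v w) \<in> carr (tprod V W)"
proof -
  interpret vector_space "fscale ((*) :: 'k \<Rightarrow> 'k \<Rightarrow> 'k)" by (rule vector_space_tensor)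
  show ?thesis using assms
    by (induction xs) (auto simp: tprod_def span_zero intro!: span_add intro: span_base)
qed

lemma tlift_sum:
  assumes "is_vspace V" "is_vspace W" "vector_space s" "bilinear_on V W s \<beta>"
    and "set xs \<subseteq> carr V \<times> carr W"
  shows "tlift V W \<beta> (\<Sum>(v, w)\<leftarrow>xs. tensor V W v w) = (\<Sum>(v, w)\<leftarrow>xs. \<beta> v w)"
  unfolding tlift_def using tensor_sum_in_tprod[OF assms(5)]
  by (auto intro!: the_equality exI[of _ xs] assms(5)
      intro: tensor_sum_eqD[OF assms(1-4) _ assms(5)])

lemma tprod_sumE:
  fixes V :: "('k::field, 'v::ab_group_add, 'x) vspace_scheme"
  assumes V: "is_vspace V" and W: "is_vspace W" and "x \<in> carr (tprod V W)"
  obtains xs where "set xs \<subseteq> carr V \<times> carr W" "x = (\<Sum>(v, w)\<leftarrow>xs. tensor V W v w)"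
proof -
  interpret T: vector_space "fscale ((*) :: 'k \<Rightarrow> 'k \<Rightarrow> 'k)" by (rule vector_space_tensor)
  interpret V: vector_space "scal V" using V by (simp add: is_vspace_def)
  have sub: "V.subspace (carr V)" using V by (simp add: is_vspace_def)
  have sc: "fscale (*) c (tensor V W v w) = tensor V W (scal V c v) w" for c v w
  proof
    fix \<beta>
    show "fscale (*) c (tensor V W v w) \<beta> = tensor V W (scal V c v) w \<beta>"
    proof (cases "bilinear_form V W \<beta>")
      case True
      then interpret Vector_Spaces.linear "scal V" "(*)" "\<lambda>v. \<beta> v w"
        by (simp add: bilinear_form_def)
      show ?thesis using True scale by (simp add: fscale_def tensor_def)
    qed (simp add: fscale_def tensor_def)
  qed
  from assms(3) have
    "x \<in> T.span {tensor V W v w | v w. v \<in> carr V \<and> w \<in> carr W}" by (simp add: tprod_def)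
  then have "\<exists>xs. set xs \<subseteq> carr V \<times> carr W \<and> x = (\<Sum>(v, w)\<leftarrow>xs. tensor V W v w)"
  proof (induction rule: T.span_induct_alt)
    case base
    show ?case by (rule exI[of _ "[]"]) simp
  next
    case (step c t y)
    then obtain xs v w where "set xs \<subseteq> carr V \<times> carr W"
      "y = (\<Sum>(v, w)\<leftarrow>xs. tensor V W v w)" "t = tensor V W v w" "v \<in> carr V" "w \<in> carr W"
      by auto
    then show ?case
      by (intro exI[of _ "(scal V c v, w) # xs"]) (auto simp: sc V.subspace_scale[OF sub])
  qed
  then show thesis using that by blast
qed

end

theory Submission
  imports Defs
begin

text \<open>Identify \<open>H\<^sup>* \<otimes> W\<close> with \<open>Hom(H, W)\<close>. An element of \<open>H\<^sup>* \<otimes> End(W)\<close> is then a linear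
  \<open>g : H \<rightarrow> End(W)\<close> acting by convolution, and \<open>s \<in> S\<close> gives \<open>g a w = (a \<rhd> s) \<odot> w\<close>, which lies in
  the double stabilizer. The resulting map is injective because its kernel is a proper \<open>H\<close>-stable
  ideal.

  For surjectivity let \<open>\<pi> : W \<rightarrow> S\<close> be \<open>S\<close>-linear, \<open>w\<^sub>0 \<in> W\<close>, \<open>c \<in> H\<close>. Then
  \<open>(\<S>\<^sup>-\<^sup>1(c\<^sub>(\<^sub>1\<^sub>)) \<rhd> \<pi>(_)) \<odot> w\<^sub>0 \<otimes> c\<^sub>(\<^sub>2\<^sub>)\<close> belongs to \<open>Stab\<^sub>S(W)\<close>, and commuting with these elements
  determines \<open>g\<close> as soon as \<open>1\<close> is a sum of elements \<open>b \<rhd> \<pi>(w)\<close>. Such elements span an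
  \<open>H\<close>-stable ideal, so it suffices that \<open>Hom\<^sub>S(W, S) \<noteq> 0\<close>.

  To see the latter, put \<open>E(Z) = Hom\<^sub>S(Ind W, Z)\<close> with \<open>Ind W\<close> the \<open>S#H\<close>-module induced by \<open>W\<close>, and
  choose a submodule \<open>V\<close> of the \<open>S\<close>-module \<open>S\<^sup>*\<close> maximizing \<open>dim E(V) / dim V\<close>. As \<open>E\<close> is left exact
  and every cocyclic module embeds into \<open>S\<^sup>*\<close>, this ratio bounds \<open>dim E(Z) / dim Z\<close> for all \<open>Z\<close>. The
  coinduced module \<open>N = Hom(H, V)\<close> attains the bound because \<open>Ind W\<close> is an \<open>S#H\<close>-module, hence so
  do all its submodules. By \<open>H\<close>-simplicity a minimal left ideal of \<open>S\<close> embeds into \<open>N\<close>.\<close>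

section \<open>Linear algebra\<close>

text \<open>W carries no action of H and need be neither faithful nor projective over S, and over a
  general finite-dimensional algebra even a simple module may fail to embed into the algebra. So a
  non-zero S-linear map from W to S has to be forced by H-simplicity, and this is done by counting
  dimensions. The quotients N/Y obey the bound that N attains, which reverses the inequality for the
  submodules Y of N: dim E(Y) * dim V \<ge> dim E(V) * dim Y. Hence E(Y) is non-zero as soon as Y
  is. For Y a copy of a minimal left ideal this gives a non-zero S-linear map p from Ind W to S. It
  descends to W because S is itself an S#H-module: for each b in H the map taking w to antipode(b1)
  \<rhd> p(b2 w) is S-linear on W, and p can be recovered from these maps.

  The actions are written with the inverse of the antipode, given only as \<open>inv\<close>.
  Nothing can be computed with it before the antipode is known to be bijective, which is derived
  from a non-zero integral in the dual of H.\<close>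

definition lin :: "('k \<Rightarrow> 'v \<Rightarrow> 'v::ab_group_add) \<Rightarrow> ('k \<Rightarrow> 'w \<Rightarrow> 'w::ab_group_add) \<Rightarrow> ('v \<Rightarrow> 'w) \<Rightarrow> bool"
  where "lin s t f \<longleftrightarrow> (\<forall>x y. f (x + y) = f x + f y) \<and> (\<forall>c x. f (s c x) = t c (f x))"

lemma lin_add: "lin s t f \<Longrightarrow> f (x + y) = f x + f y"
  and lin_scale: "lin s t f \<Longrightarrow> f (s c x) = t c (f x)"
  by (auto simp: lin_def)

lemma lin_zero: "lin s t f \<Longrightarrow> f 0 = 0"
  using lin_add[of s t f 0 0] by simp

lemma lin_sum: "lin s t f \<Longrightarrow> f (sum g A) = (\<Sum>x\<in>A. f (g x))"
  by (induction A rule: infinite_finite_induct) (auto simp: lin_zero lin_add)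

lemma lin_sum_list: "lin s t f \<Longrightarrow> f (\<Sum>(a, b)\<leftarrow>xs. g a b) = (\<Sum>(a, b)\<leftarrow>xs. f (g a b))"
  by (induction xs) (auto simp: lin_zero lin_add)

text \<open>\<open>lin\<close> leaves out the vector space axioms bundled in
  \<open>Vector_Spaces.linear\<close>. Linearity of a composite expression can then be derived from
  its syntax by the rules \<open>linI\<close>, with the axioms as separate side conditions.\<close>

lemma linear_iff_lin:
  "Vector_Spaces.linear s t f \<longleftrightarrow> vector_space s \<and> vector_space t \<and> lin s t f"
  by (auto simp: Vector_Spaces.linear_iff lin_def)

lemma lin_minus: "lin s t f \<Longrightarrow> f (- x) = - f x"
  using lin_add[of s t f "- x" x] lin_zero[of s t f] by (simp add: eq_neg_iff_add_eq_0)

lemma lin_diff: "lin s t f \<Longrightarrow> f (x - y) = f x - f y"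
  using lin_add[of s t f x "- y"] lin_minus[of s t f y] by simp

lemma sum_apply: "sum g A x = (\<Sum>i\<in>A. g i x)"
  by (induction A rule: infinite_finite_induct) auto

abbreviation subsp :: "('k::field \<Rightarrow> 'v \<Rightarrow> 'v::ab_group_add) \<Rightarrow> 'v set \<Rightarrow> bool"
  where "subsp \<equiv> module.subspace"

text \<open>Finiteness is attached to a subset because most modules below are spaces of functions
  inside full function types, whose ambient space is in general infinite-dimensional.\<close>

definition fd :: "('k::field \<Rightarrow> 'v \<Rightarrow> 'v::ab_group_add) \<Rightarrow> 'v set \<Rightarrow> bool"
  where "fd s A \<longleftrightarrow> (\<exists>B. finite B \<and> A \<subseteq> module.span s B)"

abbreviation vdim :: "('k::field \<Rightarrow> 'v \<Rightarrow> 'v::ab_group_add) \<Rightarrow> 'v set \<Rightarrow> nat"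
  where "vdim \<equiv> vector_space.dim"

context vector_space begin

lemma subspI: "0 \<in> A \<Longrightarrow> (\<And>x y. x \<in> A \<Longrightarrow> y \<in> A \<Longrightarrow> x + y \<in> A) \<Longrightarrow>
    (\<And>c x. x \<in> A \<Longrightarrow> scale c x \<in> A) \<Longrightarrow> subspace A"
  by (simp add: subspace_def)

lemma fd_subset: "fd scale B \<Longrightarrow> A \<subseteq> B \<Longrightarrow> fd scale A"
  by (auto simp: fd_def)

lemma fd_independent_finite: "fd scale A \<Longrightarrow> C \<subseteq> A \<Longrightarrow> independent C \<Longrightarrow> finite C"
  unfolding fd_def using independent_span_bound[of _ C] by blast

lemma fd_basis:
  assumes "fd scale A" "subspace A"
  obtains C where "finite C" "C \<subseteq> A" "independent C" "span C = A" "dim A = card C"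
proof -
  obtain C where C: "C \<subseteq> A" "independent C" "A \<subseteq> span C" "card C = dim A"
    using basis_exists[of A] by auto
  show thesis
    by (rule that[of C]) (use C assms fd_independent_finite span_minimal[of C A] in auto)
qed

lemma fd_independent_card: 
  assumes "fd scale A" "C \<subseteq> A" "independent C" shows "card C \<le> dim A"
proof -
  obtain C' where C': "C \<subseteq> C'" "C' \<subseteq> A" "independent C'" "A \<subseteq> span C'"
    using maximal_independent_subset_extend[OF assms(2,3)] by blast
  have "finite C'" using fd_independent_finite[OF assms(1) C'(2,3)] .
  then show ?thesis using basis_card_eq_dim[OF C'(2,4,3)] card_mono[OF _ C'(1)] by simp
qed

lemma fd_dim_mono:
  assumes "fd scale B" "A \<subseteq> B" shows "dim A \<le> dim B"
proof -
  obtain C where "C \<subseteq> A" "independent C" "A \<subseteq> span C" "card C = dim A"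
    using basis_exists[of A] by auto
  then show ?thesis using fd_independent_card[OF assms(1), of C] assms(2) by simp
qed

lemma fd_subspace_eq:
  assumes "fd scale B" "subspace A" "subspace B" "A \<subseteq> B" "dim B \<le> dim A" shows "A = B"
proof (rule ccontr)
  assume "A \<noteq> B"
  then obtain x where x: "x \<in> B" "x \<notin> A" using assms by auto
  obtain C where C: "finite C" "C \<subseteq> A" "independent C" "span C = A" "dim A = card C"
    using fd_basis[OF fd_subset[OF assms(1,4)] assms(2)] .
  have "independent (insert x C)" "x \<notin> C" using C x by (auto simp: independent_insert)
  with fd_independent_card[OF assms(1), of "insert x C"] C x assms show False by auto
qed

lemma dim_pos:
  assumes "fd scale A" "x \<in> A" "x \<noteq> 0" shows "0 < dim A"
proof -
  have "card {x} \<le> dim A" by (rule fd_independent_card) (use assms in auto)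
  then show ?thesis by simp
qed

lemma dim_pos_ex:
  assumes "0 < dim A" shows "\<exists>x\<in>A. x \<noteq> 0"
proof (rule ccontr)
  assume "\<not> ?thesis"
  then have "A \<subseteq> span {}" by auto
  then show False using dim_le_card[of A "{}"] assms by simp
qed

text \<open>Stated for a family, so that injectivity comes along and the dimension of the span is
  the size of the index set.\<close>

lemma independent_family:
  assumes I: "finite I" and ind: "\<forall>c. (\<Sum>i\<in>I. scale (c i) (v i)) = 0 \<longrightarrow> (\<forall>i\<in>I. c i = 0)"
  shows "inj_on v I" "independent (v ` I)"
proof -
  show inj: "inj_on v I"
  proof (rule inj_onI, rule ccontr)
    fix i j assume ij: "i \<in> I" "j \<in> I" "v i = v j" "i \<noteq> j"
    let ?c = "\<lambda>k. if k = i then 1 else if k = j then - 1 else (0::'a)"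
    have "(\<Sum>k\<in>I. scale (?c k) (v k)) = (\<Sum>k\<in>{i, j}. scale (?c k) (v k))"
      by (rule sum.mono_neutral_right) (use I ij in auto)
    also have "\<dots> = 0" using ij by simp
    finally show False using spec[OF ind, of ?c] ij by auto
  qed
  show "independent (v ` I)"
  proof (rule independent_if_scalars_zero)
    show "finite (v ` I)" using I by simp
    fix f x assume s: "(\<Sum>x\<in>v ` I. scale (f x) x) = 0" and x: "x \<in> v ` I"
    from s have "(\<Sum>i\<in>I. scale (f (v i)) (v i)) = 0" by (simp add: sum.reindex[OF inj])
    with spec[OF ind, of "f \<circ> v"] x show "f x = 0" by auto
  qed
qed

end

lemma rank_nullity:
  assumes s: "vector_space s" and t: "vector_space t" and T: "lin s t T"
    and A: "subsp s A" and fdA: "fd s A"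
  shows "vdim s A = vdim s {x\<in>A. T x = 0} + vdim t (T ` A)" "fd t (T ` A)" "subsp t (T ` A)"
proof -
  interpret s: vector_space s by fact
  interpret t: vector_space t by fact
  interpret T: Vector_Spaces.linear s t T using assms linear_iff_lin by blast
  let ?K = "{x\<in>A. T x = 0}"
  have K: "s.subspace ?K" using A by (auto simp: s.subspace_def T.add T.scale T.zero)
  obtain C where C: "finite C" "C \<subseteq> ?K" "s.independent C" "s.span C = ?K" "s.dim ?K = card C"
    using s.fd_basis[OF s.fd_subset[OF fdA] K] by auto
  obtain C' where C': "C \<subseteq> C'" "C' \<subseteq> A" "s.independent C'" "A \<subseteq> s.span C'"
    using s.maximal_independent_subset_extend[of C A] C by auto
  have finC': "finite C'" using s.fd_independent_finite[OF fdA C'(2,3)] .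
  have spanC': "s.span C' = A" using C' A s.span_minimal by blast
  show sub: "t.subspace (T ` A)" by (rule T.subspace_image[OF A])
  have TA: "T ` A = t.span (T ` (C' - C))"
  proof -
    have "T ` A = t.span (T ` C')" using T.span_image[of C'] spanC' by simp
    also have "\<dots> = t.span (T ` (C' - C))"
    proof (rule subset_antisym)
      have "T x \<in> t.span (T ` (C' - C))" if "x \<in> C'" for x
      proof (cases "x \<in> C")
        case True
        then have "T x = 0" using C(2) by blast
        then show ?thesis by (simp add: t.span_zero)
      next
        case False
        then show ?thesis using that by (intro t.span_base) auto
      qed
      then show "t.span (T ` C') \<subseteq> t.span (T ` (C' - C))"
        by (intro t.span_minimal t.subspace_span) auto
      show "t.span (T ` (C' - C)) \<subseteq> t.span (T ` C')" by (rule t.span_mono) auto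
    qed
    finally show ?thesis .
  qed
  then show "fd t (T ` A)" unfolding fd_def using finC' by (intro exI[of _ "T ` (C' - C)"]) auto
  have ind: "c i = 0" if "(\<Sum>i\<in>C' - C. t (c i) (T i)) = 0" "i \<in> C' - C" for c i
  proof -
    have "T (\<Sum>i\<in>C' - C. s (c i) i) = 0" using that(1) by (simp add: T.sum T.scale)
    moreover have "(\<Sum>i\<in>C' - C. s (c i) i) \<in> A"
      using C' A by (intro s.subspace_sum[OF A] s.subspace_scale[OF A]) auto
    ultimately have "(\<Sum>i\<in>C' - C. s (c i) i) \<in> s.span C" using C(4) by auto
    then obtain d where d: "(\<Sum>i\<in>C' - C. s (c i) i) = (\<Sum>i\<in>C. s (d i) i)"
      using s.span_finite[OF C(1)] by auto
    let ?e = "\<lambda>i. if i \<in> C then - d i else c i"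
    have "(\<Sum>i\<in>C'. s (?e i) i) = (\<Sum>i\<in>C. s (?e i) i) + (\<Sum>i\<in>C' - C. s (?e i) i)"
      using C'(1) finC' sum.subset_diff[of C C' "\<lambda>i. s (?e i) i"] by (simp add: add.commute)
    also have "\<dots> = 0" by (simp add: d sum_negf)
    finally have "?e i = 0" using that(2) s.independentD[OF C'(3) finC' order_refl, of ?e i] by auto
    with that(2) show ?thesis by simp
  qed
  have "card (T ` (C' - C)) = card (C' - C)" "t.independent (T ` (C' - C))"
    using t.independent_family[of "C' - C" T] ind finC' by (auto simp: card_image)
  then have "t.dim (T ` A) = card (C' - C)" unfolding TA
    using t.dim_span_eq_card_independent by metis
  moreover have "s.dim A = card C'" using s.basis_card_eq_dim C' by metis
  ultimately show "s.dim A = s.dim ?K + t.dim (T ` A)"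
    using C C' finC' by (simp add: card_Diff_subset card_mono)
qed

definition Lin :: "('k::field \<Rightarrow> 'v \<Rightarrow> 'v::ab_group_add) \<Rightarrow> ('k \<Rightarrow> 'w \<Rightarrow> 'w::ab_group_add) \<Rightarrow> 'w set \<Rightarrow> ('v \<Rightarrow> 'w) set"
  where "Lin s t E = {f. lin s t f \<and> (\<forall>x. f x \<in> E)}"

locale basis_of = vector_space scl for scl :: "'k::field \<Rightarrow> 'v::ab_group_add \<Rightarrow> 'v" +
  fixes B :: "'v set"
  assumes finB: "finite B" and indB: "independent B" and spanB: "span B = UNIV"
begin

definition crd :: "'v \<Rightarrow> 'v \<Rightarrow> 'k" where "crd b x = representation B x b"

lemma crd_lin: "lin scl (*) (crd b)"
  by (simp add: lin_def crd_def representation_add[OF indB] representation_scale[OF indB] spanB)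

lemma crd_expand: "(\<Sum>b\<in>B. scl (crd b x) b) = x"
  unfolding crd_def by (rule sum_representation_eq[OF indB _ finB order_refl]) (simp add: spanB)

lemma crd_basis: "b \<in> B \<Longrightarrow> c \<in> B \<Longrightarrow> crd b c = (if b = c then 1 else 0)"
  by (simp add: crd_def representation_basis[OF indB])

lemma lin_crd:
  assumes "lin scl t f" shows "(\<Sum>b\<in>B. t (crd b x) (f b)) = f x"
proof -
  have "f x = f (\<Sum>b\<in>B. scl (crd b x) b)" by (simp add: crd_expand)
  also have "\<dots> = (\<Sum>b\<in>B. t (crd b x) (f b))" by (simp add: lin_sum[OF assms] lin_scale[OF assms])
  finally show ?thesis ..
qed

lemma crd_zeroD: "(\<And>b. b \<in> B \<Longrightarrow> crd b x = 0) \<Longrightarrow> x = 0"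
  by (subst crd_expand[symmetric]) simp

text \<open>The maps x \<mapsto> \<open>t (crd b x) c\<close>, with b in \<open>B\<close> and c in a
  basis of \<open>E\<close>, form a basis. For the coinduced module this gives dim N = dim H * dim
  V, on which the comparison of ratios rests.\<close>

lemma Lin_dim:
  assumes t: "vector_space t" and E: "subsp t E" and fdE: "fd t E"
  shows "subsp (fscale t) (Lin scl t E)" "fd (fscale t) (Lin scl t E)"
    "vdim (fscale t) (Lin scl t E) = card B * vdim t E"
proof -
  interpret t: vector_space t by fact
  interpret f: vector_space "fscale t :: 'k \<Rightarrow> ('v \<Rightarrow> _) \<Rightarrow> _" by (rule vector_space_fscale) fact
  show sub: "f.subspace (Lin scl t E)"
    using E by (auto simp: f.subspace_def t.subspace_def Lin_def lin_def fscale_def t.scale_right_distrib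
        mult.commute algebra_simps)
  obtain C where C: "finite C" "C \<subseteq> E" "t.independent C" "t.span C = E" "t.dim E = card C"
    using t.fd_basis[OF fdE E] .
  define v where "v = (\<lambda>(b, c) x. t (crd b x) c)"
  let ?I = "B \<times> C"
  have vL: "v i \<in> Lin scl t E" if "i \<in> ?I" for i
    using that C E crd_lin by (auto simp: v_def Lin_def lin_def t.scale_left_distrib t.subspace_scale)
  have span: "Lin scl t E = f.span (v ` ?I)"
  proof
    show "f.span (v ` ?I) \<subseteq> Lin scl t E" using vL by (intro f.span_minimal[OF _ sub]) auto
    show "Lin scl t E \<subseteq> f.span (v ` ?I)"
    proof
      fix \<phi> assume \<phi>: "\<phi> \<in> Lin scl t E"
      then have "\<forall>b. \<phi> b \<in> t.span C" using C by (auto simp: Lin_def)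
      then have "\<forall>b. \<exists>d. \<phi> b = (\<Sum>c\<in>C. t (d c) c)" using t.span_finite[OF C(1)] by auto
      then obtain d where d: "\<And>b. \<phi> b = (\<Sum>c\<in>C. t (d b c) c)" by metis
      have "\<phi> = (\<Sum>b\<in>B. \<Sum>c\<in>C. fscale t (d b c) (v (b, c)))"
      proof
        fix x
        have l: "lin scl t \<phi>" using \<phi> by (simp add: Lin_def)
        have "\<phi> x = (\<Sum>b\<in>B. t (crd b x) (\<phi> b))" by (simp add: lin_crd[OF l])
        also have "\<dots> = (\<Sum>b\<in>B. \<Sum>c\<in>C. t (d b c) (t (crd b x) c))"
          by (subst d) (simp add: t.scale_sum_right mult.commute)
        also have "\<dots> = (\<Sum>b\<in>B. \<Sum>c\<in>C. fscale t (d b c) (v (b, c))) x"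
          by (simp add: fscale_def v_def sum_apply)
        finally show "\<phi> x = (\<Sum>b\<in>B. \<Sum>c\<in>C. fscale t (d b c) (v (b, c))) x" .
      qed
      also have "\<dots> \<in> f.span (v ` ?I)"
        by (intro f.span_sum f.span_scale f.span_base) auto
      finally show "\<phi> \<in> f.span (v ` ?I)" .
    qed
  qed
  show "fd (fscale t) (Lin scl t E)" unfolding fd_def using span finB C
    by (intro exI[of _ "v ` ?I"]) auto
  have ind: "k i = 0" if k0: "(\<Sum>i\<in>?I. fscale t (k i) (v i)) = 0" and iI: "i \<in> ?I" for k i
  proof -
    obtain b c where i: "i = (b, c)" "b \<in> B" "c \<in> C" using iI by auto
    have "0 = (\<Sum>i\<in>?I. fscale t (k i) (v i)) b" using k0 by simp
    also have "\<dots> = (\<Sum>i\<in>?I. t (k i) (v i b))" by (simp add: sum_apply fscale_def)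
    also have "\<dots> = (\<Sum>b'\<in>B. \<Sum>c\<in>C. t (k (b', c)) (t (crd b' b) c))"
      by (simp add: sum.cartesian_product v_def case_prod_unfold)
    also have "\<dots> = (\<Sum>b'\<in>B. if b' = b then \<Sum>c\<in>C. t (k (b', c)) c else 0)"
      using i by (intro sum.cong) (auto simp: crd_basis)
    also have "\<dots> = (\<Sum>c\<in>C. t (k (b, c)) c)" using i finB by simp
    finally show ?thesis using t.independentD[OF C(3) C(1) order_refl, of "\<lambda>c. k (b, c)" c] i by simp
  qed
  have "card (v ` ?I) = card ?I" "f.independent (v ` ?I)"
    using f.independent_family[of ?I v] ind finB C by (auto simp: card_image)
  then show "f.dim (Lin scl t E) = card B * t.dim E"
    unfolding span using f.dim_span_eq_card_independent C by (metis card_cartesian_product)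
qed

end

lemma fin_dim_basis:
  assumes "fin_dim s" obtains B where "basis_of s B"
proof -
  obtain B where "finite_dimensional_vector_space s B" using assms by (auto simp: fin_dim_def)
  then interpret finite_dimensional_vector_space s B .
  have "basis_of s B"
    by unfold_locales (use finite_Basis independent_Basis span_Basis in auto)
  then show thesis by (rule that)
qed

lemma fin_dim_fd:
  assumes "fin_dim s" shows "fd s A"
proof -
  obtain B where "basis_of s B" using fin_dim_basis[OF assms] .
  then interpret basis_of s B .
  show ?thesis unfolding fd_def by (rule exI[of _ B]) (simp add: finB spanB)
qed

lemma ex_functional_vanishing:
  assumes s: "vector_space s" and A: "subsp s A" and z: "z \<notin> A"
  obtains q where "lin s (*) q" "\<And>x. x \<in> A \<Longrightarrow> q x = 0" "q z = (1::'k::field)"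
proof -
  interpret vector_space s by fact
  interpret vector_space_pair s "(*) :: 'k \<Rightarrow> 'k \<Rightarrow> 'k"
    using vector_space_field s by (simp add: vector_space_pair_def)
  obtain C where C: "C \<subseteq> A" "independent C" "A \<subseteq> span C" using maximal_independent_subset[of A] .
  have spanC: "span C = A" using C A span_minimal by blast
  have ind: "independent (insert z C)" using C z spanC by (simp add: independent_insert)
  from linear_independent_extend[OF ind, of "\<lambda>x. if x = z then 1 else 0"]
  obtain q where q: "Vector_Spaces.linear s (*) q" "\<And>x. x \<in> insert z C \<Longrightarrow> q x = (if x = z then 1 else 0)"
    by blast
  interpret q: Vector_Spaces.linear s "(*)" q by fact
  have "q x = 0" if "x \<in> span C" for x
    by (rule q.eq_0_on_span[OF _ that]) (use q(2) C z in auto)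
  then show thesis using that[of q] q spanC by (auto simp: linear_iff_lin)
qed

section \<open>Tensor products\<close>

text \<open>Tensors are functions. With these simp rules active the simplifier turns the tensors
  \<open>x + y\<close> and \<open>0\<close> into abstractions, to which rules about \<open>tlift\<close> no longer apply.\<close>

declare plus_fun_apply [simp del] zero_fun_apply [simp del]
lemmas fun_apply = plus_fun_apply zero_fun_apply

lemma tensor_add_left: "tensor V W (v + v') w = tensor V W v w + tensor V W v' w"
  and tensor_add_right: "tensor V W v (w + w') = tensor V W v w + tensor V W v w'"
  and tensor_scale_left: "tensor V W (scal V c v) w = fscale (*) c (tensor V W v w)"
  and tensor_scale_right: "tensor V W v (scal W c w) = fscale (*) c (tensor V W v w)"
  by (auto simp: fun_eq_iff tensor_def fscale_def bilinear_form_def linear_iff_lin lin_def fun_apply)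

lemma tensor_cong_scal: "scal V = scal V' \<Longrightarrow> scal W = scal W' \<Longrightarrow> tensor V W = tensor V' W'"
  by (intro ext) (simp add: tensor_def bilinear_form_def)

lemma tensor_in_tprod: "v \<in> carr V \<Longrightarrow> w \<in> carr W \<Longrightarrow> tensor V W v w \<in> carr (tprod V W)"
  using tensor_sum_in_tprod[of "[(v, w)]" V W] by simp

lemma is_vspaceI:
  "vector_space (scal V) \<Longrightarrow> subsp (scal V) (carr V) \<Longrightarrow> is_vspace V"
  by (simp add: is_vspace_def)

lemma is_vspace_vs: "is_vspace V \<Longrightarrow> vector_space (scal V)"
  by (simp add: is_vspace_def)

lemma is_vspace_0: "is_vspace V \<Longrightarrow> 0 \<in> carr V"
  and is_vspace_add: "is_vspace V \<Longrightarrow> x \<in> carr V \<Longrightarrow> y \<in> carr V \<Longrightarrow> x + y \<in> carr V"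
  and is_vspace_scale: "is_vspace V \<Longrightarrow> x \<in> carr V \<Longrightarrow> scal V c x \<in> carr V"
proof -
  assume V: "is_vspace V"
  then interpret vector_space "scal V" by (simp add: is_vspace_def)
  from V have s: "subspace (carr V)" by (simp add: is_vspace_def)
  show "0 \<in> carr V" by (rule subspace_0[OF s])
  show "x \<in> carr V \<Longrightarrow> y \<in> carr V \<Longrightarrow> x + y \<in> carr V" by (rule subspace_add[OF s])
  show "x \<in> carr V \<Longrightarrow> scal V c x \<in> carr V" by (rule subspace_scale[OF s])
qed

lemma is_vspace_sum: "is_vspace V \<Longrightarrow> (\<And>i. i \<in> I \<Longrightarrow> f i \<in> carr V) \<Longrightarrow> sum f I \<in> carr V"
  by (induction I rule: infinite_finite_induct) (auto simp: is_vspace_0 is_vspace_add)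

lemma is_vspace_sum_list:
  "is_vspace V \<Longrightarrow> (\<And>a b. (a, b) \<in> set xs \<Longrightarrow> f a b \<in> carr V) \<Longrightarrow> (\<Sum>(a, b)\<leftarrow>xs. f a b) \<in> carr V"
  by (induction xs) (auto simp: is_vspace_0 is_vspace_add)

lemma is_vspace_tprod: "is_vspace (tprod (V :: ('k::field, 'v::ab_group_add, 'x) vspace_scheme) W)"
proof -
  interpret T: vector_space "fscale ((*) :: 'k \<Rightarrow> 'k \<Rightarrow> 'k)" by (rule vector_space_tensor)
  show ?thesis
    by (simp add: is_vspace_def tprod_def T.subspace_span T.vector_space_axioms)
qed

lemma scal_tprod [simp]: "scal (tprod V W) = fscale (*)"
  by (simp add: tprod_def)

lemma tprod_induct [consumes 3, case_names zero tensor add]: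
  assumes V: "is_vspace V" and W: "is_vspace W" and x: "x \<in> carr (tprod V W)"
    and zero: "P 0"
    and tensor: "\<And>v w. v \<in> carr V \<Longrightarrow> w \<in> carr W \<Longrightarrow> P (tensor V W v w)"
    and add: "\<And>x y. x \<in> carr (tprod V W) \<Longrightarrow> y \<in> carr (tprod V W) \<Longrightarrow> P x \<Longrightarrow> P y \<Longrightarrow> P (x + y)"
  shows "P x"
proof -
  obtain xs where xs: "set xs \<subseteq> carr V \<times> carr W" "x = (\<Sum>(v, w)\<leftarrow>xs. tensor V W v w)"
    using tprod_sumE[OF V W x] .
  have "(\<Sum>(v, w)\<leftarrow>xs. tensor V W v w) \<in> carr (tprod V W) \<and> P (\<Sum>(v, w)\<leftarrow>xs. tensor V W v w)"
    using xs(1)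
    by (induction xs)
      (auto simp: zero is_vspace_0[OF is_vspace_tprod] intro!: tensor add tensor_in_tprod is_vspace_add[OF is_vspace_tprod])
  then show ?thesis using xs(2) by simp
qed

lemma tlift_tensor:
  assumes "is_vspace V" "is_vspace W" "vector_space s" "bilinear_on V W s \<beta>"
    and "v \<in> carr V" "w \<in> carr W"
  shows "tlift V W \<beta> (tensor V W v w) = \<beta> v w"
  using tlift_sum[OF assms(1-4), of "[(v, w)]"] assms(5,6) by simp

lemma tlift_add:
  assumes "is_vspace V" "is_vspace W" "vector_space s" "bilinear_on V W s \<beta>"
    and "x \<in> carr (tprod V W)" "y \<in> carr (tprod V W)"
  shows "tlift V W \<beta> (x + y) = tlift V W \<beta> x + tlift V W \<beta> y"
proof -
  obtain xs where xs: "set xs \<subseteq> carr V \<times> carr W" "x = (\<Sum>(v, w)\<leftarrow>xs. tensor V W v w)"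
    using tprod_sumE[OF assms(1,2,5)] .
  obtain ys where ys: "set ys \<subseteq> carr V \<times> carr W" "y = (\<Sum>(v, w)\<leftarrow>ys. tensor V W v w)"
    using tprod_sumE[OF assms(1,2,6)] .
  have "x + y = (\<Sum>(v, w)\<leftarrow>xs @ ys. tensor V W v w)" by (simp add: xs ys)
  with xs ys show ?thesis
    using tlift_sum[OF assms(1-4), of "xs @ ys"] tlift_sum[OF assms(1-4), of xs] tlift_sum[OF assms(1-4), of ys]
    by simp
qed

lemma tlift_zero:
  assumes "is_vspace V" "is_vspace W" "vector_space s" "bilinear_on V W s \<beta>"
  shows "tlift V W \<beta> 0 = 0"
  using tlift_sum[OF assms, of "[]"] by simp

lemma bilinear_onD:
  assumes "bilinear_on V W s \<beta>"
  shows "v \<in> carr V \<Longrightarrow> w \<in> carr W \<Longrightarrow> w' \<in> carr W \<Longrightarrow> \<beta> v (w + w') = \<beta> v w + \<beta> v w'"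
    "v \<in> carr V \<Longrightarrow> w \<in> carr W \<Longrightarrow> \<beta> v (scal W c w) = s c (\<beta> v w)"
    "v \<in> carr V \<Longrightarrow> v' \<in> carr V \<Longrightarrow> w \<in> carr W \<Longrightarrow> \<beta> (v + v') w = \<beta> v w + \<beta> v' w"
    "v \<in> carr V \<Longrightarrow> w \<in> carr W \<Longrightarrow> \<beta> (scal V c v) w = s c (\<beta> v w)"
  using assms by (auto simp: bilinear_on_def linear_on_def whole_def)

lemma fscale_field_zero: "fscale (*) c 0 = (0 :: _ \<Rightarrow> 'k::field)"
  by (auto simp: fscale_def fun_eq_iff fun_apply)

lemma tlift_scale:
  assumes V: "is_vspace V" and W: "is_vspace W" and s: "vector_space s" and b: "bilinear_on V W s \<beta>"
    and x: "x \<in> carr (tprod V W)"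
  shows "tlift V W \<beta> (fscale (*) c x) = s c (tlift V W \<beta> x)"
proof -
  interpret vector_space s by fact
  show ?thesis using V W x
  proof (induction x rule: tprod_induct)
    case zero
    show ?case by (simp add: fscale_field_zero tlift_zero[OF V W s b])
  next
    case (tensor v w)
    then show ?case
      by (simp add: tensor_scale_left[symmetric] tlift_tensor[OF V W s b] is_vspace_scale[OF V]
          bilinear_onD[OF b])
  next
    case (add x y)
    have "fscale (*) c (x + y) = fscale (*) c x + fscale (*) c y"
      by (auto simp: fscale_def algebra_simps fun_eq_iff fun_apply)
    with add show ?case
      using is_vspace_scale[OF is_vspace_tprod[of V W]]
      by (simp add: tlift_add[OF V W s b] scale_right_distrib)
  qed
qed

lemma tlift_outside: "x \<notin> carr (tprod V W) \<Longrightarrow> tlift V W \<beta> x = 0"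
  by (simp add: tlift_def)

lemma tlift_in:
  assumes "is_vspace V" "is_vspace W" "vector_space s" "bilinear_on V W s \<beta>"
    and "x \<in> carr (tprod V W)" "is_vspace U"
    and "\<And>v w. v \<in> carr V \<Longrightarrow> w \<in> carr W \<Longrightarrow> \<beta> v w \<in> carr U"
  shows "tlift V W \<beta> x \<in> carr U"
  using assms(1,2,5)
  by (induction x rule: tprod_induct)
    (auto simp: tlift_zero[OF assms(1-4)] tlift_add[OF assms(1-4)] tlift_tensor[OF assms(1-4)]
      is_vspace_0[OF assms(6)] is_vspace_add[OF assms(6)] assms(7))

lemma whole_simps [simp]: "carr (whole s) = UNIV" "scal (whole s) = s"
  by (auto simp: whole_def)

lemma bilinear_on_wholeI:
  "(\<And>v. lin t s (\<beta> v)) \<Longrightarrow> (\<And>w. lin u s (\<lambda>v. \<beta> v w)) \<Longrightarrow> bilinear_on (whole u) (whole t) s \<beta>"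
  by (auto simp: bilinear_on_def linear_on_def lin_def)

section \<open>Sweedler calculus\<close>

named_theorems linI

lemma lin_id [linI]: "lin s s (\<lambda>x. x)" by (simp add: lin_def)
lemma lin_plus [linI]: "vector_space t \<Longrightarrow> lin s t f \<Longrightarrow> lin s t g \<Longrightarrow> lin s t (\<lambda>x. f x + g x)"
  by (auto simp: lin_def vector_space_def)
lemma lin_scale_fun [linI]: "vector_space t \<Longrightarrow> lin s (*) f \<Longrightarrow> lin s t (\<lambda>x. t (f x) v)"
  by (auto simp: lin_def vector_space_def)
lemma lin_scale_const [linI]: "vector_space t \<Longrightarrow> lin s t f \<Longrightarrow> lin s t (\<lambda>x. t c (f x))"
  by (auto simp: lin_def vector_space_def mult.commute)
lemma lin_field_left [linI]: "lin s (*) f \<Longrightarrow> lin s (*) (\<lambda>x. f x * (c::'k::field))"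
  by (auto simp: lin_def algebra_simps)
lemma lin_field_right [linI]: "lin s (*) f \<Longrightarrow> lin s (*) (\<lambda>x. (c::'k::field) * f x)"
  by (auto simp: lin_def algebra_simps)
lemma lin_comp: "lin s t f \<Longrightarrow> lin r s g \<Longrightarrow> lin r t (\<lambda>x. f (g x))"
  by (auto simp: lin_def)
lemma lin_sum_fun [linI]: "vector_space t \<Longrightarrow> (\<And>i. i \<in> I \<Longrightarrow> lin s t (\<lambda>x. f x i)) \<Longrightarrow> lin s t (\<lambda>x. \<Sum>i\<in>I. f x i)"
proof -
  assume "vector_space t" and *: "\<And>i. i \<in> I \<Longrightarrow> lin s t (\<lambda>x. f x i)"
  then interpret vector_space t by simp
  show ?thesis using * by (auto simp: lin_def sum.distrib scale_sum_right)
qed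

lemma sum_list_sum_swap:
  "(\<Sum>(a, b)\<leftarrow>xs. \<Sum>i\<in>I. f a b i) = (\<Sum>i\<in>I. \<Sum>(a, b)\<leftarrow>xs. f a b i :: 'z::ab_group_add)"
  by (induction xs) (auto simp: sum.distrib case_prod_unfold)

lemma lin_sum_list_fun:
  assumes "vector_space t" "\<And>a b. lin s t (\<lambda>x. f x a b)"
  shows "lin s t (\<lambda>x. \<Sum>(a, b)\<leftarrow>xs. f x a b)"
proof -
  interpret vector_space t by fact
  show ?thesis
    by (induction xs) (use assms(2) in \<open>auto simp: lin_def algebra_simps scale_right_distrib\<close>)
qed

definition blin :: "('k::field \<Rightarrow> 'h \<Rightarrow> 'h::ab_group_add) \<Rightarrow> ('k \<Rightarrow> 'z \<Rightarrow> 'z::ab_group_add) \<Rightarrow> ('h \<Rightarrow> 'h \<Rightarrow> 'z) \<Rightarrow> bool"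
  where "blin s t \<beta> \<longleftrightarrow> (\<forall>a. lin s t (\<beta> a)) \<and> (\<forall>b. lin s t (\<lambda>a. \<beta> a b))"

lemma blinI: "(\<And>a. lin s t (\<lambda>b. \<beta> a b)) \<Longrightarrow> (\<And>b. lin s t (\<lambda>a. \<beta> a b)) \<Longrightarrow> blin s t \<beta>"
  by (simp add: blin_def)

definition tlin :: "('k::field \<Rightarrow> 'h \<Rightarrow> 'h::ab_group_add) \<Rightarrow> ('k \<Rightarrow> 'z \<Rightarrow> 'z::ab_group_add) \<Rightarrow> ('h \<Rightarrow> 'h \<Rightarrow> 'h \<Rightarrow> 'z) \<Rightarrow> bool"
  where "tlin s t \<beta> \<longleftrightarrow> (\<forall>a b. lin s t (\<lambda>c. \<beta> a b c)) \<and> (\<forall>a c. lin s t (\<lambda>b. \<beta> a b c)) \<and> (\<forall>b c. lin s t (\<lambda>a. \<beta> a b c))"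

lemma tlinI: "(\<And>a b. lin s t (\<lambda>c. \<beta> a b c)) \<Longrightarrow> (\<And>a c. lin s t (\<lambda>b. \<beta> a b c)) \<Longrightarrow>
   (\<And>b c. lin s t (\<lambda>a. \<beta> a b c)) \<Longrightarrow> tlin s t \<beta>"
  by (simp add: tlin_def)

locale hopf_fd =
  fixes H :: "('k::field, 'h::ring_1) hopf"
  assumes hopf: "hopf_algebra H" and fin_dim_H: "fin_dim (hscale H)"
begin

abbreviation "hs \<equiv> hscale H"
abbreviation "S \<equiv> antipode H"
abbreviation "\<epsilon> \<equiv> counit H"

lemma vs_hs [simp]: "vector_space hs"
  using hopf by (simp add: hopf_algebra_def algebra_over_def)

lemma vs_field [simp]: "vector_space ((*) :: 'k \<Rightarrow> 'k \<Rightarrow> 'k)"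
  by (rule vector_space_field)

lemma vs_fscale [simp]: "vector_space s \<Longrightarrow> vector_space (fscale s)"
  by (rule vector_space_fscale)

lemma vsp_H [simp]: "is_vspace (hsp H)"
  by (rule is_vspace_whole) simp

lemma hs_mult [simp]: "hs c x * y = hs c (x * y)" "x * hs c y = hs c (x * y)"
  using hopf by (auto simp: hopf_algebra_def algebra_over_def)

lemma lin_S: "lin hs hs S" and lin_eps: "lin hs (*) \<epsilon>"
  using hopf by (auto simp: hopf_algebra_def linear_iff_lin)

lemmas lin_S' [linI] = lin_comp[OF lin_S] and lin_eps' [linI] = lin_comp[OF lin_eps]

lemma lin_mult_left [linI]: "lin s hs f \<Longrightarrow> lin s hs (\<lambda>x. f x * c)"
  by (auto simp: lin_def algebra_simps)
lemma lin_mult_right [linI]: "lin s hs f \<Longrightarrow> lin s hs (\<lambda>x. c * f x)"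
  by (auto simp: lin_def algebra_simps)

definition cop :: "'h \<Rightarrow> ('h \<times> 'h) list"
  where "cop h = (SOME xs. comult H h = (\<Sum>(a, b)\<leftarrow>xs. tensor (hsp H) (hsp H) a b))"

text \<open>Being the sum over a fixed representative of the coproduct, \<open>sw\<close> commutes with all additive
  maps; bilinearity is only needed to identify it with \<open>sweedler\<close>.\<close>

definition sw :: "'h \<Rightarrow> ('h \<Rightarrow> 'h \<Rightarrow> 'z::ab_group_add) \<Rightarrow> 'z"
  where "sw h \<beta> = (\<Sum>(a, b)\<leftarrow>cop h. \<beta> a b)"

lemma comult_in: "comult H h \<in> carr (tprod (hsp H) (hsp H))"
  using hopf by (auto simp: hopf_algebra_def linear_on_def)

lemma cop: "comult H h = (\<Sum>(a, b)\<leftarrow>cop h. tensor (hsp H) (hsp H) a b)"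
proof -
  obtain xs where "comult H h = (\<Sum>(a, b)\<leftarrow>xs. tensor (hsp H) (hsp H) a b)"
    using tprod_sumE[OF _ _ comult_in[of h]] by auto
  then show ?thesis unfolding cop_def by (rule someI)
qed

lemma bilinear_on_blin: "blin hs t \<beta> \<Longrightarrow> bilinear_on (hsp H) (hsp H) t \<beta>"
  by (rule bilinear_on_wholeI) (auto simp: blin_def)

lemma sweedler_sw: "vector_space t \<Longrightarrow> blin hs t \<beta> \<Longrightarrow> sweedler H h \<beta> = sw h \<beta>"
  unfolding sweedler_def sw_def by (subst cop, rule tlift_sum) (auto intro: bilinear_on_blin)

text \<open>The lists \<open>cop h\<close> are chosen separately for each h and do not depend
  linearly on it. Linearity comes from \<open>comult\<close>, through the lift in
  \<open>sweedler\<close>.\<close>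

lemma lin_sweedler:
  assumes "vector_space t" "blin hs t \<beta>" shows "lin hs t (\<lambda>h. sw h \<beta>)"
proof -
  have c: "comult H (x + y) = comult H x + comult H y" "comult H (hs k x) = fscale (*) k (comult H x)" for x y k
    using hopf by (auto simp: hopf_algebra_def linear_on_def)
  have "lin hs t (\<lambda>h. sweedler H h \<beta>)"
    using assms by (auto simp: lin_def sweedler_def c comult_in bilinear_on_blin
        tlift_add[where s = t] tlift_scale[where s = t])
  then show ?thesis using assms by (simp add: sweedler_sw)
qed

lemmas lin_sw_arg = lin_comp[OF lin_sweedler]

lemma lin_sw [linI]: "vector_space t \<Longrightarrow> (\<And>a b. lin s t (\<lambda>x. f x a b)) \<Longrightarrow> lin s t (\<lambda>x. sw h (f x))"
  unfolding sw_def by (rule lin_sum_list_fun)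

lemma lin_sw2 [linI]:
  "vector_space t \<Longrightarrow> (\<And>a. lin hs t (\<lambda>b. \<beta> a b)) \<Longrightarrow> (\<And>b. lin hs t (\<lambda>a. \<beta> a b)) \<Longrightarrow> lin s hs g \<Longrightarrow>
   lin s t (\<lambda>x. sw (g x) \<beta>)"
  by (rule lin_sw_arg) (auto intro: blinI)

lemma sw_pull: "lin s t f \<Longrightarrow> f (sw h \<beta>) = sw h (\<lambda>a b. f (\<beta> a b))"
  unfolding sw_def by (rule lin_sum_list)

lemma sw_add: "sw h (\<lambda>a b. f a b + g a b) = sw h f + sw h g"
proof -
  have "(\<Sum>(a, b)\<leftarrow>xs. f a b + g a b) = (\<Sum>(a, b)\<leftarrow>xs. f a b) + (\<Sum>(a, b)\<leftarrow>xs. g a b)" for xs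
    by (induction xs) (auto simp: algebra_simps)
  then show ?thesis by (simp add: sw_def)
qed

lemma sw_zero [simp]: "sw h (\<lambda>a b. 0) = 0"
  by (simp add: sw_def case_prod_unfold)

lemma sw_scale: "vector_space t \<Longrightarrow> sw h (\<lambda>a b. t c (f a b)) = t c (sw h f)"
  using sw_pull[of t t "\<lambda>x. t c x" h f] linI(4)[of t t "\<lambda>x. x" c] by (simp add: lin_id)

lemma sw_sum: "sw h (\<lambda>a b. \<Sum>i\<in>I. f a b i) = (\<Sum>i\<in>I. sw h (\<lambda>a b. f a b i))"
  unfolding sw_def by (rule sum_list_sum_swap)

lemma sw_sum_list: "sw h (\<lambda>a b. \<Sum>(i, j)\<leftarrow>xs. f a b i j) = (\<Sum>(i, j)\<leftarrow>xs. sw h (\<lambda>a b. f a b i j))"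
  by (induction xs) (auto simp: sw_add)

lemma sw_swap: "sw g (\<lambda>a b. sw h (\<lambda>c d. f a b c d)) = sw h (\<lambda>c d. sw g (\<lambda>a b. f a b c d))"
  unfolding sw_def[of h] by (rule sw_sum_list)

lemma sw_eval: "sw h \<beta> x = sw h (\<lambda>a b. \<beta> a b x)"
proof -
  have "(\<Sum>(a, b)\<leftarrow>xs. \<beta> a b) x = (\<Sum>(a, b)\<leftarrow>xs. \<beta> a b x)" for xs
    by (induction xs) (auto simp: fun_apply)
  then show ?thesis by (simp add: sw_def)
qed

lemma sw_one: assumes "vector_space t" "blin hs t \<beta>" shows "sw 1 \<beta> = \<beta> 1 1"
proof -
  have "sweedler H 1 \<beta> = \<beta> 1 1" unfolding sweedler_def
    using hopf tlift_tensor[OF vsp_H vsp_H assms(1) bilinear_on_blin[OF assms(2)], of 1 1]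
    by (simp add: hopf_algebra_def)
  then show ?thesis using assms by (simp add: sweedler_sw)
qed

lemma lin_tensor_left: "lin s (scal V) f \<Longrightarrow> lin s (fscale (*)) (\<lambda>x. tensor V W (f x) w)"
  and lin_tensor_right: "lin s (scal W) g \<Longrightarrow> lin s (fscale (*)) (\<lambda>x. tensor V W v (g x))"
  by (auto simp: lin_def tensor_add_left tensor_add_right tensor_scale_left tensor_scale_right)

lemma lin_tensor_H_left [linI]: "lin s hs f \<Longrightarrow> lin s (fscale (*)) (\<lambda>x. tensor (hsp H) W (f x) w)"
  and lin_tensor_H_right [linI]: "lin s hs g \<Longrightarrow> lin s (fscale (*)) (\<lambda>x. tensor V (hsp H) v (g x))"
  by (auto intro: lin_tensor_left lin_tensor_right)

lemma tlift_comult: "vector_space t \<Longrightarrow> blin hs t \<beta> \<Longrightarrow> tlift (hsp H) (hsp H) \<beta> (comult H h) = sw h \<beta>"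
  using sweedler_sw[of t \<beta> h] by (simp add: sweedler_def)

lemma tlift_HH_tensor: "vector_space t \<Longrightarrow> blin hs t \<beta> \<Longrightarrow> tlift (hsp H) (hsp H) \<beta> (tensor (hsp H) (hsp H) a b) = \<beta> a b"
  by (rule tlift_tensor) (auto intro: bilinear_on_blin)

lemma lin_on_tlift:
  assumes "is_vspace V" "is_vspace W" "vector_space s" "bilinear_on V W s \<beta>"
  shows "linear_on (tprod V W) (whole s) (tlift V W \<beta>)"
  using tlift_add[OF assms] tlift_scale[OF assms] by (auto simp: linear_on_def)

lemma sw_mult:
  assumes t: "vector_space t" and b: "blin hs t \<beta>"
  shows "sw (g * h) \<beta> = sw g (\<lambda>a b. sw h (\<lambda>c d. \<beta> (a * c) (b * d)))"
proof -
  let ?T = "tensor (hsp H) (hsp H)" and ?l = "tlift (hsp H) (hsp H) \<beta>"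
  have bl: "bilinear_on (hsp H) (hsp H) t \<beta>" using b by (rule bilinear_on_blin)
  note vs_field [simp del] note vs_f = vs_fscale[OF vs_field]
  have 1: "blin hs (fscale (*)) (\<lambda>c d. ?T (a * c) (b * d))" for a b
    by (intro blinI linI)
  have 2: "blin hs (fscale (*)) (\<lambda>a b. sw h (\<lambda>c d. ?T (a * c) (b * d)))"
    by (intro blinI linI vs_f)
  have eq: "comult H (g * h) = sw g (\<lambda>a b. sw h (\<lambda>c d. ?T (a * c) (b * d)))"
  proof -
    have "comult H (g * h) = sweedler H g (\<lambda>a b. sweedler H h (\<lambda>c d. ?T (a * c) (b * d)))"
      using hopf unfolding hopf_algebra_def by blast
    then show ?thesis by (simp only: sweedler_sw[OF vs_f 1] sweedler_sw[OF vs_f 2])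
  qed
  have "?l (\<Sum>(a, b)\<leftarrow>cop g. \<Sum>(c, d)\<leftarrow>cop h. ?T (a * c) (b * d)) = (\<Sum>(a, b)\<leftarrow>cop g. \<Sum>(c, d)\<leftarrow>cop h. \<beta> (a * c) (b * d))"
  proof -
    have in1: "(\<Sum>(c, d)\<leftarrow>ys. ?T (a * c) (b * d)) \<in> carr (tprod (hsp H) (hsp H))" for a b ys
      by (rule is_vspace_sum_list[OF is_vspace_tprod]) (auto intro: tensor_in_tprod)
    have in2: "(\<Sum>(a, b)\<leftarrow>xs. \<Sum>(c, d)\<leftarrow>ys. ?T (a * c) (b * d)) \<in> carr (tprod (hsp H) (hsp H))" for xs ys
      by (rule is_vspace_sum_list[OF is_vspace_tprod]) (auto intro: in1)
    have inner: "?l (\<Sum>(c, d)\<leftarrow>ys. ?T (a * c) (b * d)) = (\<Sum>(c, d)\<leftarrow>ys. \<beta> (a * c) (b * d))" for a b ys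
      by (induction ys) (auto simp: tlift_zero[OF vsp_H vsp_H t bl] tlift_add[OF vsp_H vsp_H t bl]
          tensor_in_tprod in1 tlift_HH_tensor[OF t b])
    have "?l (\<Sum>(a, b)\<leftarrow>xs. \<Sum>(c, d)\<leftarrow>ys. ?T (a * c) (b * d)) = (\<Sum>(a, b)\<leftarrow>xs. \<Sum>(c, d)\<leftarrow>ys. \<beta> (a * c) (b * d))" for xs ys
      by (induction xs) (auto simp: tlift_zero[OF vsp_H vsp_H t bl] tlift_add[OF vsp_H vsp_H t bl]
          in1 in2 inner)
    then show ?thesis .
  qed
  then have "?l (comult H (g * h)) = sw g (\<lambda>a b. sw h (\<lambda>c d. \<beta> (a * c) (b * d)))"
    by (simp only: eq sw_def)
  then show ?thesis by (simp only: tlift_comult[OF t b])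
qed

lemma tlift_sum_list:
  assumes "is_vspace V" "is_vspace W" "vector_space s" "bilinear_on V W s \<beta>"
    and "\<And>a b. (a, b) \<in> set xs \<Longrightarrow> f a b \<in> carr (tprod V W)"
  shows "tlift V W \<beta> (\<Sum>(a, b)\<leftarrow>xs. f a b) = (\<Sum>(a, b)\<leftarrow>xs. tlift V W \<beta> (f a b))"
  using assms(5)
  by (induction xs) (auto simp: tlift_zero[OF assms(1-4)] tlift_add[OF assms(1-4)]
      is_vspace_sum_list[OF is_vspace_tprod])

lemma tlift_sw:
  assumes "is_vspace V" "is_vspace W" "vector_space s" "bilinear_on V W s \<beta>"
    and "\<And>a b. f a b \<in> carr (tprod V W)"
  shows "tlift V W \<beta> (sw h f) = sw h (\<lambda>a b. tlift V W \<beta> (f a b))"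
  unfolding sw_def by (rule tlift_sum_list[OF assms(1-4)]) (rule assms(5))

lemma sw_in: "is_vspace V \<Longrightarrow> (\<And>a b. f a b \<in> carr V) \<Longrightarrow> sw h f \<in> carr V"
  unfolding sw_def by (rule is_vspace_sum_list) auto

text \<open>The coassociativity axiom is an equation in (H \<otimes> H) \<otimes> H. Lifting
  \<open>\<tau>\<close> in two stages, first over the inner and then over the outer tensor product,
  transports it to arbitrary trilinear expressions.\<close>

lemma sw_assoc:
  assumes t: "vector_space t" and b: "tlin hs t \<tau>"
  shows "sw h (\<lambda>a b. sw a (\<lambda>c d. \<tau> c d b)) = sw h (\<lambda>a b. sw b (\<lambda>c d. \<tau> a c d))"
proof -
  let ?HH = "tprod (hsp H) (hsp H)"
  let ?T = "tensor (hsp H) (hsp H)" and ?T3 = "tensor ?HH (hsp H)"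
  let ?\<beta> = "\<lambda>x b. tlift (hsp H) (hsp H) (\<lambda>c d. \<tau> c d b) x"
  let ?l = "tlift ?HH (hsp H) ?\<beta>"
  note vs_f = vs_fscale[OF vs_field]
  have bl: "blin hs t (\<lambda>c d. \<tau> c d b)" for b using b by (simp add: tlin_def blin_def)
  note bo = bilinear_on_blin[OF bl]
  have bo3: "bilinear_on ?HH (hsp H) t ?\<beta>"
  proof -
    have "?\<beta> x (b + b') = ?\<beta> x b + ?\<beta> x b' \<and> ?\<beta> x (hs k b) = t k (?\<beta> x b)"
      if "x \<in> carr ?HH" for x b b' k
    proof -
      interpret vector_space t by fact
      show ?thesis using vsp_H vsp_H that
      proof (induction x rule: tprod_induct)
        case zero
        show ?case by (simp add: tlift_zero[OF vsp_H vsp_H t bo])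
      next
        case (tensor v w)
        show ?case unfolding tlift_HH_tensor[OF t bl] using b by (simp add: tlin_def lin_def)
      next
        case (add x y)
        then show ?case by (simp add: tlift_add[OF vsp_H vsp_H t bo] algebra_simps scale_right_distrib)
      qed
    qed
    then show ?thesis using lin_on_tlift[OF vsp_H vsp_H t bo]
      by (auto simp: bilinear_on_def linear_on_def)
  qed
  have lc: "lin hs (fscale (*)) (comult H)" using hopf by (auto simp: hopf_algebra_def lin_def linear_on_def)
  have 1: "blin hs (fscale (*)) (\<lambda>a b. ?T3 (comult H a) b)"
    by (intro blinI linI lin_tensor_left) (simp add: lc)
  have 2: "blin hs (fscale (*)) (\<lambda>c d. ?T3 (?T a c) d)" for a
    by (intro blinI linI lin_tensor_left) (simp only: scal_tprod, intro linI)
  have 3: "blin hs (fscale (*)) (\<lambda>a b. sw b (\<lambda>c d. ?T3 (?T a c) d))"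
    by (intro blinI lin_sw lin_sw2 vs_f linI lin_tensor_left; simp only: scal_tprod; intro linI)
  have "sw h (\<lambda>a b. ?T3 (comult H a) b) = sw h (\<lambda>a b. sw b (\<lambda>c d. ?T3 (?T a c) d))"
  proof -
    have "sweedler H h (\<lambda>a b. ?T3 (comult H a) b) = sweedler H h (\<lambda>a b. sweedler H b (\<lambda>c d. ?T3 (?T a c) d))"
      using hopf unfolding hopf_algebra_def by blast
    then show ?thesis
      by (simp only: sweedler_sw[OF vs_f 1] sweedler_sw[OF vs_f 2] sweedler_sw[OF vs_f 3])
  qed
  then have eq: "?l (sw h (\<lambda>a b. ?T3 (comult H a) b)) = ?l (sw h (\<lambda>a b. sw b (\<lambda>c d. ?T3 (?T a c) d)))"
    by (simp only:)
  have l: "?l (sw h (\<lambda>a b. ?T3 (comult H a) b)) = sw h (\<lambda>a b. sw a (\<lambda>c d. \<tau> c d b))"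
    by (subst tlift_sw[OF is_vspace_tprod vsp_H t bo3])
      (auto simp: tensor_in_tprod comult_in tlift_tensor[OF is_vspace_tprod vsp_H t bo3] tlift_comult[OF t bl])
  have r: "?l (sw h (\<lambda>a b. sw b (\<lambda>c d. ?T3 (?T a c) d))) = sw h (\<lambda>a b. sw b (\<lambda>c d. \<tau> a c d))"
    by (simp add: tlift_sw[OF is_vspace_tprod vsp_H t bo3] sw_in[OF is_vspace_tprod] 
        tensor_in_tprod tlift_tensor[OF is_vspace_tprod vsp_H t bo3] tlift_HH_tensor[OF t bl])
  show ?thesis using eq unfolding l r .
qed

lemma sw_counit1': "sw h (\<lambda>a b. hs (\<epsilon> a) b) = h"
  and sw_counit2': "sw h (\<lambda>a b. hs (\<epsilon> b) a) = h"
  and sw_antipode1': "sw h (\<lambda>a b. S a * b) = hs (\<epsilon> h) 1"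
  and sw_antipode2': "sw h (\<lambda>a b. a * S b) = hs (\<epsilon> h) 1"
proof -
  have *: "blin hs hs (\<lambda>a b. hs (\<epsilon> a) b)" "blin hs hs (\<lambda>a b. hs (\<epsilon> b) a)"
    "blin hs hs (\<lambda>a b. S a * b)" "blin hs hs (\<lambda>a b. a * S b)"
    by (intro blinI linI vs_hs)+
  show "sw h (\<lambda>a b. hs (\<epsilon> a) b) = h"
    "sw h (\<lambda>a b. hs (\<epsilon> b) a) = h"
    "sw h (\<lambda>a b. S a * b) = hs (\<epsilon> h) 1"
    "sw h (\<lambda>a b. a * S b) = hs (\<epsilon> h) 1"
    using hopf *[THEN sweedler_sw[OF vs_hs]] by (simp_all add: hopf_algebra_def)
qed

lemma sw_counit1: "lin hs t f \<Longrightarrow> sw h (\<lambda>a b. t (\<epsilon> a) (f b)) = f h"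
  using sw_pull[of hs t f h "\<lambda>a b. hs (\<epsilon> a) b"] by (simp add: sw_counit1' lin_scale)

lemma sw_counit2: "lin hs t f \<Longrightarrow> sw h (\<lambda>a b. t (\<epsilon> b) (f a)) = f h"
  using sw_pull[of hs t f h "\<lambda>a b. hs (\<epsilon> b) a"] by (simp add: sw_counit2' lin_scale)

lemma sw_antipode1: "lin hs t f \<Longrightarrow> sw h (\<lambda>a b. f (S a * b)) = t (\<epsilon> h) (f 1)"
  using sw_pull[of hs t f h "\<lambda>a b. S a * b"] by (simp add: sw_antipode1' lin_scale)

lemma sw_antipode2: "lin hs t f \<Longrightarrow> sw h (\<lambda>a b. f (a * S b)) = t (\<epsilon> h) (f 1)"
  using sw_pull[of hs t f h "\<lambda>a b. a * S b"] by (simp add: sw_antipode2' lin_scale)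

lemma eps_one [simp]: "\<epsilon> 1 = 1" and eps_mult [simp]: "\<epsilon> (g * h) = \<epsilon> g * \<epsilon> h"
  using hopf by (auto simp: hopf_algebra_def)

end

context hopf_fd begin

declare vs_hs [linI] vs_field [linI] vs_fscale [linI]

lemma sw_cong: "(\<And>a b. f a b = g a b) \<Longrightarrow> sw h f = sw h g"
  by (simp add: sw_def)

lemma hs_one [simp]: "hs 1 x = x" "hs c (hs d x) = hs (c * d) x"
  using vs_hs unfolding vector_space_def by blast+

lemma vs_simps: "vector_space t \<Longrightarrow> t 1 x = x" "vector_space t \<Longrightarrow> t c (t d x) = t (c * d) x"
  unfolding vector_space_def by blast+

section \<open>The antipode is bijective\<close>

lemma S_one [simp]: "S 1 = 1"
proof -
  have "sw 1 (\<lambda>a b. S a * b) = S 1 * 1" by (rule sw_one[of hs]) (intro blinI linI)+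
  then show ?thesis by (simp add: sw_antipode1')
qed

lemma eps_S [simp]: "\<epsilon> (S h) = \<epsilon> h"
proof -
  have "sw h (\<lambda>a b. \<epsilon> (S a * b)) = \<epsilon> h * \<epsilon> 1" by (rule sw_antipode1) (rule lin_eps)
  moreover have "sw h (\<lambda>a b. \<epsilon> b * \<epsilon> (S a)) = \<epsilon> (S h)" by (rule sw_counit2) (intro linI)
  ultimately show ?thesis by (simp add: mult.commute)
qed

text \<open>Both sides are convolution inverse to the multiplication.\<close>

lemma S_mult: "S (x * y) = S y * S x"
proof -
  have 1: "S (x * y) = sw x (\<lambda>x1 x2. hs (\<epsilon> x2) (S (x1 * y)))"
    by (rule sw_counit2[symmetric]) (intro linI)
  have 2: "S (x1 * y) = sw y (\<lambda>y1 y2. hs (\<epsilon> y2) (S (x1 * y1)))" for x1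
    by (rule sw_counit2[symmetric]) (intro linI)
  \<comment> \<open>\<open>3\<close> and \<open>4\<close> are the two inverse properties, each with
    a spectator z: (x, y) \<mapsto> S y * S x is a right convolution inverse of the multiplication,
    and (x, y) \<mapsto> S (x * y) is a left one. Inserting \<open>3\<close> and cancelling
    \<open>4\<close> identifies them.\<close>
  have 3: "sw x2 (\<lambda>a b. sw y2 (\<lambda>c d. z * (a * (c * S d) * S b))) = hs (\<epsilon> x2) (hs (\<epsilon> y2) z)" for x2 y2 z
  proof -
    have "sw y2 (\<lambda>c d. z * (a * (c * S d) * S b)) = hs (\<epsilon> y2) (z * (a * 1 * S b))" for a b
      by (rule sw_antipode2) (intro linI)
    then have "sw x2 (\<lambda>a b. sw y2 (\<lambda>c d. z * (a * (c * S d) * S b))) = sw x2 (\<lambda>a b. hs (\<epsilon> y2) (z * (a * S b)))"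
      by simp
    also have "\<dots> = hs (\<epsilon> x2) (hs (\<epsilon> y2) (z * 1))"
      by (rule sw_antipode2[where f = "\<lambda>w. hs (\<epsilon> y2) (z * w)"]) (intro linI)
    finally show ?thesis by simp
  qed
  have 4: "sw x1 (\<lambda>p q. sw y1 (\<lambda>r t. S (p * r) * (q * t) * z)) = hs (\<epsilon> x1) (hs (\<epsilon> y1) z)" for x1 y1 z
  proof -
    have "sw x1 (\<lambda>p q. sw y1 (\<lambda>r t. S (p * r) * (q * t) * z)) = sw (x1 * y1) (\<lambda>u v. S u * v * z)"
      by (rule sw_mult[symmetric, of hs]) (intro blinI linI)+
    also have "\<dots> = hs (\<epsilon> (x1 * y1)) (1 * z)" by (rule sw_antipode1) (intro linI)
    finally show ?thesis by simp
  qed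
  have "S (x * y) = sw x (\<lambda>x1 x2. sw y (\<lambda>y1 y2. hs (\<epsilon> x2) (hs (\<epsilon> y2) (S (x1 * y1)))))"
    unfolding 1 by (subst 2) (simp only: sw_scale[OF vs_hs])
  also have "\<dots> = sw x (\<lambda>x1 x2. sw y (\<lambda>y1 y2. sw x2 (\<lambda>a b. sw y2 (\<lambda>c d. S (x1 * y1) * (a * (c * S d) * S b)))))"
    by (simp only: 3)
  also have "\<dots> = sw x (\<lambda>x1 x2. sw x2 (\<lambda>a b. sw y (\<lambda>y1 y2. sw y2 (\<lambda>c d. S (x1 * y1) * (a * (c * S d) * S b)))))"
    by (intro sw_cong sw_swap)
  also have "\<dots> = sw x (\<lambda>x1 x2. sw x1 (\<lambda>p q. sw y (\<lambda>y1 y2. sw y2 (\<lambda>c d. S (p * y1) * (q * (c * S d) * S x2)))))"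
    by (rule sw_assoc[symmetric, of hs]) (intro tlinI linI)+
  also have "\<dots> = sw x (\<lambda>x1 x2. sw x1 (\<lambda>p q. sw y (\<lambda>y1 y2. sw y1 (\<lambda>c d. S (p * c) * (q * (d * S y2) * S x2)))))"
    by (rule sw_cong, rule sw_cong, rule sw_assoc[symmetric, of hs]) (intro tlinI linI)+
  also have "\<dots> = sw x (\<lambda>x1 x2. sw y (\<lambda>y1 y2. sw x1 (\<lambda>p q. sw y1 (\<lambda>c d. S (p * c) * (q * (d * S y2) * S x2)))))"
    by (intro sw_cong sw_swap)
  also have "\<dots> = sw x (\<lambda>x1 x2. sw y (\<lambda>y1 y2. hs (\<epsilon> x1) (hs (\<epsilon> y1) (S y2 * S x2))))"
    by (simp only: 4[symmetric] mult.assoc)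
  also have "\<dots> = sw x (\<lambda>x1 x2. hs (\<epsilon> x1) (sw y (\<lambda>y1 y2. hs (\<epsilon> y1) (S y2 * S x2))))"
    by (simp only: sw_scale[OF vs_hs])
  also have "\<dots> = sw x (\<lambda>x1 x2. hs (\<epsilon> x1) (S y * S x2))"
    by (intro sw_cong arg_cong[where f = "hs _"] sw_counit1 linI)
  also have "\<dots> = S y * S x" by (rule sw_counit1) (intro linI)
  finally show ?thesis .
qed

text \<open>Uniqueness of convolution inverses once more, now for maps from H to H \<otimes> H. Step
  \<open>3\<close> shows that h \<mapsto> S h2 \<otimes> S h1 is a right inverse of the coproduct,
  step \<open>4\<close> that the coproduct of S h is a left inverse.\<close>

lemma sw_S:
  assumes t: "vector_space t" and b: "blin hs t \<beta>"
  shows "sw (S h) \<beta> = sw h (\<lambda>a b. \<beta> (S b) (S a))"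
proof -
  have b1: "lin hs t (\<beta> a)" for a using b by (simp add: blin_def)
  have b2: "lin hs t (\<lambda>a. \<beta> a b)" for b using b by (simp add: blin_def)
  note L = linI t lin_comp[OF b1] lin_comp[OF b2]
  have 3: "sw x (\<lambda>a b. sw a (\<lambda>c d. sw b (\<lambda>e f. \<beta> (p * (c * S f)) (q * (d * S e))))) = t (\<epsilon> x) (\<beta> p q)" for x p q
  proof -
    have "sw x (\<lambda>a b. sw a (\<lambda>c d. sw b (\<lambda>e f. \<beta> (p * (c * S f)) (q * (d * S e)))))
      = sw x (\<lambda>c r. sw r (\<lambda>d b. sw b (\<lambda>e f. \<beta> (p * (c * S f)) (q * (d * S e)))))"
      by (rule sw_assoc[OF t]) (intro tlinI L)
    also have "\<dots> = sw x (\<lambda>c r. sw r (\<lambda>u f. sw u (\<lambda>d e. \<beta> (p * (c * S f)) (q * (d * S e)))))"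
      by (rule sw_cong, rule sw_assoc[OF t, symmetric]) (intro tlinI L)
    also have "\<dots> = sw x (\<lambda>c r. sw r (\<lambda>u f. t (\<epsilon> u) (\<beta> (p * (c * S f)) (q * 1))))"
      by (intro sw_cong, rule sw_antipode2) (intro L)
    also have "\<dots> = sw x (\<lambda>c r. \<beta> (p * (c * S r)) (q * 1))"
      by (intro sw_cong, rule sw_counit1) (intro L)
    also have "\<dots> = t (\<epsilon> x) (\<beta> (p * 1) (q * 1))"
      by (rule sw_antipode2[where f = "\<lambda>z. \<beta> (p * z) (q * 1)"]) (intro L)
    finally show ?thesis by simp
  qed
  have 4: "sw u (\<lambda>h1 a. sw (S h1) (\<lambda>p q. sw a (\<lambda>c d. \<beta> (p * (c * z)) (q * (d * w))))) = t (\<epsilon> u) (\<beta> z w)" for u z w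
  proof -
    have "sw u (\<lambda>h1 a. sw (S h1) (\<lambda>p q. sw a (\<lambda>c d. \<beta> (p * (c * z)) (q * (d * w)))))
      = sw u (\<lambda>h1 a. sw (S h1 * a) (\<lambda>x y. \<beta> (x * z) (y * w)))"
      unfolding mult.assoc[symmetric]
      by (intro sw_cong, rule sw_mult[OF t, symmetric]) (intro blinI L)
    also have "\<dots> = t (\<epsilon> u) (sw 1 (\<lambda>x y. \<beta> (x * z) (y * w)))"
      by (rule sw_antipode1[where f = "\<lambda>v. sw v (\<lambda>x y. \<beta> (x * z) (y * w))"]) (intro L)
    also have "sw 1 (\<lambda>x y. \<beta> (x * z) (y * w)) = \<beta> (1 * z) (1 * w)"
      by (rule sw_one[OF t]) (intro blinI L)
    finally show ?thesis by simp
  qed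
  have "sw (S h) \<beta> = sw h (\<lambda>h1 h2. t (\<epsilon> h2) (sw (S h1) (\<lambda>p q. \<beta> p q)))"
    by (rule sw_counit2[symmetric]) (intro L)
  also have "\<dots> = sw h (\<lambda>h1 h2. sw (S h1) (\<lambda>p q. sw h2 (\<lambda>a b. sw a (\<lambda>c d. sw b (\<lambda>e f. \<beta> (p * (c * S f)) (q * (d * S e)))))))"
    by (simp only: 3 sw_scale[OF t])
  also have "\<dots> = sw h (\<lambda>h1 h2. sw h2 (\<lambda>a b. sw (S h1) (\<lambda>p q. sw a (\<lambda>c d. sw b (\<lambda>e f. \<beta> (p * (c * S f)) (q * (d * S e)))))))"
    by (intro sw_cong sw_swap)
  also have "\<dots> = sw h (\<lambda>u b. sw u (\<lambda>h1 a. sw (S h1) (\<lambda>p q. sw a (\<lambda>c d. sw b (\<lambda>e f. \<beta> (p * (c * S f)) (q * (d * S e)))))))"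
    by (rule sw_assoc[OF t, symmetric]) (intro tlinI L)
  also have "\<dots> = sw h (\<lambda>u b. sw u (\<lambda>h1 a. sw (S h1) (\<lambda>p q. sw b (\<lambda>e f. sw a (\<lambda>c d. \<beta> (p * (c * S f)) (q * (d * S e)))))))"
    by (intro sw_cong sw_swap)
  also have "\<dots> = sw h (\<lambda>u b. sw u (\<lambda>h1 a. sw b (\<lambda>e f. sw (S h1) (\<lambda>p q. sw a (\<lambda>c d. \<beta> (p * (c * S f)) (q * (d * S e)))))))"
    by (intro sw_cong sw_swap)
  also have "\<dots> = sw h (\<lambda>u b. sw b (\<lambda>e f. sw u (\<lambda>h1 a. sw (S h1) (\<lambda>p q. sw a (\<lambda>c d. \<beta> (p * (c * S f)) (q * (d * S e)))))))"
    by (intro sw_cong sw_swap)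
  also have "\<dots> = sw h (\<lambda>u b. t (\<epsilon> u) (sw b (\<lambda>e f. \<beta> (S f) (S e))))"
    by (simp only: 4 sw_scale[OF t])
  also have "\<dots> = sw h (\<lambda>e f. \<beta> (S f) (S e))"
    by (rule sw_counit1) (intro L)
  finally show ?thesis .
qed

section \<open>A non-zero integral in the dual of H, by way of traces\<close>

definition HB :: "'h set" where "HB = (SOME B. basis_of hs B)"

lemma HB: "basis_of hs HB"
proof -
  obtain B where "basis_of hs B" using fin_dim_basis[OF fin_dim_H] .
  then show ?thesis unfolding HB_def by (rule someI)
qed

end

sublocale hopf_fd \<subseteq> HB: basis_of "hscale H" HB
  by (rule HB)

context hopf_fd begin

abbreviation "e \<equiv> HB.crd"

lemma lin_e: "lin hs (*) (e b)" by (rule HB.crd_lin)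
lemmas lin_e' [linI] = lin_comp[OF lin_e]

lemma sw_mult_field: "sw h (\<lambda>a b. f a b * c) = sw h f * (c :: 'k)" "sw h (\<lambda>a b. c * f a b) = c * sw h f"
  using sw_scale[OF vs_field, of h c f] by (simp_all add: mult.commute)

text \<open>This is tr(fg) = tr(gf) for the coproduct H \<rightarrow> H \<otimes> H and
  \<open>\<psi>\<close>, viewed as a map H \<otimes> H \<rightarrow> H; the dual basis of H
  \<otimes> H consists of the products of coordinates.\<close>

lemma trace_swap:
  assumes p1: "\<And>u. lin hs hs (\<psi> u)" and p2: "\<And>v. lin hs hs (\<lambda>u. \<psi> u v)"
  shows "(\<Sum>i\<in>HB. sw i (\<lambda>u v. e i (\<psi> u v))) = (\<Sum>j\<in>HB. \<Sum>k\<in>HB. sw (\<psi> j k) (\<lambda>u v. e j u * e k v))"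
proof -
  have ex: "e i (\<psi> u v) = (\<Sum>j\<in>HB. \<Sum>k\<in>HB. e i (\<psi> j k) * (e j u * e k v))" for i u v
  proof -
    have "e i (\<psi> u v) = (\<Sum>j\<in>HB. e j u * e i (\<psi> j v))"
      by (rule HB.lin_crd[symmetric, where t = "(*)" and f = "\<lambda>u. e i (\<psi> u v)"]) (intro linI p2)
    also have "\<dots> = (\<Sum>j\<in>HB. e j u * (\<Sum>k\<in>HB. e k v * e i (\<psi> j k)))"
      by (intro sum.cong arg_cong[where f = "(*) _"] HB.lin_crd[symmetric, where t = "(*)"] refl) (intro linI p1)
    finally show ?thesis by (simp add: sum_distrib_left mult_ac)
  qed
  have "(\<Sum>i\<in>HB. sw i (\<lambda>u v. e i (\<psi> u v))) = (\<Sum>i\<in>HB. \<Sum>j\<in>HB. \<Sum>k\<in>HB. e i (\<psi> j k) * sw i (\<lambda>u v. e j u * e k v))"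
    by (subst ex) (simp only: sw_sum sw_mult_field)
  also have "\<dots> = (\<Sum>j\<in>HB. \<Sum>i\<in>HB. \<Sum>k\<in>HB. e i (\<psi> j k) * sw i (\<lambda>u v. e j u * e k v))"
    by (rule sum.swap)
  also have "\<dots> = (\<Sum>j\<in>HB. \<Sum>k\<in>HB. \<Sum>i\<in>HB. e i (\<psi> j k) * sw i (\<lambda>u v. e j u * e k v))"
    by (rule sum.cong[OF refl], rule sum.swap)
  also have "\<dots> = (\<Sum>j\<in>HB. \<Sum>k\<in>HB. sw (\<psi> j k) (\<lambda>u v. e j u * e k v))"
    by (intro sum.cong refl HB.lin_crd[where t = "(*)" and f = "\<lambda>i. sw i _"]) (intro linI)
  finally show ?thesis .
qed

text \<open>The Larson--Sweedler projection of \<open>H\<^sup>*\<close> onto the integrals, written as a trace.\<close>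

definition trace_integral :: "('h \<Rightarrow> 'k) \<Rightarrow> 'h \<Rightarrow> 'k"
  where "trace_integral \<alpha> a = (\<Sum>i\<in>HB. sw (a * S (S i)) (\<lambda>x y. e i x * \<alpha> y))"

lemma lin_trace_integral:
  assumes a: "lin hs (*) \<alpha>" shows "lin hs (*) (trace_integral \<alpha>)"
  unfolding trace_integral_def by (intro linI lin_comp[OF a])

text \<open>By two uses of \<open>sw_S\<close> the square of the antipode preserves the coproduct,
  so a factor S (S c) * S u = S (u * S c) arises and collapses. The right side exhibits both legs of
  the coproduct of h, which is the shape needed for \<open>trace_swap\<close>.\<close>

lemma integral_aux:
  assumes b: "lin hs (*) \<beta>" and f: "lin hs (*) f"
  shows "sw a (\<lambda>a1 a2. \<beta> a1 * f (a2 * S (S h))) = sw h (\<lambda>u v. sw (a * S (S v)) (\<lambda>x y. \<beta> (x * S u) * f y))"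
proof -
  note L = linI lin_comp[OF b] lin_comp[OF f]
  have "sw (a * S (S v)) (\<lambda>x y. \<beta> (x * S u) * f y)
     = sw v (\<lambda>c d. sw a (\<lambda>a1 a2. \<beta> (a1 * S (u * S c)) * f (a2 * S (S d))))" for u v
  proof -
    have "sw (a * S (S v)) (\<lambda>x y. \<beta> (x * S u) * f y)
      = sw a (\<lambda>a1 a2. sw (S (S v)) (\<lambda>p q. \<beta> (a1 * p * S u) * f (a2 * q)))"
      by (rule sw_mult[OF vs_field]) (intro blinI L)
    also have "\<dots> = sw a (\<lambda>a1 a2. sw (S v) (\<lambda>p q. \<beta> (a1 * S q * S u) * f (a2 * S p)))"
      by (intro sw_cong, rule sw_S[OF vs_field]) (intro blinI L)
    also have "\<dots> = sw a (\<lambda>a1 a2. sw v (\<lambda>c d. \<beta> (a1 * S (S c) * S u) * f (a2 * S (S d))))"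
      by (intro sw_cong, rule sw_S[OF vs_field]) (intro blinI L)
    also have "\<dots> = sw v (\<lambda>c d. sw a (\<lambda>a1 a2. \<beta> (a1 * S (S c) * S u) * f (a2 * S (S d))))"
      by (rule sw_swap)
    finally show ?thesis by (simp only: S_mult mult.assoc)
  qed
  then have "sw h (\<lambda>u v. sw (a * S (S v)) (\<lambda>x y. \<beta> (x * S u) * f y))
     = sw h (\<lambda>u v. sw v (\<lambda>c d. sw a (\<lambda>a1 a2. \<beta> (a1 * S (u * S c)) * f (a2 * S (S d)))))"
    by (simp only:)
  also have "\<dots> = sw h (\<lambda>w d. sw w (\<lambda>u c. sw a (\<lambda>a1 a2. \<beta> (a1 * S (u * S c)) * f (a2 * S (S d)))))"
    by (rule sw_assoc[OF vs_field, symmetric]) (intro tlinI L)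
  also have "\<dots> = sw h (\<lambda>w d. \<epsilon> w * (sw a (\<lambda>a1 a2. \<beta> (a1 * S 1) * f (a2 * S (S d)))))"
    by (intro sw_cong, rule sw_antipode2[where f = "\<lambda>z. sw a (\<lambda>a1 a2. \<beta> (a1 * S z) * f (a2 * _))"]) (intro L)
  also have "\<dots> = sw a (\<lambda>a1 a2. \<beta> (a1 * S 1) * f (a2 * S (S h)))"
    by (rule sw_counit1) (intro L)
  finally show ?thesis by simp
qed

text \<open>\<open>integral_aux\<close> turns the left side into the trace of \<open>\<psi>\<close>
  composed with the coproduct. In the opposite order the argument of \<open>\<beta>\<close> becomes
  p * S u with p and u adjacent legs of one element, so it collapses to \<open>\<beta> 1\<close> and
  the trace defining the integral remains.\<close>

lemma trace_integral_integral:
  assumes a: "lin hs (*) \<alpha>" and b: "lin hs (*) \<beta>"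
  shows "sw x (\<lambda>x1 x2. \<beta> x1 * trace_integral \<alpha> x2) = \<beta> 1 * trace_integral \<alpha> x"
proof -
  note L = linI lin_comp[OF a] lin_comp[OF b]
  define f where "f = (\<lambda>i z. sw z (\<lambda>x y. e i x * \<alpha> y))"
  have lf: "lin hs (*) (f i)" for i unfolding f_def by (intro L)
  define \<psi> where "\<psi> = (\<lambda>u v. sw (x * S (S v)) (\<lambda>p y. sw y (\<lambda>x' y'. hs (\<beta> (p * S u) * \<alpha> y') x')))"
  have p1: "lin hs hs (\<psi> u)" for u unfolding \<psi>_def by (intro L)
  have p2: "lin hs hs (\<lambda>u. \<psi> u v)" for v unfolding \<psi>_def by (intro L)
  have "sw x (\<lambda>x1 x2. \<beta> x1 * trace_integral \<alpha> x2) = (\<Sum>i\<in>HB. sw x (\<lambda>x1 x2. \<beta> x1 * f i (x2 * S (S i))))"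
    by (simp add: trace_integral_def f_def sum_distrib_left sw_sum)
  also have "\<dots> = (\<Sum>i\<in>HB. sw i (\<lambda>u v. sw (x * S (S v)) (\<lambda>p y. \<beta> (p * S u) * f i y)))"
    by (intro sum.cong refl integral_aux b lf)
  also have "\<dots> = (\<Sum>i\<in>HB. sw i (\<lambda>u v. e i (\<psi> u v)))"
    unfolding \<psi>_def f_def
    by (simp only: sw_pull[OF lin_e] lin_scale[OF lin_e] sw_mult_field(2)[symmetric] mult.assoc mult.commute[of "\<alpha> _"])
  also have "\<dots> = (\<Sum>j\<in>HB. \<Sum>k\<in>HB. sw (\<psi> j k) (\<lambda>u v. e j u * e k v))"
    by (rule trace_swap[OF p1 p2])
  also have "\<dots> = (\<Sum>j\<in>HB. \<Sum>k\<in>HB. sw (x * S (S k)) (\<lambda>p y. sw y (\<lambda>x' y'. \<beta> (p * S j) * \<alpha> y' * sw x' (\<lambda>u v. e j u * e k v))))"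
  proof -
    have l: "lin hs (*) (\<lambda>z. sw z (\<lambda>u v. e j u * e k v))" for j k by (intro L)
    show ?thesis unfolding \<psi>_def by (simp only: sw_pull[OF l] lin_scale[OF l])
  qed
  also have "\<dots> = (\<Sum>k\<in>HB. \<Sum>j\<in>HB. sw (x * S (S k)) (\<lambda>p y. sw y (\<lambda>x' y'. sw x' (\<lambda>u v. e j u * \<beta> (p * S j) * (e k v * \<alpha> y')))))"
    by (subst sum.swap) (simp only: sw_mult_field(2)[symmetric] mult_ac)
  also have "\<dots> = (\<Sum>k\<in>HB. sw (x * S (S k)) (\<lambda>p y. sw y (\<lambda>x' y'. sw x' (\<lambda>u v. (\<Sum>j\<in>HB. e j u * \<beta> (p * S j)) * (e k v * \<alpha> y')))))"
    by (simp only: sw_sum sum_distrib_right)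
  also have "\<dots> = (\<Sum>k\<in>HB. sw (x * S (S k)) (\<lambda>p y. sw y (\<lambda>x' y'. sw x' (\<lambda>u v. \<beta> (p * S u) * (e k v * \<alpha> y')))))"
  proof -
    have "(\<Sum>j\<in>HB. e j u * \<beta> (p * S j)) = \<beta> (p * S u)" for u p
      by (rule HB.lin_crd) (intro L)
    then show ?thesis by (simp only:)
  qed
  also have "\<dots> = (\<Sum>k\<in>HB. \<beta> 1 * sw (x * S (S k)) (\<lambda>x y. e k x * \<alpha> y))"
  proof (rule sum.cong[OF refl])
    fix k
    let ?z = "x * S (S k)"
    have "sw ?z (\<lambda>p y. sw y (\<lambda>x' y'. sw x' (\<lambda>u v. \<beta> (p * S u) * (e k v * \<alpha> y'))))
      = sw ?z (\<lambda>p y. sw y (\<lambda>u r. sw r (\<lambda>v y'. \<beta> (p * S u) * (e k v * \<alpha> y'))))"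
      by (rule sw_cong, rule sw_assoc[OF vs_field]) (intro tlinI L)
    also have "\<dots> = sw ?z (\<lambda>w r. sw w (\<lambda>p u. sw r (\<lambda>v y'. \<beta> (p * S u) * (e k v * \<alpha> y'))))"
      by (rule sw_assoc[OF vs_field, symmetric]) (intro tlinI L)
    also have "\<dots> = sw ?z (\<lambda>w r. \<epsilon> w * sw r (\<lambda>v y'. \<beta> 1 * (e k v * \<alpha> y')))"
      by (intro sw_cong, rule sw_antipode2[where f = "\<lambda>z. sw _ (\<lambda>v y'. \<beta> z * (e k v * \<alpha> y'))"]) (intro L)
    also have "\<dots> = sw ?z (\<lambda>v y'. \<beta> 1 * (e k v * \<alpha> y'))"
      by (rule sw_counit1) (intro L)
    finally show "sw ?z (\<lambda>p y. sw y (\<lambda>x' y'. sw x' (\<lambda>u v. \<beta> (p * S u) * (e k v * \<alpha> y')))) = \<beta> 1 * sw ?z (\<lambda>x y. e k x * \<alpha> y)"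
      by (simp only: sw_mult_field)
  qed
  also have "\<dots> = \<beta> 1 * trace_integral \<alpha> x" by (simp add: trace_integral_def sum_distrib_left)
  finally show ?thesis .
qed

text \<open>Every functional is generated by integrals: \<open>\<alpha>\<close> is the sum over j of
  the integral attached to the convolution product of e j and \<open>\<alpha>\<close>, translated by
  S j. The two factors combine to S (S i * j), so the double sum is a trace over H \<otimes> H, and
  after \<open>trace_swap\<close> the antipode axiom leaves the counit.\<close>

lemma trace_integral_expand:
  assumes a: "lin hs (*) \<alpha>"
  shows "(\<Sum>j\<in>HB. trace_integral (\<lambda>y. sw y (\<lambda>p q. e j p * \<alpha> q)) (a * S j)) = \<alpha> a"
proof -
  note L = linI lin_comp[OF a]
  define \<psi> where "\<psi> = (\<lambda>u v. sw (a * S (S u * v)) (\<lambda>w q. hs (\<alpha> q) w))"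
  have p1: "lin hs hs (\<psi> u)" for u unfolding \<psi>_def by (intro L)
  have p2: "lin hs hs (\<lambda>u. \<psi> u v)" for v unfolding \<psi>_def by (intro L)
  have "(\<Sum>j\<in>HB. trace_integral (\<lambda>y. sw y (\<lambda>p q. e j p * \<alpha> q)) (a * S j))
     = (\<Sum>j\<in>HB. \<Sum>i\<in>HB. sw (a * S (S i * j)) (\<lambda>x y. sw y (\<lambda>p q. e i x * (e j p * \<alpha> q))))"
    by (simp only: trace_integral_def S_mult mult.assoc sw_mult_field)
  also have "\<dots> = (\<Sum>j\<in>HB. \<Sum>i\<in>HB. sw (a * S (S i * j)) (\<lambda>w q. sw w (\<lambda>x p. e i x * (e j p * \<alpha> q))))"
    by (intro sum.cong refl, rule sw_assoc[OF vs_field, symmetric]) (intro tlinI L)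
  also have "\<dots> = (\<Sum>j\<in>HB. \<Sum>i\<in>HB. sw (\<psi> i j) (\<lambda>u v. e i u * e j v))"
  proof -
    have l: "lin hs (*) (\<lambda>z. sw z (\<lambda>u v. e i u * e j v))" for i j by (intro L)
    show ?thesis unfolding \<psi>_def
      by (simp only: sw_pull[OF l] lin_scale[OF l]) (simp only: sw_mult_field[symmetric] mult_ac)
  qed
  also have "\<dots> = (\<Sum>i\<in>HB. sw i (\<lambda>u v. e i (\<psi> u v)))"
    by (subst sum.swap) (rule trace_swap[OF p1 p2, symmetric])
  also have "\<dots> = (\<Sum>i\<in>HB. \<epsilon> i * sw a (\<lambda>w q. \<alpha> q * e i w))"
  proof (rule sum.cong[OF refl])
    fix i
    have "sw i (\<lambda>u v. e i (\<psi> u v)) = sw i (\<lambda>u v. sw (a * S (S u * v)) (\<lambda>w q. \<alpha> q * e i w))"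
      unfolding \<psi>_def by (simp only: sw_pull[OF lin_e] lin_scale[OF lin_e])
    also have "\<dots> = \<epsilon> i * sw (a * S 1) (\<lambda>w q. \<alpha> q * e i w)"
      by (rule sw_antipode1[where f = "\<lambda>z. sw (a * S z) (\<lambda>w q. \<alpha> q * e i w)"]) (intro L)
    finally show "sw i (\<lambda>u v. e i (\<psi> u v)) = \<epsilon> i * sw a (\<lambda>w q. \<alpha> q * e i w)" by simp
  qed
  also have "\<dots> = sw a (\<lambda>w q. (\<Sum>i\<in>HB. e i w * \<epsilon> i) * \<alpha> q)"
    by (simp only: sw_mult_field[symmetric] sw_sum[symmetric] sum_distrib_right sum_distrib_left mult_ac)
  also have "\<dots> = sw a (\<lambda>w q. \<epsilon> w * \<alpha> q)"
    by (simp only: HB.lin_crd[OF lin_eps])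
  also have "\<dots> = \<alpha> a" by (rule sw_counit1) (rule a)
  finally show ?thesis .
qed

text \<open>The expansion of \<open>\<epsilon>\<close> at 1 has total value 1, so one of the
  integrals occurring in it is non-zero.\<close>

lemma ex_integral:
  obtains l where "lin hs (*) l" "\<And>\<beta> x. lin hs (*) \<beta> \<Longrightarrow> sw x (\<lambda>x1 x2. \<beta> x1 * l x2) = \<beta> 1 * l x" "\<exists>x. l x \<noteq> 0"
proof -
  have "(\<Sum>j\<in>HB. trace_integral (\<lambda>y. sw y (\<lambda>p q. e j p * \<epsilon> q)) (1 * S j)) \<noteq> 0"
    by (subst trace_integral_expand[OF lin_eps]) simp
  then obtain j where j: "trace_integral (\<lambda>y. sw y (\<lambda>p q. e j p * \<epsilon> q)) (1 * S j) \<noteq> 0"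
    by (rule sum.not_neutral_contains_not_neutral)
  have l: "lin hs (*) (\<lambda>y. sw y (\<lambda>p q. e j p * \<epsilon> q))" by (intro linI)
  from j have "\<exists>x. trace_integral (\<lambda>y. sw y (\<lambda>p q. e j p * \<epsilon> q)) x \<noteq> 0" by blast
  with lin_trace_integral[OF l] trace_integral_integral[OF l] show thesis by (rule that)
qed

text \<open>For a left integral \<open>l\<close> one has \<open>a\<^sub>(\<^sub>1\<^sub>) l(a\<^sub>(\<^sub>2\<^sub>) S(h)) = l(a S(h\<^sub>(\<^sub>1\<^sub>))) h\<^sub>(\<^sub>2\<^sub>)\<close>, and
  \<open>l(x S(S(h\<^sub>(\<^sub>2\<^sub>))) S(h\<^sub>(\<^sub>1\<^sub>))) h\<^sub>(\<^sub>3\<^sub>) = l(x) h\<close>.\<close>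

lemma S_zeroD:
  assumes "S h = 0" shows "h = 0"
proof (rule HB.crd_zeroD)
  fix b assume "b \<in> HB"
  obtain l where l: "lin hs (*) l" "\<And>\<beta> x. lin hs (*) \<beta> \<Longrightarrow> sw x (\<lambda>x1 x2. \<beta> x1 * l x2) = \<beta> 1 * l x" "\<exists>x. l x \<noteq> 0"
    using ex_integral by blast
  from l(3) obtain x where x: "l x \<noteq> 0" by blast
  \<comment> \<open>Because S h = 0, the left side of the first identity above vanishes;
    \<open>J\<close> is the resulting vanishing of its right side, paired with
    \<open>\<beta>\<close>.\<close>
  have J: "sw h (\<lambda>h1 h2. l (a * S h1) * \<beta> h2) = 0" if b: "lin hs (*) \<beta>" for a \<beta>
  proof -
    note L = linI lin_comp[OF l(1)] lin_comp[OF b]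
    have "sw h (\<lambda>h1 h2. l (a * S h1) * \<beta> h2) = sw h (\<lambda>h1 h2. sw (a * S h1) (\<lambda>x y. \<beta> (x * h2) * l y))"
    proof (rule sw_cong)
      fix h1 h2
      have "sw (a * S h1) (\<lambda>x y. \<beta> (x * h2) * l y) = \<beta> (1 * h2) * l (a * S h1)"
        by (rule l(2)) (intro L)
      then show "l (a * S h1) * \<beta> h2 = sw (a * S h1) (\<lambda>x y. \<beta> (x * h2) * l y)"
        by (simp add: mult.commute)
    qed
    also have "\<dots> = sw h (\<lambda>h1 h2. sw a (\<lambda>a1 a2. sw (S h1) (\<lambda>p q. \<beta> (a1 * p * h2) * l (a2 * q))))"
      by (intro sw_cong, rule sw_mult[OF vs_field]) (intro blinI L)
    also have "\<dots> = sw h (\<lambda>h1 h2. sw a (\<lambda>a1 a2. sw h1 (\<lambda>c d. \<beta> (a1 * S d * h2) * l (a2 * S c))))"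
      by (intro sw_cong, rule sw_S[OF vs_field]) (intro blinI L)
    also have "\<dots> = sw h (\<lambda>h1 h2. sw h1 (\<lambda>c d. sw a (\<lambda>a1 a2. \<beta> (a1 * (S d * h2)) * l (a2 * S c))))"
      unfolding mult.assoc by (intro sw_cong sw_swap)
    also have "\<dots> = sw h (\<lambda>c r. sw r (\<lambda>d h2. sw a (\<lambda>a1 a2. \<beta> (a1 * (S d * h2)) * l (a2 * S c))))"
      by (rule sw_assoc[OF vs_field]) (intro tlinI L)
    also have "\<dots> = sw h (\<lambda>c r. \<epsilon> r * sw a (\<lambda>a1 a2. \<beta> (a1 * 1) * l (a2 * S c)))"
      by (intro sw_cong, rule sw_antipode1[where f = "\<lambda>z. sw a (\<lambda>a1 a2. \<beta> (a1 * z) * l (a2 * S _))"]) (intro L)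
    also have "\<dots> = sw a (\<lambda>a1 a2. \<beta> (a1 * 1) * l (a2 * S h))"
      by (rule sw_counit2) (intro L)
    also have "\<dots> = 0" by (simp add: assms lin_zero[OF l(1)])
    finally show ?thesis .
  qed
  note L = linI lin_comp[OF l(1)]
  have "l x * e b h = sw h (\<lambda>w d. \<epsilon> w * (l x * e b d))"
    by (rule sw_counit1[symmetric]) (intro L)
  also have "\<dots> = sw h (\<lambda>w d. sw w (\<lambda>h1 c. l (x * S (h1 * S c)) * e b d))"
  proof (rule sw_cong)
    fix w d
    have "sw w (\<lambda>h1 c. l (x * S (h1 * S c)) * e b d) = \<epsilon> w * (l (x * S 1) * e b d)"
      by (rule sw_antipode2[where f = "\<lambda>z. l (x * S z) * e b d"]) (intro L)
    then show "\<epsilon> w * (l x * e b d) = sw w (\<lambda>h1 c. l (x * S (h1 * S c)) * e b d)" by simp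
  qed
  also have "\<dots> = sw h (\<lambda>h1 h2. sw h2 (\<lambda>c d. l (x * S (h1 * S c)) * e b d))"
    by (rule sw_assoc[OF vs_field]) (intro tlinI L)
  \<comment> \<open>Expanding c over the basis frees the argument of l from the legs of h2, so that
    \<open>J\<close> applies with a = x * S (S j).\<close>
  also have "\<dots> = sw h (\<lambda>h1 h2. sw h2 (\<lambda>c d. (\<Sum>j\<in>HB. e j c * l (x * S (h1 * S j))) * e b d))"
  proof -
    have "(\<Sum>j\<in>HB. e j c * l (x * S (h1 * S j))) = l (x * S (h1 * S c))" for h1 c
      by (rule HB.lin_crd) (intro L)
    then show ?thesis by (simp only:)
  qed
  also have "\<dots> = (\<Sum>j\<in>HB. sw h (\<lambda>h1 h2. l (x * S (S j) * S h1) * sw h2 (\<lambda>c d. e j c * e b d)))"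
    by (simp only: sum_distrib_right sum_distrib_left sw_sum sw_mult_field[symmetric] S_mult mult_ac[where 'a = 'k] mult.assoc[where 'a = 'h])
  also have "\<dots> = 0" by (intro sum.neutral ballI J) (intro L)
  finally show "e b h = 0" using x by simp
qed

lemma bij_S: "bij S"
proof (rule bijI)
  show "inj S"
  proof (rule injI)
    fix x y assume "S x = S y"
    then have "S (x - y) = 0" by (simp add: lin_diff[OF lin_S])
    from S_zeroD[OF this] show "x = y" by simp
  qed
  then show "surj S"
  proof -
    interpret finite_dimensional_vector_space hs HB
      by unfold_locales (use HB.finB HB.indB HB.spanB in auto)
    show ?thesis using linear_inj_imp_surj[OF _ \<open>inj S\<close>] lin_S by (simp add: linear_iff_lin)
  qed
qed

section \<open>Calculus with the inverse of the antipode\<close>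

abbreviation "\<sigma> \<equiv> antipode_inv H"

lemma S_sg [simp]: "S (\<sigma> h) = h" and sg_S [simp]: "\<sigma> (S h) = h"
  by (rule surj_f_inv_f[OF bij_is_surj[OF bij_S]], rule inv_f_f[OF bij_is_inj[OF bij_S]])

lemma lin_sg: "lin hs hs \<sigma>"
proof -
  have "\<sigma> (x + y) = \<sigma> x + \<sigma> y" for x y
  proof -
    have "\<sigma> (S (\<sigma> x) + S (\<sigma> y)) = \<sigma> (S (\<sigma> x + \<sigma> y))" by (simp only: lin_add[OF lin_S])
    then show ?thesis by simp
  qed
  moreover have "\<sigma> (hs c x) = hs c (\<sigma> x)" for c x
  proof -
    have "\<sigma> (hs c (S (\<sigma> x))) = \<sigma> (S (hs c (\<sigma> x)))" by (simp only: lin_scale[OF lin_S])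
    then show ?thesis by simp
  qed
  ultimately show ?thesis by (simp add: lin_def)
qed

lemmas lin_sg' [linI] = lin_comp[OF lin_sg]

lemma sg_mult: "\<sigma> (x * y) = \<sigma> y * \<sigma> x"
proof -
  have "\<sigma> (S (\<sigma> x) * S (\<sigma> y)) = \<sigma> (S (\<sigma> y * \<sigma> x))" by (simp only: S_mult)
  then show ?thesis by simp
qed

lemma sg_one [simp]: "\<sigma> 1 = 1"
  using sg_S[of 1] by simp

lemma eps_sg [simp]: "\<epsilon> (\<sigma> h) = \<epsilon> h"
  using eps_S[of "\<sigma> h"] by simp

lemma sw_sg:
  assumes t: "vector_space t" and b: "blin hs t \<beta>"
  shows "sw (\<sigma> h) \<beta> = sw h (\<lambda>a b. \<beta> (\<sigma> b) (\<sigma> a))"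
proof -
  have b1: "lin hs t (\<beta> a)" for a using b by (simp add: blin_def)
  have b2: "lin hs t (\<lambda>a. \<beta> a b)" for b using b by (simp add: blin_def)
  note L = linI t lin_comp[OF b1] lin_comp[OF b2]
  have "sw (S (\<sigma> h)) (\<lambda>a b. \<beta> (\<sigma> b) (\<sigma> a)) = sw (\<sigma> h) (\<lambda>a b. \<beta> (\<sigma> (S a)) (\<sigma> (S b)))"
    by (rule sw_S[OF t]) (intro blinI L)
  then show ?thesis by simp
qed

text \<open>\<open>\<sigma>\<close> is an antipode for the opposite multiplication with the same
  coproduct. Its cancellation rules therefore multiply the two legs in reversed order.\<close>

lemma sw_sg1: "lin hs t f \<Longrightarrow> sw h (\<lambda>a b. f (b * \<sigma> a)) = t (\<epsilon> h) (f 1)"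
  using sw_antipode2[of t "\<lambda>z. f (\<sigma> z)" h] lin_comp[of hs t f hs \<sigma>] lin_sg by (simp add: sg_mult)

lemma sw_sg2: "lin hs t f \<Longrightarrow> sw h (\<lambda>a b. f (\<sigma> b * a)) = t (\<epsilon> h) (f 1)"
  using sw_antipode1[of t "\<lambda>z. f (\<sigma> z)" h] lin_comp[of hs t f hs \<sigma>] lin_sg by (simp add: sg_mult)

end

lemma fscale_apply [simp]: "fscale s c f x = s c (f x)"
  by (simp add: fscale_def)

lemma lin_fun_iff: "lin s (fscale t) f \<longleftrightarrow> (\<forall>x. lin s t (\<lambda>y. f y x))"
  unfolding lin_def fun_eq_iff plus_fun_apply fscale_apply by blast

lemma lin_evalI: "lin s (fscale t) f \<Longrightarrow> lin s t (\<lambda>y. f y x)"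
  by (simp add: lin_fun_iff)

lemma lin_funI: "(\<And>x. lin s t (\<lambda>y. f y x)) \<Longrightarrow> lin s (fscale t) f"
  by (simp add: lin_fun_iff)

lemma lin_const_zero [linI]: "vector_space t \<Longrightarrow> lin s t (\<lambda>x. 0)"
  by (simp add: lin_def vector_space.scale_eq_0_iff)

lemma lin_zero_fun: "vector_space t \<Longrightarrow> lin s t 0"
  by (simp add: lin_def fun_apply vector_space.scale_eq_0_iff)

lemma lin_plus_fun: "vector_space t \<Longrightarrow> lin s t f \<Longrightarrow> lin s t g \<Longrightarrow> lin s t (f + g)"
  unfolding plus_fun_def by (rule lin_plus)

lemma lin_fscale: "vector_space t \<Longrightarrow> lin s t f \<Longrightarrow> lin s t (fscale t c f)"
  unfolding fscale_def by (rule lin_scale_const)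

section \<open>Maps from the induced module\<close>

locale hopf_module = hopf_fd H for H :: "('k::field, 'h::ring_1) hopf" +
  fixes ss :: "'k \<Rightarrow> 's::ring_1 \<Rightarrow> 's"
    and actS :: "'h \<Rightarrow> 's \<Rightarrow> 's" (infixr "\<rhd>" 75)
    and sW :: "'k \<Rightarrow> 'w::ab_group_add \<Rightarrow> 'w"
    and actW :: "'s \<Rightarrow> 'w \<Rightarrow> 'w" (infixr "\<odot>" 75)
  assumes modalg: "module_algebra H ss actS" and fin_dim_S: "fin_dim ss" and simple: "H_simple actS"
    and modW: "left_module ss sW actW" and fin_dim_W: "fin_dim sW" and W_nonzero: "\<exists>w::'w. w \<noteq> 0"
begin

lemma vs_ss [simp, linI]: "vector_space ss"
  using modalg by (simp add: module_algebra_def algebra_over_def)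

lemma vs_sW [simp, linI]: "vector_space sW"
proof -
  obtain B where "finite_dimensional_vector_space sW B" using fin_dim_W by (auto simp: fin_dim_def)
  then show ?thesis by (simp add: finite_dimensional_vector_space_def)
qed

lemma ss_mult [simp]: "ss c x * y = ss c (x * y)" "x * ss c y = ss c (x * y)"
  using modalg unfolding module_algebra_def algebra_over_def by blast+

lemma act_one_left [simp]: "1 \<rhd> s = s"
  and act_mult_left: "(a * b) \<rhd> s = a \<rhd> (b \<rhd> s)"
  and act_one_right [simp]: "h \<rhd> 1 = ss (\<epsilon> h) 1"
  and lin_act_left: "lin hs ss (\<lambda>h. h \<rhd> s)"
  and lin_act_right: "lin ss ss (\<lambda>s. h \<rhd> s)"
  using modalg unfolding module_algebra_def left_module_def linear_iff_lin by blast+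

lemmas lin_act [linI] = lin_comp[OF lin_act_left] lin_comp[OF lin_act_right]

lemma actW_one [simp]: "1 \<odot> w = w"
  and actW_mult: "(s * r) \<odot> w = s \<odot> (r \<odot> w)"
  and lin_actW_left: "lin ss sW (\<lambda>s. s \<odot> w)"
  and lin_actW_right: "lin sW sW (\<lambda>w. s \<odot> w)"
  using modW unfolding left_module_def linear_iff_lin by blast+

lemmas lin_actW [linI] = lin_comp[OF lin_actW_left] lin_comp[OF lin_actW_right]

lemma lin_ss_mult_left [linI]: "lin s ss f \<Longrightarrow> lin s ss (\<lambda>x. f x * c)"
  by (auto simp: lin_def algebra_simps)
lemma lin_ss_mult_right [linI]: "lin s ss f \<Longrightarrow> lin s ss (\<lambda>x. c * f x)"
  by (auto simp: lin_def algebra_simps)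

lemma act_mult: "h \<rhd> (s * r) = sw h (\<lambda>a b. (a \<rhd> s) * (b \<rhd> r))"
proof -
  have "h \<rhd> (s * r) = sweedler H h (\<lambda>a b. (a \<rhd> s) * (b \<rhd> r))"
    using modalg unfolding module_algebra_def by blast
  also have "\<dots> = sw h (\<lambda>a b. (a \<rhd> s) * (b \<rhd> r))"
    by (rule sweedler_sw[OF vs_ss]) (intro blinI linI)
  finally show ?thesis .
qed

lemma H_simple_zero:
  assumes "two_sided_ideal I" "\<And>h x. x \<in> I \<Longrightarrow> h \<rhd> x \<in> I" "1 \<notin> I" "x \<in> I" shows "x = 0"
  using simple assms unfolding H_simple_def by blast

lemma H_simple_UNIV:
  assumes "two_sided_ideal I" "\<And>h x. x \<in> I \<Longrightarrow> h \<rhd> x \<in> I" "x \<in> I" "x \<noteq> 0" shows "y \<in> I"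
  using simple assms unfolding H_simple_def by blast

text \<open>The unit and associativity laws are asked on \<open>Z\<close> only:
  \<open>coind_act\<close>, for example, is given by a formula on all functions but satisfies these
  laws only on linear ones. Linearity of each \<open>f s\<close> is kept on the whole ambient space,
  so that it commutes with sums without membership conditions.\<close>

definition S_module :: "('k \<Rightarrow> 'y \<Rightarrow> 'y::ab_group_add) \<Rightarrow> ('s \<Rightarrow> 'y \<Rightarrow> 'y) \<Rightarrow> 'y set \<Rightarrow> bool"
  where "S_module t f Z \<longleftrightarrow> vector_space t \<and> subsp t Z \<and> fd t Z \<and> (\<forall>s. lin t t (f s)) \<and>
    (\<forall>y\<in>Z. (\<forall>s. f s y \<in> Z) \<and> lin ss t (\<lambda>s. f s y) \<and> f 1 y = y \<and> (\<forall>s r. f (s * r) y = f s (f r y)))"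

lemma S_moduleD:
  assumes "S_module t f Z"
  shows "vector_space t" "subsp t Z" "fd t Z" "lin t t (f s)" 
    "y \<in> Z \<Longrightarrow> f s y \<in> Z" "y \<in> Z \<Longrightarrow> lin ss t (\<lambda>s. f s y)" "y \<in> Z \<Longrightarrow> f 1 y = y"
    "y \<in> Z \<Longrightarrow> f (s * r) y = f s (f r y)"
  using assms by (auto simp: S_module_def)

lemma S_module_subset:
  assumes "S_module t f Z" "subsp t Z'" "Z' \<subseteq> Z" "\<And>s y. y \<in> Z' \<Longrightarrow> f s y \<in> Z'"
  shows "S_module t f Z'"
proof -
  interpret vector_space t using S_moduleD[OF assms(1)] by simp
  have "fd t Z'" by (rule fd_subset[OF S_moduleD(3)[OF assms(1)] assms(3)])
  then show ?thesis using assms unfolding S_module_def by blast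
qed

lemma sw_mem:
  assumes "vector_space t" "subsp t Z" "\<And>a b. f a b \<in> Z" shows "sw h f \<in> Z"
proof -
  interpret vector_space t by fact
  have "(\<Sum>(a, b)\<leftarrow>xs. f a b) \<in> Z" for xs
    by (induction xs) (auto simp: subspace_0[OF assms(2)] subspace_add[OF assms(2)] assms(3))
  then show ?thesis by (simp add: sw_def)
qed

text \<open>The \<open>S\<close>-linear maps from the \<open>S#H\<close>-module induced by \<open>W\<close> to \<open>Z\<close>, written as \<open>S\<close>-linear maps
  \<open>W \<rightarrow> Hom(H, Z)\<close>; \<open>f\<close> is the action of \<open>S\<close> on the ambient space of \<open>Z\<close>.\<close>

definition ind_hom :: "('k \<Rightarrow> 'y \<Rightarrow> 'y::ab_group_add) \<Rightarrow> ('s \<Rightarrow> 'y \<Rightarrow> 'y) \<Rightarrow> 'y set \<Rightarrow> ('w \<Rightarrow> 'h \<Rightarrow> 'y) set"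
  where "ind_hom t f Z = {F. (\<forall>w. lin hs t (F w)) \<and> (\<forall>h. lin sW t (\<lambda>w. F w h)) \<and> (\<forall>w h. F w h \<in> Z) \<and>
    (\<forall>s w h. F (s \<odot> w) h = sw h (\<lambda>a b. f (a \<rhd> s) (F w b)))}"

abbreviation "dim_ind_hom t f Z \<equiv> vdim (fscale (fscale t)) (ind_hom t f Z)"

lemma ind_homD:
  assumes "F \<in> ind_hom t f Z"
  shows "lin hs t (F w)" "lin sW t (\<lambda>w. F w h)" "F w h \<in> Z" "F (s \<odot> w) h = sw h (\<lambda>a b. f (a \<rhd> s) (F w b))"
  using assms by (auto simp: ind_hom_def)

lemma ind_homI:
  assumes "\<And>w. lin hs t (F w)" "\<And>h. lin sW t (\<lambda>w. F w h)" "\<And>w h. F w h \<in> Z"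
    "\<And>s w h. F (s \<odot> w) h = sw h (\<lambda>a b. f (a \<rhd> s) (F w b))"
  shows "F \<in> ind_hom t f Z"
  using assms by (auto simp: ind_hom_def)

lemma ind_hom_space:
  assumes Z: "S_module t f Z"
  shows "subsp (fscale (fscale t)) (ind_hom t f Z)" "fd (fscale (fscale t)) (ind_hom t f Z)"
proof -
  note z = S_moduleD[OF Z]
  interpret t: vector_space t by (rule z(1))
  interpret t2: vector_space "fscale (fscale t) :: 'k \<Rightarrow> ('w \<Rightarrow> 'h \<Rightarrow> _) \<Rightarrow> _"
    by (intro vector_space_fscale z(1))
  show "t2.subspace (ind_hom t f Z)"
  proof (rule t2.subspI)
    show "0 \<in> ind_hom t f Z"
      by (rule ind_homI) (auto simp: fun_apply lin_zero[OF z(4)] t.subspace_0[OF z(2)] intro: lin_const_zero[OF z(1)] lin_zero_fun[OF z(1)])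
    show "F + G \<in> ind_hom t f Z" if "F \<in> ind_hom t f Z" "G \<in> ind_hom t f Z" for F G
      using that
      by (intro ind_homI) (auto simp: fun_apply lin_add[OF z(4)] sw_add ind_homD
          intro!: t.subspace_add[OF z(2)] lin_plus[OF z(1)] lin_plus_fun[OF z(1)] intro: ind_homD)
    show "fscale (fscale t) c F \<in> ind_hom t f Z" if "F \<in> ind_hom t f Z" for F c
      using that
      by (intro ind_homI) (auto simp: lin_scale[OF z(4)] sw_scale[OF z(1)] ind_homD
          intro!: t.subspace_scale[OF z(2)] lin_scale_const[OF z(1)] lin_fscale[OF z(1)] intro: ind_homD)
  qed
  obtain B where "basis_of sW B" using fin_dim_basis[OF fin_dim_W] .
  then interpret W: basis_of sW B .
  note L1 = HB.Lin_dim[OF z(1-3)]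
  have "fd (fscale (fscale t)) (Lin sW (fscale t) (Lin hs t Z))"
    by (rule W.Lin_dim(2)[OF _ L1(1,2)]) (simp add: z(1))
  moreover have "ind_hom t f Z \<subseteq> Lin sW (fscale t) (Lin hs t Z)"
    by (auto simp: Lin_def lin_fun_iff intro: ind_homD)
  ultimately show "fd (fscale (fscale t)) (ind_hom t f Z)" by (rule t2.fd_subset)
qed

section \<open>Submodules of the dual of S and the bound on dimensions\<close>

definition dual_act :: "'s \<Rightarrow> ('s \<Rightarrow> 'k) \<Rightarrow> 's \<Rightarrow> 'k" where "dual_act s l = (\<lambda>x. l (x * s))"

abbreviation "fk \<equiv> fscale ((*) :: 'k \<Rightarrow> 'k \<Rightarrow> 'k)"

lemma dual_act_mult: "dual_act (s * r) l = dual_act s (dual_act r l)"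
  by (simp add: dual_act_def mult.assoc)

lemma dual_act_one [simp]: "dual_act 1 l = l"
  by (simp add: dual_act_def)

lemma lin_dual_act: "lin fk fk (dual_act s)"
  by (auto simp: lin_def dual_act_def fun_eq_iff fun_apply)

lemma lin_dual_act_left: "lin ss (*) l \<Longrightarrow> lin ss fk (\<lambda>s. dual_act s l)"
  unfolding dual_act_def by (rule lin_funI) (auto simp: lin_def algebra_simps)

lemma S_module_dual_actI:
  assumes "subsp fk V" "\<And>s l. l \<in> V \<Longrightarrow> dual_act s l \<in> V" "\<And>l. l \<in> V \<Longrightarrow> lin ss (*) l"
  shows "S_module fk dual_act V"
proof -
  obtain B where "basis_of ss B" using fin_dim_basis[OF fin_dim_S] .
  then interpret S: basis_of ss B .
  interpret k: vector_space "(*) :: 'k \<Rightarrow> 'k \<Rightarrow> 'k" by (rule vs_field)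
  interpret fk: vector_space "fk :: 'k \<Rightarrow> ('s \<Rightarrow> 'k) \<Rightarrow> _" by (intro vector_space_fscale vs_field)
  have "fd (*) (UNIV :: 'k set)" unfolding fd_def
    by (rule exI[of _ "{1}"]) (auto simp: k.span_singleton)
  from S.Lin_dim(2)[OF vs_field _ this] have "fd fk (Lin ss (*) (UNIV :: 'k set))"
    by (simp add: k.subspace_UNIV)
  then have "fd fk V" by (rule fk.fd_subset) (use assms(3) in \<open>auto simp: Lin_def\<close>)
  then show ?thesis unfolding S_module_def
    using assms by (auto simp: lin_dual_act lin_dual_act_left dual_act_mult)
qed

text \<open>A functional \<open>q\<close> on \<open>Z\<close> vanishing on \<open>Y\<close> defines \<open>Z \<rightarrow> S\<^sup>*\<close>, \<open>y \<mapsto> q(_ y)\<close>, whose kernel is a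
  smaller module containing \<open>Y\<close> and whose image satisfies the bound \<open>ub\<close>.\<close>

lemma dim_ind_hom_step:
  assumes ub: "\<And>V. S_module fk dual_act V \<Longrightarrow> dim_ind_hom fk dual_act V * d \<le> m * vdim fk V"
    and Z: "S_module t f Z" and Y: "S_module t f Y" "Y \<subseteq> Z"
  shows "dim_ind_hom t f Z * d + m * vdim t Y \<le> dim_ind_hom t f Y * d + m * vdim t Z"
  using Z Y(2)
proof (induction "vdim t Z" arbitrary: Z rule: less_induct)
  case less
  note z = S_moduleD[OF less.prems(1)] and y = S_moduleD[OF Y(1)]
  interpret t: vector_space t by (rule z(1))
  interpret k: vector_space "(*) :: 'k \<Rightarrow> 'k \<Rightarrow> 'k" by (rule vs_field)
  interpret fk: vector_space "fk :: 'k \<Rightarrow> ('s \<Rightarrow> 'k) \<Rightarrow> _" by (intro vector_space_fscale vs_field)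
  show ?case
  proof (cases "Y = Z")
    case False
    then obtain x where x: "x \<in> Z" "x \<notin> Y" using less.prems by blast
    obtain q where q: "lin t (*) q" "\<And>y. y \<in> Y \<Longrightarrow> q y = 0" "q x = (1::'k)"
      using ex_functional_vanishing[OF z(1) y(2) x(2)] by blast
    define T where "T = (\<lambda>y r. q (f r y))"
    have linT: "lin t fk T"
      unfolding T_def by (rule lin_funI) (intro lin_comp[OF q(1)] z(4))
    have Tf: "T (f s y) = dual_act s (T y)" if "y \<in> Z" for s y
      using z(8)[OF that] by (simp add: T_def dual_act_def)
    define Z' where "Z' = {y\<in>Z. T y = 0}"
    define V where "V = T ` Z"
    note rn = rank_nullity[OF z(1) _ linT z(2,3), folded Z'_def V_def]
    have dimZ: "vdim t Z = vdim t Z' + vdim fk V" "fd fk V" "subsp fk V"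
      using rn by (simp_all add: vector_space_fscale vector_space_field)
    have V: "S_module fk dual_act V"
    proof (rule S_module_dual_actI[OF dimZ(3)])
      show "dual_act s l \<in> V" if "l \<in> V" for s l using that z(5) by (auto simp: V_def simp flip: Tf)
      show "lin ss (*) l" if "l \<in> V" for l
        using that by (auto simp: V_def T_def intro: lin_comp[OF q(1)] z(6))
    qed
    have Z': "S_module t f Z'"
    proof (rule S_module_subset[OF less.prems(1)])
      show "t.subspace Z'" unfolding Z'_def using z(2)
        by (auto simp: t.subspace_def lin_add[OF linT] lin_scale[OF linT] lin_zero[OF linT] fk.scale_zero_right)
      show "Z' \<subseteq> Z" by (auto simp: Z'_def)
      show "f s y \<in> Z'" if "y \<in> Z'" for s y
        using that by (auto simp: Z'_def z(5) Tf lin_zero[OF lin_dual_act])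
    qed
    have YZ': "Y \<subseteq> Z'"
      using less.prems(2) y(5) q(2) by (auto simp: Z'_def T_def fun_eq_iff fun_apply)
    \<comment> \<open>The normalisation q x = 1 keeps x out of \<open>Z'\<close>. Hence
      \<open>V\<close> is non-zero and the dimension drops, as the induction requires.\<close>
    have "T x 1 = 1" using z(7)[OF x(1)] q(3) by (simp add: T_def)
    then have "T x \<noteq> 0" by (auto simp: fun_apply)
    then have "0 < vdim fk V" using fk.dim_pos[OF dimZ(2)] x(1) by (auto simp: V_def)
    then have lt: "vdim t Z' < vdim t Z" using dimZ(1) by simp
    define TT where "TT = (\<lambda>F w (h::'h). T (F (w::'w) h))"
    have linTT: "lin (fscale (fscale t)) (fscale (fscale fk)) TT"
      by (auto simp: lin_def TT_def fun_eq_iff fun_apply lin_add[OF linT] lin_scale[OF linT])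
    have dimEs: "dim_ind_hom t f Z = vdim (fscale (fscale t)) {F \<in> ind_hom t f Z. TT F = 0} + vdim (fscale (fscale fk)) (TT ` ind_hom t f Z)"
      by (rule rank_nullity(1)[OF _ _ linTT ind_hom_space[OF less.prems(1)]])
        (auto intro!: vector_space_fscale vs_field z(1))
    \<comment> \<open>Left exactness: the maps killed by composition with \<open>T\<close> are those
      with values in its kernel \<open>Z'\<close>.\<close>
    have kerEs: "{F \<in> ind_hom t f Z. TT F = 0} = ind_hom t f Z'"
      by (auto simp: ind_hom_def TT_def Z'_def fun_eq_iff fun_apply)
    have imEs: "vdim (fscale (fscale fk)) (TT ` ind_hom t f Z) \<le> dim_ind_hom fk dual_act V"
    proof (rule vector_space.fd_dim_mono[OF _ ind_hom_space(2)[OF V]])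
      show "vector_space (fscale (fscale fk))" by (intro vector_space_fscale vs_field)
      show "TT ` ind_hom t f Z \<subseteq> ind_hom fk dual_act V"
      proof clarify
        fix F assume F: "F \<in> ind_hom t f Z"
        show "TT F \<in> ind_hom fk dual_act V"
          unfolding TT_def
        proof (rule ind_homI)
          show "lin hs fk (\<lambda>h. T (F w h))" for w by (rule lin_comp[OF linT ind_homD(1)[OF F]])
          show "lin sW fk (\<lambda>w. T (F w h))" for h by (rule lin_comp[OF linT ind_homD(2)[OF F]])
          show "T (F w h) \<in> V" for w h using ind_homD(3)[OF F] by (auto simp: V_def)
          show "T (F (s \<odot> w) h) = sw h (\<lambda>a b. dual_act (a \<rhd> s) (T (F w b)))" for s w h
            by (simp only: ind_homD(4)[OF F] sw_pull[OF linT] Tf[OF ind_homD(3)[OF F]])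
        qed
      qed
    qed
    have 1: "dim_ind_hom t f Z \<le> dim_ind_hom t f Z' + dim_ind_hom fk dual_act V" using dimEs imEs unfolding kerEs by linarith
    have 2: "dim_ind_hom t f Z' * d + m * vdim t Y \<le> dim_ind_hom t f Y * d + m * vdim t Z'"
      by (rule less.hyps[OF lt Z' YZ'])
    have "dim_ind_hom t f Z * d \<le> dim_ind_hom t f Z' * d + dim_ind_hom fk dual_act V * d"
      using mult_right_mono[OF 1, of d] by (simp add: algebra_simps)
    also have "\<dots> \<le> dim_ind_hom t f Z' * d + m * vdim fk V" using ub[OF V] by simp
    finally show ?thesis using 2 dimZ(1) by (simp add: algebra_simps)
  qed simp
qed

end

text \<open>\<open>A\<close> may be infinite, as a module over an infinite field can have infinitely
  many submodules. The maximum exists because bounded numerators and denominators produce finitely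
  many fractions. The conclusion is cross-multiplied to stay within the natural numbers.\<close>

lemma ex_max_ratio:
  fixes f g :: "'a \<Rightarrow> nat"
  assumes "A \<noteq> {}" "\<And>x. x \<in> A \<Longrightarrow> f x \<le> m" "\<And>x. x \<in> A \<Longrightarrow> 0 < g x \<and> g x \<le> n"
  obtains x where "x \<in> A" "\<And>y. y \<in> A \<Longrightarrow> f y * g x \<le> f x * g y"
proof -
  define r where "r = (\<lambda>x. of_nat (f x) / of_nat (g x) :: rat)"
  have "r ` A \<subseteq> (\<lambda>(i, j). of_nat i / of_nat j) ` ({..m} \<times> {..n})"
    using assms by (fastforce simp: r_def)
  then have fin: "finite (r ` A)" by (rule finite_subset) simp
  have "Max (r ` A) \<in> r ` A" using fin assms(1) by (intro Max_in) auto
  then obtain x where x: "x \<in> A" "r x = Max (r ` A)" by auto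
  show thesis
  proof (rule that[OF x(1)])
    fix y assume y: "y \<in> A"
    have "r y \<le> r x" using x(2) fin y by simp
    then have "of_nat (f y * g x) \<le> (of_nat (f x * g y) :: rat)"
      using assms(3)[OF x(1)] assms(3)[OF y] by (simp add: r_def divide_simps mult.commute)
    then show "f y * g x \<le> f x * g y" by (simp only: of_nat_le_iff)
  qed
qed

context hopf_module begin

section \<open>A submodule of the dual of S with maximal ratio\<close>

lemma vs_fk2: "vector_space (fscale fk)" and vs_fk: "vector_space fk"
  by (intro vector_space_fscale vs_field)+

lemma S_module_dual: "S_module fk dual_act {l. lin ss (*) l}"
proof (rule S_module_dual_actI)
  interpret fk: vector_space "fk :: 'k \<Rightarrow> ('s \<Rightarrow> 'k) \<Rightarrow> _" by (rule vs_fk)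
  show "fk.subspace {l. lin ss (*) l}"
    by (rule fk.subspI) (auto intro: lin_zero_fun lin_plus_fun lin_fscale)
  show "dual_act s l \<in> {l. lin ss (*) l}" if "l \<in> {l. lin ss (*) l}" for s l
    using that by (auto simp: dual_act_def lin_def algebra_simps)
qed auto

lemma ind_hom_dual_nonzero: "\<exists>F\<in>ind_hom fk dual_act {l. lin ss (*) l}. F \<noteq> 0"
proof -
  obtain w0 :: 'w where w0: "w0 \<noteq> 0" using W_nonzero by blast
  obtain l where l: "lin sW (*) l" "l w0 = (1::'k)"
    using ex_functional[OF vs_sW w0] by (auto simp: linear_iff_lin)
  note L = linI lin_comp[OF l(1)]
  \<comment> \<open>Maps from Ind W = H \<otimes> W to the dual of S correspond to functionals on H
    \<otimes> W; this one belongs to \<epsilon> \<otimes> l. The twist by \<open>\<sigma>\<close>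
    comes from moving x past h in S#H, where x h = h2 (\<sigma> h1 \<rhd> x).\<close>
  define F where "F = (\<lambda>w h x. l ((\<sigma> h \<rhd> x) \<odot> w))"
  have "F \<in> ind_hom fk dual_act {l. lin ss (*) l}"
  proof (rule ind_homI)
    show "lin hs fk (F w)" for w unfolding F_def by (rule lin_funI) (intro L)
    show "lin sW fk (\<lambda>w. F w h)" for h unfolding F_def by (rule lin_funI) (intro L)
    have "lin ss (*) (F w h)" for w h unfolding F_def by (intro L)
    then show "F w h \<in> {l. lin ss (*) l}" for w h by simp
    show "F (s \<odot> w) h = sw h (\<lambda>a b. dual_act (a \<rhd> s) (F w b))" for s w h
    proof
      fix x
      have "sw h (\<lambda>a b. dual_act (a \<rhd> s) (F w b)) x = sw h (\<lambda>a b. l ((\<sigma> b \<rhd> (x * (a \<rhd> s))) \<odot> w))"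
        by (simp add: sw_eval dual_act_def F_def)
      also have "\<dots> = sw h (\<lambda>a b. l (sw (\<sigma> b) (\<lambda>p q. (p \<rhd> x) * (q \<rhd> (a \<rhd> s))) \<odot> w))"
        by (simp only: act_mult)
      also have "\<dots> = sw h (\<lambda>a b. l (sw b (\<lambda>c d. (\<sigma> d \<rhd> x) * (\<sigma> c \<rhd> (a \<rhd> s))) \<odot> w))"
      proof -
        have "sw (\<sigma> b) (\<lambda>p q. (p \<rhd> x) * (q \<rhd> (a \<rhd> s))) = sw b (\<lambda>c d. (\<sigma> d \<rhd> x) * (\<sigma> c \<rhd> (a \<rhd> s)))" for a b
          by (rule sw_sg[OF vs_ss]) (intro blinI L)
        then show ?thesis by (simp only:)
      qed
      also have "\<dots> = sw h (\<lambda>a b. sw b (\<lambda>c d. l (((\<sigma> d \<rhd> x) * ((\<sigma> c * a) \<rhd> s)) \<odot> w)))"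
        by (simp only: sw_pull[OF lin_actW_left] sw_pull[OF l(1)] act_mult_left)
      also have "\<dots> = sw h (\<lambda>u d. sw u (\<lambda>a c. l (((\<sigma> d \<rhd> x) * ((\<sigma> c * a) \<rhd> s)) \<odot> w)))"
        by (rule sw_assoc[OF vs_field, symmetric]) (intro tlinI L)
      also have "\<dots> = sw h (\<lambda>u d. \<epsilon> u * l (((\<sigma> d \<rhd> x) * (1 \<rhd> s)) \<odot> w))"
        by (rule sw_cong, rule sw_sg2[where f = "\<lambda>z. l (((\<sigma> _ \<rhd> x) * (z \<rhd> s)) \<odot> w)"]) (intro L)
      also have "\<dots> = l (((\<sigma> h \<rhd> x) * (1 \<rhd> s)) \<odot> w)"
        by (rule sw_counit1) (intro L)
      finally show "F (s \<odot> w) h x = sw h (\<lambda>a b. dual_act (a \<rhd> s) (F w b)) x"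
        by (simp add: F_def actW_mult)
    qed
  qed
  moreover have "F w0 1 1 = 1" by (simp add: F_def actW_mult l(2) vs_simps)
  then have "F \<noteq> 0" by (auto simp: fun_apply)
  ultimately show ?thesis by blast
qed

lemma ex_max_submodule:
  obtains V where "S_module fk dual_act V" "0 < vdim fk V" "0 < dim_ind_hom fk dual_act V"
    "\<And>V'. S_module fk dual_act V' \<Longrightarrow> dim_ind_hom fk dual_act V' * vdim fk V \<le> dim_ind_hom fk dual_act V * vdim fk V'"
proof -
  let ?D = "{l. lin ss (*) l}"
  interpret fk: vector_space "fk :: 'k \<Rightarrow> ('s \<Rightarrow> 'k) \<Rightarrow> _" by (rule vs_fk)
  interpret fk3: vector_space "fscale (fscale fk) :: 'k \<Rightarrow> ('w \<Rightarrow> 'h \<Rightarrow> 's \<Rightarrow> 'k) \<Rightarrow> _"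
    by (intro vector_space_fscale vs_field)
  \<comment> \<open>The zero module has no ratio and is left out of the maximum; there both sides of
    the cross-multiplied bound vanish.\<close>
  have zero: "vdim fk V = 0 \<Longrightarrow> dim_ind_hom fk dual_act V = 0" if "S_module fk dual_act V" for V
  proof (rule ccontr)
    assume "vdim fk V = 0" "dim_ind_hom fk dual_act V \<noteq> 0"
    then obtain F where F: "F \<in> ind_hom fk dual_act V" "F \<noteq> 0" using fk3.dim_pos_ex[of "ind_hom fk dual_act V"] by auto
    then obtain w h where "F w h \<noteq> 0" by (auto simp: fun_eq_iff fun_apply)
    then have "0 < vdim fk V" using fk.dim_pos[OF S_moduleD(3)[OF that] ind_homD(3)[OF F(1)]] by simp
    with \<open>vdim fk V = 0\<close> show False by simp
  qed
  have sub: "V \<subseteq> ?D" if V: "S_module fk dual_act V" for V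
  proof
    fix l assume l: "l \<in> V"
    have "lin ss (*) (\<lambda>s. dual_act s l 1)" by (rule lin_evalI[OF S_moduleD(6)[OF V l]])
    then show "l \<in> ?D" by (simp add: dual_act_def)
  qed
  let ?A = "{V. S_module fk dual_act V \<and> 0 < vdim fk V}"
  obtain F where F: "F \<in> ind_hom fk dual_act ?D" "F \<noteq> 0" using ind_hom_dual_nonzero by blast
  have posE: "0 < dim_ind_hom fk dual_act ?D" by (rule fk3.dim_pos[OF ind_hom_space(2)[OF S_module_dual] F])
  have D: "?D \<in> ?A" using zero[OF S_module_dual] posE S_module_dual by auto
  have b1: "dim_ind_hom fk dual_act V \<le> dim_ind_hom fk dual_act ?D" if "V \<in> ?A" for V
    using sub[of V] that by (intro fk3.fd_dim_mono ind_hom_space S_module_dual) (auto simp: ind_hom_def subset_iff)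
  have b2: "0 < vdim fk V \<and> vdim fk V \<le> vdim fk ?D" if "V \<in> ?A" for V
    using sub[of V] that by (auto intro: fk.fd_dim_mono S_moduleD(3)[OF S_module_dual])
  obtain V where V: "V \<in> ?A" "\<And>V'. V' \<in> ?A \<Longrightarrow> dim_ind_hom fk dual_act V' * vdim fk V \<le> dim_ind_hom fk dual_act V * vdim fk V'"
    using ex_max_ratio[of ?A "dim_ind_hom fk dual_act" _ "vdim fk", OF _ b1 b2] D by blast
  show thesis
  proof (rule that[of V])
    show "S_module fk dual_act V" "0 < vdim fk V" using V(1) by auto
    have "0 < dim_ind_hom fk dual_act ?D * vdim fk V" using posE V(1) by simp
    also have "\<dots> \<le> dim_ind_hom fk dual_act V * vdim fk ?D" by (rule V(2)[OF D])
    finally show "0 < dim_ind_hom fk dual_act V" by simp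
    fix V' assume V': "S_module fk dual_act V'"
    show "dim_ind_hom fk dual_act V' * vdim fk V \<le> dim_ind_hom fk dual_act V * vdim fk V'"
      using V(2)[of V'] zero[OF V'] V' by (cases "vdim fk V' = 0") auto
  qed
qed

text \<open>The coinduced module is Hom_S(S#H, V) with S acting by right translation, its elements
  being restricted to H. The formula results from a s = (a1 \<rhd> s) a2 in S#H.\<close>

definition coind_act :: "'s \<Rightarrow> ('h \<Rightarrow> 's \<Rightarrow> 'k) \<Rightarrow> 'h \<Rightarrow> 's \<Rightarrow> 'k"
  where "coind_act s u = (\<lambda>a. sw a (\<lambda>p q. dual_act (p \<rhd> s) (u q)))"

lemma coind_act_lin: "lin (fscale fk) (fscale fk) (coind_act s)"
proof -
  have "coind_act s (x + y) = coind_act s x + coind_act s y" for x y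
    by (intro ext) (simp add: coind_act_def sw_eval dual_act_def fun_apply sw_add)
  moreover have "coind_act s (fscale fk c x) = fscale fk c (coind_act s x)" for c x
    by (intro ext) (simp add: coind_act_def sw_eval dual_act_def sw_mult_field)
  ultimately show ?thesis by (simp add: lin_def)
qed

lemma S_module_coind_act:
  assumes V: "S_module fk dual_act V"
  shows "S_module (fscale fk) coind_act (Lin hs fk V)"
proof -
  note v = S_moduleD[OF V]
  note LV = HB.Lin_dim[OF v(1-3)]
  have U: "coind_act s u \<in> Lin hs fk V \<and> lin ss (fscale fk) (\<lambda>s. coind_act s u) \<and> coind_act 1 u = u \<and> coind_act (s * r) u = coind_act s (coind_act r u)"
    if "u \<in> Lin hs fk V" for u s r
  proof -
    have u: "lin hs fk u" "u q \<in> V" for q using that by (auto simp: Lin_def)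
    note Ls = lin_comp[OF v(6)[OF u(2)]] lin_comp[OF v(6)[OF v(5)[OF u(2)]]] lin_comp[OF lin_dual_act] lin_comp[OF u(1)]
    show ?thesis
    proof (intro conjI)
      show "coind_act s u \<in> Lin hs fk V" unfolding Lin_def mem_Collect_eq coind_act_def
      proof (intro conjI allI)
        show "lin hs fk (\<lambda>a. sw a (\<lambda>p q. dual_act (p \<rhd> s) (u q)))"
          by (intro linI Ls)
        show "sw x (\<lambda>p q. dual_act (p \<rhd> s) (u q)) \<in> V" for x
          by (rule sw_mem[OF v(1,2)]) (rule v(5)[OF u(2)])
      qed
      show "lin ss (fscale fk) (\<lambda>s. coind_act s u)"
        unfolding coind_act_def by (rule lin_funI) (intro lin_sw vs_fk Ls lin_act linI)
      show "coind_act 1 u = u"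
      proof
        fix a
        have "coind_act 1 u a = sw a (\<lambda>p q. fk (\<epsilon> p) (u q))"
          by (simp add: coind_act_def lin_scale[OF v(6)[OF u(2)]])
        also have "\<dots> = u a" by (rule sw_counit1[OF u(1)])
        finally show "coind_act 1 u a = u a" .
      qed
      show "coind_act (s * r) u = coind_act s (coind_act r u)"
      proof
        fix a
        have "coind_act (s * r) u a = sw a (\<lambda>p q. sw p (\<lambda>c d. dual_act (c \<rhd> s) (dual_act (d \<rhd> r) (u q))))"
          by (simp only: coind_act_def act_mult sw_pull[OF v(6)[OF u(2)]] dual_act_mult)
        also have "\<dots> = sw a (\<lambda>c z. sw z (\<lambda>d q. dual_act (c \<rhd> s) (dual_act (d \<rhd> r) (u q))))"
          by (rule sw_assoc[OF vs_fk]) (intro tlinI Ls linI)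
        also have "\<dots> = coind_act s (coind_act r u) a"
          by (simp only: coind_act_def sw_pull[OF lin_dual_act])
        finally show "coind_act (s * r) u a = coind_act s (coind_act r u) a" .
      qed
    qed
  qed
  then show ?thesis unfolding S_module_def
    using LV(1,2) coind_act_lin vs_fk2 by blast
qed

text \<open>Behind this is the isomorphism of Hom(H, Hom_S(Ind W, V)) with Hom_S(Ind W, Hom(H, V)),
  of which only injectivity of one direction is required. \<open>\<Theta>\<close> lets the leg a1
  act on Ind W, which is possible because Ind W is a module over S#H; multiplying by \<sigma> a1
  undoes this and recovers \<open>\<phi>\<close>.\<close>

lemma dim_ind_hom_coind_act:
  assumes V: "S_module fk dual_act V"
  shows "card HB * dim_ind_hom fk dual_act V \<le> dim_ind_hom (fscale fk) coind_act (Lin hs fk V)"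
proof -
  note v = S_moduleD[OF V]
  let ?f3 = "fscale (fscale (fscale fk))"
  let ?E = "Lin hs (fscale (fscale fk)) (ind_hom fk dual_act V)"
  have vs: "vector_space ?f3" by (intro vector_space_fscale vs_field)
  have vs3: "vector_space (fscale (fscale fk))" by (intro vector_space_fscale vs_field)
  note LE = HB.Lin_dim[OF vs3 ind_hom_space[OF V]]
  define \<Theta> where "\<Theta> = (\<lambda>\<phi> (w::'w) h a. sw a (\<lambda>p q. \<phi> q w (p * h) :: 's \<Rightarrow> 'k))"
  have lin\<Theta>: "lin ?f3 ?f3 \<Theta>"
  proof -
    have "\<Theta> (x + y) = \<Theta> x + \<Theta> y" for x y
    proof (intro ext)
      fix w h a z
      show "\<Theta> (x + y) w h a z = (\<Theta> x + \<Theta> y) w h a z"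
        by (simp add: \<Theta>_def fun_apply sw_eval sw_add)
    qed
    moreover have "\<Theta> (?f3 c x) = ?f3 c (\<Theta> x)" for c x
    proof (intro ext)
      fix w h a z
      show "\<Theta> (?f3 c x) w h a z = ?f3 c (\<Theta> x) w h a z"
        by (simp add: \<Theta>_def sw_eval sw_mult_field)
    qed
    ultimately show ?thesis by (simp add: lin_def)
  qed
  have P: "lin hs fk (\<lambda>q. \<phi> q w h)" "lin hs fk (\<phi> q w)" "lin sW fk (\<lambda>w. \<phi> q w h)" "\<phi> q w h \<in> V"
    "\<phi> q (s \<odot> w) h = sw h (\<lambda>a b. dual_act (a \<rhd> s) (\<phi> q w b))"
    if "\<phi> \<in> ?E" for \<phi> q w h s
    using that ind_homD[of "\<phi> q" fk dual_act V] lin_evalI[OF lin_evalI[of hs "fscale fk" \<phi> w], of h] unfolding Lin_def by blast+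
  have ker: "{\<phi> \<in> ?E. \<Theta> \<phi> = 0} \<subseteq> {0}"
  proof clarify
    fix \<phi> assume \<phi>: "\<phi> \<in> ?E" "\<Theta> \<phi> = 0"
    note Ls = lin_comp[OF P(1)[OF \<phi>(1)]] lin_comp[OF P(2)[OF \<phi>(1)]]
    show "\<phi> = 0"
    proof (intro ext)
      fix a w h z
      have "\<phi> a w h = sw a (\<lambda>u d. fk (\<epsilon> u) (\<phi> d w (1 * h)))"
        using sw_counit1[OF P(1)[OF \<phi>(1), of w h], of a] by simp
      also have "\<dots> = sw a (\<lambda>u d. sw u (\<lambda>p c. \<phi> d w ((c * \<sigma> p) * h)))"
        by (rule sw_cong, rule sw_sg1[where f = "\<lambda>z. \<phi> _ w (z * h)", symmetric]) (intro Ls linI)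
      also have "\<dots> = sw a (\<lambda>p q. sw q (\<lambda>c d. \<phi> d w ((c * \<sigma> p) * h)))"
        by (rule sw_assoc[OF vs_fk]) (intro tlinI Ls linI)
      also have "\<dots> = sw a (\<lambda>p q. \<Theta> \<phi> w (\<sigma> p * h) q)"
        by (simp add: \<Theta>_def mult.assoc)
      also have "\<dots> = 0" unfolding \<phi>(2) by (simp add: fun_apply)
      finally show "\<phi> a w h z = 0 a w h z" by (simp add: fun_apply)
    qed
  qed
  have im: "\<Theta> ` ?E \<subseteq> ind_hom (fscale fk) coind_act (Lin hs fk V)"
  proof clarify
    fix \<phi> assume \<phi>: "\<phi> \<in> ?E"
    note Ls = lin_comp[OF P(1)[OF \<phi>]] lin_comp[OF P(2)[OF \<phi>]] lin_comp[OF P(3)[OF \<phi>]]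
      lin_comp[OF v(6)[OF P(4)[OF \<phi>]]] lin_comp[OF lin_dual_act]
    show "\<Theta> \<phi> \<in> ind_hom (fscale fk) coind_act (Lin hs fk V)"
    proof (rule ind_homI)
      show "lin hs (fscale fk) (\<Theta> \<phi> w)" for w
        unfolding \<Theta>_def by (rule lin_funI) (intro Ls linI)
      show "lin sW (fscale fk) (\<lambda>w. \<Theta> \<phi> w h)" for h
        unfolding \<Theta>_def by (rule lin_funI) (intro Ls linI)
      have "lin hs fk (\<Theta> \<phi> w h)" for w h
        unfolding \<Theta>_def by (intro Ls linI)
      moreover have "\<Theta> \<phi> w h a \<in> V" for w h a
        unfolding \<Theta>_def by (rule sw_mem[OF v(1,2)]) (rule P(4)[OF \<phi>])
      ultimately show "\<Theta> \<phi> w h \<in> Lin hs fk V" for w h by (simp add: Lin_def)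
      show "\<Theta> \<phi> (s \<odot> w) h = sw h (\<lambda>a b. coind_act (a \<rhd> s) (\<Theta> \<phi> w b))" for s w h
      proof
        fix a
        have "\<Theta> \<phi> (s \<odot> w) h a = sw a (\<lambda>p q. sw (p * h) (\<lambda>c d. dual_act (c \<rhd> s) (\<phi> q w d)))"
          by (simp only: \<Theta>_def P(5)[OF \<phi>])
        also have "\<dots> = sw a (\<lambda>p q. sw p (\<lambda>c d. sw h (\<lambda>x y. dual_act ((c * x) \<rhd> s) (\<phi> q w (d * y)))))"
          by (rule sw_cong, rule sw_mult[OF vs_fk]) (intro blinI Ls linI)
        also have "\<dots> = sw a (\<lambda>p q. sw q (\<lambda>c d. sw h (\<lambda>x y. dual_act ((p * x) \<rhd> s) (\<phi> d w (c * y)))))"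
          by (rule sw_assoc[OF vs_fk]) (intro tlinI Ls linI)
        also have "\<dots> = sw a (\<lambda>p q. sw h (\<lambda>x y. sw q (\<lambda>c d. dual_act ((p * x) \<rhd> s) (\<phi> d w (c * y)))))"
          by (intro sw_cong sw_swap)
        also have "\<dots> = sw h (\<lambda>x y. sw a (\<lambda>p q. sw q (\<lambda>c d. dual_act ((p * x) \<rhd> s) (\<phi> d w (c * y)))))"
          by (rule sw_swap)
        also have "\<dots> = sw h (\<lambda>x y. coind_act (x \<rhd> s) (\<Theta> \<phi> w y) a)"
          by (simp only: coind_act_def \<Theta>_def sw_pull[OF lin_dual_act] act_mult_left)
        finally show "\<Theta> \<phi> (s \<odot> w) h a = sw h (\<lambda>a b. coind_act (a \<rhd> s) (\<Theta> \<phi> w b)) a"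
          by (simp only: sw_eval)
      qed
    qed
  qed
  interpret f3: vector_space "?f3 :: 'k \<Rightarrow> ('h \<Rightarrow> 'w \<Rightarrow> 'h \<Rightarrow> 's \<Rightarrow> 'k) \<Rightarrow> _" by (rule vs)
  interpret g3: vector_space "?f3 :: 'k \<Rightarrow> ('w \<Rightarrow> 'h \<Rightarrow> 'h \<Rightarrow> 's \<Rightarrow> 'k) \<Rightarrow> _" by (rule vs)
  have "card HB * dim_ind_hom fk dual_act V = vdim ?f3 {\<phi> \<in> ?E. \<Theta> \<phi> = 0} + vdim ?f3 (\<Theta> ` ?E)"
    using rank_nullity(1)[OF vs vs lin\<Theta> LE(1,2)] LE(3) by simp
  moreover have "vdim ?f3 {\<phi> \<in> ?E. \<Theta> \<phi> = 0} = 0"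
    using f3.dim_le_card[of "{\<phi> \<in> ?E. \<Theta> \<phi> = 0}" "{}"] ker by simp
  moreover have "vdim ?f3 (\<Theta> ` ?E) \<le> dim_ind_hom (fscale fk) coind_act (Lin hs fk V)"
    by (rule g3.fd_dim_mono[OF ind_hom_space(2)[OF S_module_coind_act[OF V]] im])
  ultimately show ?thesis by simp
qed

section \<open>From a minimal left ideal of S to a non-zero S-linear map W \<rightarrow> S\<close>

lemma left_ideal_minimal:
  obtains V where "S_module ss (\<lambda>s x. s * x) V" "V \<noteq> {0}"
    "\<And>V'. S_module ss (\<lambda>s x. s * x) V' \<Longrightarrow> V' \<subseteq> V \<Longrightarrow> V' = {0} \<or> V' = V"
proof -
  interpret s: vector_space ss by (rule vs_ss)
  let ?P = "\<lambda>V. S_module ss (\<lambda>s x. s * x) V \<and> V \<noteq> {0}"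
  have "S_module ss (\<lambda>s x. s * x) UNIV" unfolding S_module_def
    using fin_dim_fd[OF fin_dim_S] by (auto simp: mult.assoc s.subspace_UNIV intro!: linI)
  moreover have "(1::'s) \<in> UNIV" "(1::'s) \<noteq> 0" by auto
  then have "(UNIV :: 's set) \<noteq> {0}" by blast
  ultimately have "?P UNIV" by blast
  then obtain V where V: "?P V" "\<And>V'. ?P V' \<Longrightarrow> s.dim V \<le> s.dim V'"
    using ex_has_least_nat[of ?P UNIV s.dim] by blast
  show thesis
  proof (rule that)
    show "S_module ss (\<lambda>s x. s * x) V" "V \<noteq> {0}" using V(1) by auto
    fix V' assume V': "S_module ss (\<lambda>s x. s * x) V'" "V' \<subseteq> V"
    show "V' = {0} \<or> V' = V"
    proof (cases "V' = {0}")
      case False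
      then have "s.dim V \<le> s.dim V'" using V(2) V'(1) by blast
      then show ?thesis using s.fd_subspace_eq[of V V'] V' V(1) S_moduleD(2,3) by blast
    qed simp
  qed
qed

text \<open>Otherwise \<open>J\<close> lies in the set of all s for which H \<rhd> s annihilates
  \<open>V\<close>. This is an H-stable two-sided ideal without 1, hence zero.\<close>

lemma ex_dual_embedding:
  assumes V: "S_module fk dual_act V" "0 < vdim fk V" and J: "J \<noteq> {0}" "0 \<in> J"
  obtains l s a where "l \<in> V" "s \<in> J" "dual_act (a \<rhd> s) l \<noteq> 0"
proof (rule ccontr)
  assume "\<not> thesis"
  with that have *: "dual_act (a \<rhd> s) l = 0" if "l \<in> V" "s \<in> J" for l s a using that by blast
  note v = S_moduleD[OF V(1)]
  interpret fk: vector_space "fk :: 'k \<Rightarrow> ('s \<Rightarrow> 'k) \<Rightarrow> _" by (rule vs_fk)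
  let ?I = "{s. \<forall>a. \<forall>l\<in>V. dual_act (a \<rhd> s) l = 0}"
  obtain s where s: "s \<in> J" "s \<noteq> 0" using J by blast
  obtain l where l: "l \<in> V" "l \<noteq> 0" using fk.dim_pos_ex[OF V(2)] by blast
  have "s = 0"
  proof (rule H_simple_zero[of ?I])
    show "s \<in> ?I" using * s(1) by blast
    show "h \<rhd> x \<in> ?I" if "x \<in> ?I" for h x
      using that by (auto simp flip: act_mult_left)
    show "1 \<notin> ?I"
    proof
      assume "1 \<in> ?I"
      then have "dual_act (1 \<rhd> 1) l = 0" using l(1) by blast
      then show False using l(2) by (simp add: vs_simps)
    qed
    show "two_sided_ideal ?I" unfolding two_sided_ideal_def
    proof (intro conjI ballI allI)
      show "0 \<in> ?I" by (auto simp: lin_zero[OF lin_act_right] lin_zero[OF v(6)])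
      show "x + y \<in> ?I" if "x \<in> ?I" "y \<in> ?I" for x y
        using that by (auto simp: lin_add[OF lin_act_right] lin_add[OF v(6)])
      fix x r assume x: "x \<in> ?I"
      show "r * x \<in> ?I"
      proof clarify
        fix a l assume l: "l \<in> V"
        show "dual_act (a \<rhd> (r * x)) l = 0"
          using x l by (simp add: act_mult sw_pull[OF v(6)[OF l]] dual_act_mult lin_zero[OF lin_dual_act])
      qed
      show "x * r \<in> ?I"
      proof clarify
        fix a l assume l: "l \<in> V"
        show "dual_act (a \<rhd> (x * r)) l = 0"
          using x v(5)[OF l] by (simp add: act_mult sw_pull[OF v(6)[OF l]] dual_act_mult)
      qed
    qed
  qed
  with s(2) show False by simp
qed

definition HomWS :: "('w \<Rightarrow> 's) set"
  where "HomWS = {\<pi>. lin sW ss \<pi> \<and> (\<forall>s w. \<pi> (s \<odot> w) = s * \<pi> w)}"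

lemma HomWS: assumes "\<pi> \<in> HomWS" shows "lin sW ss \<pi>" "\<pi> (s \<odot> w) = s * \<pi> w"
  using assms by (auto simp: HomWS_def)

lemma ex_ind_hom_left_ideal:
  obtains V p where "p \<in> ind_hom ss (\<lambda>s x. s * x) V" "p \<noteq> 0"
proof -
  obtain V where V: "S_module fk dual_act V" "0 < vdim fk V" "0 < dim_ind_hom fk dual_act V"
    "\<And>V'. S_module fk dual_act V' \<Longrightarrow> dim_ind_hom fk dual_act V' * vdim fk V \<le> dim_ind_hom fk dual_act V * vdim fk V'"
    using ex_max_submodule by blast
  note v = S_moduleD[OF V(1)]
  obtain J where J: "S_module ss (\<lambda>s x. s * x) J" "J \<noteq> {0}"
    "\<And>V'. S_module ss (\<lambda>s x. s * x) V' \<Longrightarrow> V' \<subseteq> J \<Longrightarrow> V' = {0} \<or> V' = J"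
    using left_ideal_minimal by blast
  note j = S_moduleD[OF J(1)]
  interpret s: vector_space ss by (rule vs_ss)
  interpret f2: vector_space "fscale fk :: 'k \<Rightarrow> ('h \<Rightarrow> 's \<Rightarrow> 'k) \<Rightarrow> _" by (rule vs_fk2)
  interpret f4: vector_space "fscale (fscale (fscale fk)) :: 'k \<Rightarrow> ('w \<Rightarrow> 'h \<Rightarrow> 'h \<Rightarrow> 's \<Rightarrow> 'k) \<Rightarrow> _"
    by (intro vector_space_fscale vs_field)
  have J0: "0 \<in> J" by (rule s.subspace_0[OF j(2)])
  obtain l s0 a0 where l: "l \<in> V" and s0: "s0 \<in> J" "dual_act (a0 \<rhd> s0) l \<noteq> 0"
    using ex_dual_embedding[OF V(1,2) J(2) J0] by blast
  \<comment> \<open>The S-linear map from S to Hom(H, V) that sends 1 to a \<mapsto> \<epsilon>(a)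
    l. It does not vanish on \<open>J\<close>, so by minimality of \<open>J\<close> it is injective
    there.\<close>
  define u where "u = (\<lambda>s a. dual_act (a \<rhd> s) l)"
  note Ll = lin_comp[OF v(6)[OF l]] lin_comp[OF v(6)[OF v(5)[OF l]]] lin_comp[OF lin_dual_act]
  have linu: "lin ss (fscale fk) u" unfolding u_def by (rule lin_funI) (intro Ll linI)
  have uN: "u s \<in> Lin hs fk V" for s
    unfolding Lin_def u_def using v(5)[OF l] by (auto intro!: Ll linI)
  have u_mult: "u (s * r) = coind_act s (u r)" for s r
  proof
    fix a
    show "u (s * r) a = coind_act s (u r) a"
      by (simp only: u_def coind_act_def act_mult sw_pull[OF v(6)[OF l]] dual_act_mult)
  qed
  have ker: "{s\<in>J. u s = 0} = {0}"
  proof -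
    have "S_module ss (\<lambda>s x. s * x) {s\<in>J. u s = 0}"
    proof (rule S_module_subset[OF J(1)])
      show "s.subspace {s\<in>J. u s = 0}"
        using j(2) by (auto simp: s.subspace_def lin_add[OF linu] lin_scale[OF linu] lin_zero[OF linu] f2.scale_zero_right)
      show "s * y \<in> {s\<in>J. u s = 0}" if "y \<in> {s\<in>J. u s = 0}" for s y
        using that j(5) by (auto simp: u_mult lin_zero[OF coind_act_lin])
    qed auto
    moreover have "s0 \<notin> {s\<in>J. u s = 0}" using s0(2) by (auto simp: u_def fun_eq_iff fun_apply)
    ultimately show ?thesis using J(3)[of "{s\<in>J. u s = 0}"] s0(1) by blast
  qed
  have inj: "x = y" if "x \<in> J" "y \<in> J" "u x = u y" for x y
  proof -
    have "x - y \<in> {s\<in>J. u s = 0}"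
      using that s.subspace_diff[OF j(2)] by (simp add: lin_diff[OF linu])
    then show ?thesis by (simp add: ker)
  qed
  define Y where "Y = u ` J"
  have Y: "S_module (fscale fk) coind_act Y" "Y \<subseteq> Lin hs fk V" "vdim (fscale fk) Y = s.dim J"
  proof -
    note rn = rank_nullity[OF vs_ss vs_fk2 linu j(2,3), folded Y_def]
    show "Y \<subseteq> Lin hs fk V" using uN by (auto simp: Y_def)
    then show "S_module (fscale fk) coind_act Y"
      by (rule S_module_subset[OF S_module_coind_act[OF V(1)] rn(3)])
        (auto simp: Y_def simp flip: u_mult intro: j(5))
    show "vdim (fscale fk) Y = s.dim J"
      using rn(1) s.dim_le_card[of "{0}" "{}"] by (simp add: ker)
  qed
  obtain y where "y \<in> J" "y \<noteq> 0" using J(2) J0 by blast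
  then have dimJ: "0 < s.dim J" using s.dim_pos[OF j(3)] by blast
  note LV = HB.Lin_dim[OF v(1-3)]
  \<comment> \<open>Write m = dim E(V), d = dim V and n = dim H. The coinduced module has dimension
    n d and dim E \<ge> n m, so its two terms in this inequality cancel and dim E(Y) * d \<ge> m *
    dim Y > 0 remains.\<close>
  have "dim_ind_hom (fscale fk) coind_act (Lin hs fk V) * vdim fk V + dim_ind_hom fk dual_act V * vdim (fscale fk) Y
      \<le> dim_ind_hom (fscale fk) coind_act Y * vdim fk V + dim_ind_hom fk dual_act V * vdim (fscale fk) (Lin hs fk V)"
    by (rule dim_ind_hom_step[OF V(4) S_module_coind_act[OF V(1)] Y(1,2)])
  moreover have "card HB * dim_ind_hom fk dual_act V * vdim fk V \<le> dim_ind_hom (fscale fk) coind_act (Lin hs fk V) * vdim fk V"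
    by (rule mult_le_mono1[OF dim_ind_hom_coind_act[OF V(1)]])
  moreover have "dim_ind_hom fk dual_act V * (card HB * vdim fk V) = card HB * dim_ind_hom fk dual_act V * vdim fk V"
    by (simp only: mult_ac)
  ultimately have "dim_ind_hom fk dual_act V * s.dim J \<le> dim_ind_hom (fscale fk) coind_act Y * vdim fk V"
    unfolding LV(3) Y(3) by linarith
  moreover have "0 < dim_ind_hom fk dual_act V * s.dim J" using V(3) dimJ by simp
  ultimately have "0 < dim_ind_hom (fscale fk) coind_act Y * vdim fk V" by linarith
  then have "0 < dim_ind_hom (fscale fk) coind_act Y" by simp
  then obtain F where F: "F \<in> ind_hom (fscale fk) coind_act Y" "F \<noteq> 0" using f4.dim_pos_ex by blast
  \<comment> \<open>Values of \<open>F\<close> are pulled back along \<open>u\<close>; injectivity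
    on \<open>J\<close> makes \<open>p\<close> inherit linearity and the twisted
    S-linearity.\<close>
  have "\<exists>x. x \<in> J \<and> u x = F w h" for w h using ind_homD(3)[OF F(1), of w h] by (auto simp: Y_def)
  then obtain p where p: "\<And>w h. p w h \<in> J" "\<And>w h. u (p w h) = F w h" by metis
  show thesis
  proof (rule that[of p J])
    show "p \<noteq> 0"
    proof
      assume "p = 0"
      then have "F w h = 0" for w h using p(2)[of w h] by (simp add: fun_apply lin_zero[OF linu])
      then have "F = 0" by (intro ext) (simp add: fun_apply)
      with F(2) show False ..
    qed
    note sJ = s.subspace_add[OF j(2)] s.subspace_scale[OF j(2)]
    show "p \<in> ind_hom ss (\<lambda>s x. s * x) J"
    proof (rule ind_homI)
      show "lin hs ss (p w)" for w unfolding lin_def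
        by (intro conjI allI inj sJ p)
          (simp_all only: p lin_add[OF linu] lin_scale[OF linu] lin_add[OF ind_homD(1)[OF F(1)]] lin_scale[OF ind_homD(1)[OF F(1)]])
      show "lin sW ss (\<lambda>w. p w h)" for h unfolding lin_def
        by (intro conjI allI inj sJ p)
          (simp_all only: p lin_add[OF linu] lin_scale[OF linu] lin_add[OF ind_homD(2)[OF F(1)]] lin_scale[OF ind_homD(2)[OF F(1)]])
      show "p w h \<in> J" for w h by (rule p)
      show "p (s \<odot> w) h = sw h (\<lambda>a b. (a \<rhd> s) * p w b)" for s w h
      proof (rule inj)
        show "sw h (\<lambda>a b. (a \<rhd> s) * p w b) \<in> J" by (rule sw_mem[OF vs_ss j(2)]) (rule j(5)[OF p(1)])
        show "u (p (s \<odot> w) h) = u (sw h (\<lambda>a b. (a \<rhd> s) * p w b))"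
          by (simp only: p(2) ind_homD(4)[OF F(1)] sw_pull[OF linu] u_mult)
      qed (rule p)
    qed
  qed
qed

text \<open>As p(s w) at h equals (h1 \<rhd> s) p(w) at h2, acting with S c on the value at d
  cancels the twist and leaves an honest S-linear map on W. Not all \<open>\<pi> b\<close> vanish,
  since p w b is the sum of c \<rhd> \<open>\<pi> d w\<close> over the legs c, d of b.\<close>

lemma HomWS_nonzero: obtains \<pi> where "\<pi> \<in> HomWS" "\<pi> \<noteq> 0"
proof -
  obtain V p where p: "p \<in> ind_hom ss (\<lambda>s x. s * x) V" "p \<noteq> 0" using ex_ind_hom_left_ideal .
  note P = ind_homD[OF p(1)]
  note L = linI lin_comp[OF P(1)] lin_comp[OF P(2)]
  define \<pi> where "\<pi> = (\<lambda>b w. sw b (\<lambda>c d. S c \<rhd> p w d))"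
  have "\<pi> b \<in> HomWS" for b unfolding HomWS_def mem_Collect_eq
  proof (intro conjI allI)
    show "lin sW ss (\<pi> b)" unfolding \<pi>_def by (intro L)
    fix s w
    have "\<pi> b (s \<odot> w) = sw b (\<lambda>c d. sw d (\<lambda>x y. sw (S c) (\<lambda>m n. (m \<rhd> (x \<rhd> s)) * (n \<rhd> p w y))))"
      by (simp only: \<pi>_def P(4) sw_pull[OF lin_act_right] act_mult)
    also have "\<dots> = sw b (\<lambda>c d. sw (S c) (\<lambda>m n. sw d (\<lambda>x y. ((m * x) \<rhd> s) * (n \<rhd> p w y))))"
      unfolding act_mult_left[symmetric] by (intro sw_cong sw_swap)
    also have "\<dots> = sw b (\<lambda>c d. sw c (\<lambda>m n. sw d (\<lambda>x y. ((S n * x) \<rhd> s) * (S m \<rhd> p w y))))"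
      by (rule sw_cong, rule sw_S[OF vs_ss]) (intro blinI L)
    also have "\<dots> = sw b (\<lambda>m r. sw r (\<lambda>n d. sw d (\<lambda>x y. ((S n * x) \<rhd> s) * (S m \<rhd> p w y))))"
      by (rule sw_assoc[OF vs_ss]) (intro tlinI L)
    also have "\<dots> = sw b (\<lambda>m r. sw r (\<lambda>v y. sw v (\<lambda>n x. ((S n * x) \<rhd> s) * (S m \<rhd> p w y))))"
      by (rule sw_cong, rule sw_assoc[OF vs_ss, symmetric]) (intro tlinI L)
    also have "\<dots> = sw b (\<lambda>m r. sw r (\<lambda>v y. ss (\<epsilon> v) ((1 \<rhd> s) * (S m \<rhd> p w y))))"
      by (rule sw_cong, rule sw_cong, rule sw_antipode1[where f = "\<lambda>z. (z \<rhd> s) * (S _ \<rhd> p w _)"]) (intro L)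
    also have "\<dots> = sw b (\<lambda>m r. (1 \<rhd> s) * (S m \<rhd> p w r))"
      by (rule sw_cong, rule sw_counit1) (intro L)
    also have "\<dots> = s * \<pi> b w"
      using sw_pull[of ss ss "\<lambda>z. s * z" b "\<lambda>m r. S m \<rhd> p w r"] by (simp add: \<pi>_def linI)
    finally show "\<pi> b (s \<odot> w) = s * \<pi> b w" .
  qed
  moreover have "\<exists>b. \<pi> b \<noteq> 0"
  proof (rule ccontr)
    assume "\<not> ?thesis"
    then have z: "\<pi> b w = 0" for b w by (metis zero_fun_apply)
    have "p w b = 0" for w b
    proof -
      have "p w b = sw b (\<lambda>v y. ss (\<epsilon> v) (1 \<rhd> p w y))"
        using sw_counit1[OF P(1)[of w], of b] by simp
      also have "\<dots> = sw b (\<lambda>v y. sw v (\<lambda>c x. (c * S x) \<rhd> p w y))"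
        by (rule sw_cong, rule sw_antipode2[where f = "\<lambda>z. z \<rhd> p w _", symmetric]) (intro L)
      also have "\<dots> = sw b (\<lambda>c d. sw d (\<lambda>x y. (c * S x) \<rhd> p w y))"
        by (rule sw_assoc[OF vs_ss]) (intro tlinI L)
      also have "\<dots> = sw b (\<lambda>c d. c \<rhd> \<pi> d w)"
        by (simp only: \<pi>_def act_mult_left sw_pull[OF lin_act_right])
      also have "\<dots> = 0" by (simp add: z lin_zero[OF lin_act_right])
      finally show ?thesis .
    qed
    then show False using p(2) by (auto simp: fun_eq_iff fun_apply)
  qed
  ultimately show thesis using that by blast
qed

section \<open>The double centralizer property\<close>

lemma trace_one:
  obtains T :: "'s set" and b \<pi> w where "finite T" "\<And>i. i \<in> T \<Longrightarrow> \<pi> i \<in> HomWS"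
    "(1::'s) = (\<Sum>i\<in>T. b i \<rhd> \<pi> i (w i))"
proof -
  interpret s: vector_space ss by (rule vs_ss)
  let ?G = "{b \<rhd> \<pi> w | b \<pi> w. \<pi> \<in> HomWS}"
  let ?I = "s.span ?G"
  have ind: "P x" if "x \<in> ?I" "P 0" "\<And>x y. P x \<Longrightarrow> P y \<Longrightarrow> P (x + y)" "\<And>c x. P x \<Longrightarrow> P (ss c x)"
      "\<And>b \<pi> w. \<pi> \<in> HomWS \<Longrightarrow> P (b \<rhd> \<pi> w)" for P x
    using that(1) by (rule s.span_induct) (use that(2-) in \<open>auto simp: s.subspace_def\<close>)
  have base: "b \<rhd> \<pi> w \<in> ?I" if "\<pi> \<in> HomWS" for b \<pi> w
    by (rule s.span_base) (use that in blast)
  obtain \<pi>0 where \<pi>0: "\<pi>0 \<in> HomWS" "\<pi>0 \<noteq> 0" using HomWS_nonzero .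
  then obtain w0 where w0: "\<pi>0 w0 \<noteq> 0" by (auto simp: fun_eq_iff fun_apply)
  have "1 \<in> ?I"
  proof (rule H_simple_UNIV[of ?I])
    show "\<pi>0 w0 \<in> ?I" using base[OF \<pi>0(1), of 1 w0] by simp
    show "\<pi>0 w0 \<noteq> 0" by (rule w0)
    show "h \<rhd> x \<in> ?I" if "x \<in> ?I" for h x
      using that
    proof (rule ind)
      show "h \<rhd> (b \<rhd> \<pi> w) \<in> ?I" if "\<pi> \<in> HomWS" for b \<pi> w
        unfolding act_mult_left[symmetric] by (rule base[OF that])
    qed (auto simp: lin_zero[OF lin_act_right] lin_add[OF lin_act_right] lin_scale[OF lin_act_right]
          s.span_zero s.span_add s.span_scale)
    show "two_sided_ideal ?I" unfolding two_sided_ideal_def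
    proof (intro conjI ballI allI)
      show "0 \<in> ?I" by (rule s.span_zero)
      show "x + y \<in> ?I" if "x \<in> ?I" "y \<in> ?I" for x y using that by (rule s.span_add)
      fix x t assume x: "x \<in> ?I"
      show "t * x \<in> ?I" using x
      proof (rule ind)
        fix b \<pi> w assume \<pi>: "\<pi> \<in> HomWS"
        note L = linI lin_comp[OF HomWS(1)[OF \<pi>]]
        \<comment> \<open>A left factor t is moved through b into the argument of the S-linear map,
          at the price of a twist by \<open>\<sigma>\<close>.\<close>
        have "sw b (\<lambda>c d. d \<rhd> \<pi> ((\<sigma> c \<rhd> t) \<odot> w)) = sw b (\<lambda>c d. sw d (\<lambda>m n. ((m * \<sigma> c) \<rhd> t) * (n \<rhd> \<pi> w)))"
          by (simp only: HomWS(2)[OF \<pi>] act_mult act_mult_left)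
        also have "\<dots> = sw b (\<lambda>v n. sw v (\<lambda>c m. ((m * \<sigma> c) \<rhd> t) * (n \<rhd> \<pi> w)))"
          by (rule sw_assoc[OF vs_ss, symmetric]) (intro tlinI L)
        also have "\<dots> = sw b (\<lambda>v n. ss (\<epsilon> v) ((1 \<rhd> t) * (n \<rhd> \<pi> w)))"
          by (rule sw_cong, rule sw_sg1[where f = "\<lambda>z. (z \<rhd> t) * (_ \<rhd> \<pi> w)"]) (intro L)
        also have "\<dots> = (1 \<rhd> t) * (b \<rhd> \<pi> w)"
          by (rule sw_counit1) (intro L)
        finally have "t * (b \<rhd> \<pi> w) = sw b (\<lambda>c d. d \<rhd> \<pi> ((\<sigma> c \<rhd> t) \<odot> w))" by simp
        also have "\<dots> \<in> ?I" by (rule sw_mem[OF vs_ss s.subspace_span]) (rule base[OF \<pi>])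
        finally show "t * (b \<rhd> \<pi> w) \<in> ?I" .
      qed (auto simp: distrib_left s.span_zero s.span_add s.span_scale)
      show "x * t \<in> ?I" using x
      proof (rule ind)
        fix b \<pi> w assume \<pi>: "\<pi> \<in> HomWS"
        note L = linI lin_comp[OF HomWS(1)[OF \<pi>]]
        \<comment> \<open>A right factor is absorbed differently: right multiplication by an element
          of S preserves S-linear maps into S.\<close>
        have "(\<lambda>w. \<pi> w * (S d \<rhd> t)) \<in> HomWS" for d
          using \<pi> unfolding HomWS_def by (auto simp: mult.assoc intro: L)
        note b' = base[OF this]
        have "sw b (\<lambda>c d. c \<rhd> (\<pi> w * (S d \<rhd> t))) = sw b (\<lambda>c d. sw c (\<lambda>m n. (m \<rhd> \<pi> w) * ((n * S d) \<rhd> t)))"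
          by (simp only: act_mult act_mult_left)
        also have "\<dots> = sw b (\<lambda>m r. sw r (\<lambda>n d. (m \<rhd> \<pi> w) * ((n * S d) \<rhd> t)))"
          by (rule sw_assoc[OF vs_ss]) (intro tlinI L)
        also have "\<dots> = sw b (\<lambda>m r. ss (\<epsilon> r) ((m \<rhd> \<pi> w) * (1 \<rhd> t)))"
          by (rule sw_cong, rule sw_antipode2[where f = "\<lambda>z. (_ \<rhd> \<pi> w) * (z \<rhd> t)"]) (intro L)
        also have "\<dots> = (b \<rhd> \<pi> w) * (1 \<rhd> t)"
          by (rule sw_counit2) (intro L)
        finally have "(b \<rhd> \<pi> w) * t = sw b (\<lambda>c d. c \<rhd> (\<pi> w * (S d \<rhd> t)))" by simp
        also have "\<dots> \<in> ?I" by (rule sw_mem[OF vs_ss s.subspace_span]) (rule b')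
        finally show "(b \<rhd> \<pi> w) * t \<in> ?I" .
      qed (auto simp: distrib_right s.span_zero s.span_add s.span_scale)
    qed
  qed
  then obtain T r where T: "finite T" "T \<subseteq> ?G" "1 = (\<Sum>x\<in>T. ss (r x) x)"
    unfolding s.span_explicit by blast
  have "\<forall>x\<in>T. \<exists>b \<pi> w. x = b \<rhd> \<pi> w \<and> \<pi> \<in> HomWS" using T(2) by blast
  then obtain b \<pi> w where bw: "\<forall>x\<in>T. x = b x \<rhd> \<pi> x (w x) \<and> \<pi> x \<in> HomWS" by metis
  show thesis
  proof (rule that[of T \<pi> "\<lambda>x. hs (r x) (b x)" w])
    show "finite T" by fact
    show "\<pi> i \<in> HomWS" if "i \<in> T" for i using bw that by blast
    have "(\<Sum>i\<in>T. hs (r i) (b i) \<rhd> \<pi> i (w i)) = (\<Sum>x\<in>T. ss (r x) x)"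
      by (rule sum.cong) (use bw in \<open>auto simp: lin_scale[OF lin_act_left]\<close>)
    with T(3) show "1 = (\<Sum>i\<in>T. hs (r i) (b i) \<rhd> \<pi> i (w i))" by simp
  qed
qed

lemma double_centralizer:
  assumes g1: "\<And>w. lin hs sW (\<lambda>a. g a w)" and g2: "\<And>a. lin sW sW (g a)"
    and C: "\<And>\<pi> a b w w0. \<pi> \<in> HomWS \<Longrightarrow>
      sw b (\<lambda>c d. d \<rhd> \<pi> (g (\<sigma> c * a) w)) \<odot> w0 = g a ((b \<rhd> \<pi> w) \<odot> w0)"
  shows "\<exists>s. \<forall>a w. g a w = (a \<rhd> s) \<odot> w"
proof -
  obtain T :: "'s set" and b \<pi> v where T: "finite T" "\<And>i. i \<in> T \<Longrightarrow> \<pi> i \<in> HomWS" "1 = (\<Sum>i\<in>T. b i \<rhd> \<pi> i (v i))"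
    using trace_one by metis
  \<comment> \<open>The choice is forced: hypothesis \<open>C\<close> with a = 1, summed over the
    decomposition of 1, says that g 1 w0 = s \<odot> w0.\<close>
  define s where "s = (\<Sum>i\<in>T. sw (b i) (\<lambda>c d. d \<rhd> \<pi> i (g (\<sigma> c) (v i))))"
  have "g a w = (a \<rhd> s) \<odot> w" for a w
  proof -
    have i: "(a \<rhd> sw (b i) (\<lambda>c d. d \<rhd> \<pi> i (g (\<sigma> c) (v i)))) \<odot> w = sw a (\<lambda>p q. g p ((q \<rhd> (b i \<rhd> \<pi> i (v i))) \<odot> w))"
      if "i \<in> T" for i
    proof -
      note \<pi> = T(2)[OF that]
      note L = linI lin_comp[OF HomWS(1)[OF \<pi>]] lin_comp[OF g1] lin_comp[OF g2]
      \<comment> \<open>For general a, \<open>C\<close> is used at the first leg of a, with b i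
        multiplied by the second leg. Anti-multiplicativity of \<open>\<sigma>\<close> brings
        \<sigma> q1 next to p, and these legs of a cancel.\<close>
      have "sw a (\<lambda>p q. g p ((q \<rhd> (b i \<rhd> \<pi> i (v i))) \<odot> w))
         = sw a (\<lambda>p q. sw (q * b i) (\<lambda>c d. d \<rhd> \<pi> i (g (\<sigma> c * p) (v i))) \<odot> w)"
        by (simp only: C[OF \<pi>] act_mult_left)
      also have "\<dots> = sw a (\<lambda>p q. sw q (\<lambda>q1 q2. sw (b i) (\<lambda>c d. (q2 * d) \<rhd> \<pi> i (g (\<sigma> (q1 * c) * p) (v i)))) \<odot> w)"
      proof -
        have "sw (q * b i) (\<lambda>c d. d \<rhd> \<pi> i (g (\<sigma> c * p) (v i)))
          = sw q (\<lambda>q1 q2. sw (b i) (\<lambda>c d. (q2 * d) \<rhd> \<pi> i (g (\<sigma> (q1 * c) * p) (v i))))" for p q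
          by (rule sw_mult[OF vs_ss]) (intro blinI L)
        then show ?thesis by (simp only:)
      qed
      also have "\<dots> = sw a (\<lambda>p q. sw q (\<lambda>q1 q2. sw (b i) (\<lambda>c d. (q2 * d) \<rhd> \<pi> i (g (\<sigma> c * (\<sigma> q1 * p)) (v i))) \<odot> w))"
        by (simp only: sw_pull[OF lin_actW_left] sg_mult mult.assoc)
      also have "\<dots> = sw a (\<lambda>u q2. sw u (\<lambda>p q1. sw (b i) (\<lambda>c d. (q2 * d) \<rhd> \<pi> i (g (\<sigma> c * (\<sigma> q1 * p)) (v i))) \<odot> w))"
        by (rule sw_assoc[OF vs_sW, symmetric]) (intro tlinI L)
      also have "\<dots> = sw a (\<lambda>u q2. sW (\<epsilon> u) (sw (b i) (\<lambda>c d. (q2 * d) \<rhd> \<pi> i (g (\<sigma> c * 1) (v i))) \<odot> w))"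
        by (rule sw_cong, rule sw_sg2[where f = "\<lambda>z. sw (b i) (\<lambda>c d. (_ * d) \<rhd> \<pi> i (g (\<sigma> c * z) (v i))) \<odot> w"]) (intro L)
      also have "\<dots> = sw (b i) (\<lambda>c d. (a * d) \<rhd> \<pi> i (g (\<sigma> c * 1) (v i))) \<odot> w"
        by (rule sw_counit1) (intro L)
      also have "\<dots> = (a \<rhd> sw (b i) (\<lambda>c d. d \<rhd> \<pi> i (g (\<sigma> c) (v i)))) \<odot> w"
        by (simp only: act_mult_left mult_1_right sw_pull[OF lin_act_right])
      finally show ?thesis by simp
    qed
    have "(a \<rhd> s) \<odot> w = (\<Sum>i\<in>T. sw a (\<lambda>p q. g p ((q \<rhd> (b i \<rhd> \<pi> i (v i))) \<odot> w)))"
      by (simp add: s_def lin_sum[OF lin_act_right] lin_sum[OF lin_actW_left] i)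
    also have "\<dots> = sw a (\<lambda>p q. g p ((q \<rhd> (\<Sum>i\<in>T. b i \<rhd> \<pi> i (v i))) \<odot> w))"
      by (simp add: lin_sum[OF lin_act_right] lin_sum[OF lin_actW_left] lin_sum[OF g2] sw_sum)
    also have "\<dots> = sw a (\<lambda>p q. sW (\<epsilon> q) (g p w))"
      by (simp add: T(3)[symmetric] lin_scale[OF lin_actW_left] lin_scale[OF g2])
    also have "\<dots> = g a w" by (rule sw_counit2) (rule g1)
    finally show ?thesis ..
  qed
  then show ?thesis by blast
qed

end

section \<open>The stabilizer of the module algebra\<close>

lemma is_vspace_Hom: 
  assumes V: "is_vspace V" and W: "is_vspace W" shows "is_vspace (Hom V W)"
proof (rule is_vspaceI)
  interpret w: vector_space "scal W" by (rule is_vspace_vs[OF W])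
  show vs: "vector_space (scal (Hom V W))"
    by (simp add: Hom_def vector_space_fscale w.vector_space_axioms)
  interpret f: vector_space "scal (Hom V W)" by (rule vs)
  show "f.subspace (carr (Hom V W))"
    by (rule f.subspI)
      (auto simp: Hom_def linear_on_def fun_apply is_vspace_0[OF W] is_vspace_add[OF W] is_vspace_scale[OF W]
        w.scale_right_distrib mult.commute)
qed

lemma bilinear_onI:
  assumes "\<And>v w w'. v \<in> carr V \<Longrightarrow> w \<in> carr W \<Longrightarrow> w' \<in> carr W \<Longrightarrow> \<beta> v (w + w') = \<beta> v w + \<beta> v w'"
    "\<And>v w c. v \<in> carr V \<Longrightarrow> w \<in> carr W \<Longrightarrow> \<beta> v (scal W c w) = s c (\<beta> v w)"
    "\<And>v v' w. v \<in> carr V \<Longrightarrow> v' \<in> carr V \<Longrightarrow> w \<in> carr W \<Longrightarrow> \<beta> (v + v') w = \<beta> v w + \<beta> v' w"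
    "\<And>v w c. v \<in> carr V \<Longrightarrow> w \<in> carr W \<Longrightarrow> \<beta> (scal V c v) w = s c (\<beta> v w)"
  shows "bilinear_on V W s \<beta>"
  using assms by (auto simp: bilinear_on_def linear_on_def whole_def)

lemma tlift_fun_add:
  assumes V: "is_vspace V" and W: "is_vspace W" and s: "vector_space s"
    and b: "bilinear_on V W s \<beta>" and b': "bilinear_on V W s \<beta>'" and b'': "bilinear_on V W s \<beta>''"
    and eq: "\<And>v w. v \<in> carr V \<Longrightarrow> w \<in> carr W \<Longrightarrow> \<beta>'' v w = \<beta> v w + \<beta>' v w"
  shows "tlift V W \<beta>'' x = tlift V W \<beta> x + tlift V W \<beta>' x"
proof (cases "x \<in> carr (tprod V W)")
  case True
  with V W show ?thesis
    by (induction x rule: tprod_induct)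
      (simp_all add: tlift_zero[OF V W s b] tlift_zero[OF V W s b'] tlift_zero[OF V W s b'']
        tlift_add[OF V W s b] tlift_add[OF V W s b'] tlift_add[OF V W s b'']
        tlift_tensor[OF V W s b] tlift_tensor[OF V W s b'] tlift_tensor[OF V W s b''] eq algebra_simps)
qed (simp add: tlift_outside)

lemma tlift_fun_scale:
  assumes V: "is_vspace V" and W: "is_vspace W" and s: "vector_space s"
    and b: "bilinear_on V W s \<beta>" and b'': "bilinear_on V W s \<beta>''"
    and eq: "\<And>v w. v \<in> carr V \<Longrightarrow> w \<in> carr W \<Longrightarrow> \<beta>'' v w = s c (\<beta> v w)"
  shows "tlift V W \<beta>'' x = s c (tlift V W \<beta> x)"
proof (cases "x \<in> carr (tprod V W)")
  case True
  interpret vector_space s by fact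
  show ?thesis using V W True
    by (induction x rule: tprod_induct)
      (simp_all add: tlift_zero[OF V W s b] tlift_zero[OF V W s b'']
        tlift_add[OF V W s b] tlift_add[OF V W s b'']
        tlift_tensor[OF V W s b] tlift_tensor[OF V W s b''] eq scale_right_distrib)
next
  case False
  interpret vector_space s by fact
  show ?thesis using False by (simp add: tlift_outside)
qed

text \<open>The maps \<open>WH_act\<close>, \<open>R_map\<close>, \<open>HW_act\<close> and
  \<open>L_map\<close> are lifts whose integrand is again a lift; this lemma makes the outer one
  meaningful.\<close>

lemma bilinear_on_tlift:
  assumes V: "is_vspace V" and W: "is_vspace W" and s: "vector_space s" and A: "is_vspace A" and B: "is_vspace B"
    and in': "\<And>a b. a \<in> carr A \<Longrightarrow> b \<in> carr B \<Longrightarrow> bilinear_on V W s (\<beta> a b)"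
    and out: "\<And>v w. v \<in> carr V \<Longrightarrow> w \<in> carr W \<Longrightarrow> bilinear_on A B s (\<lambda>a b. \<beta> a b v w)"
  shows "bilinear_on A B s (\<lambda>a b. tlift V W (\<beta> a b) x)"
proof (rule bilinear_onI)
  fix v w w' assume "v \<in> carr A" "w \<in> carr B" "w' \<in> carr B"
  then show "tlift V W (\<beta> v (w + w')) x = tlift V W (\<beta> v w) x + tlift V W (\<beta> v w') x"
    by (intro tlift_fun_add[OF V W s] in' is_vspace_add[OF B] bilinear_onD(1)[OF out])
next
  fix v w c assume "v \<in> carr A" "w \<in> carr B"
  then show "tlift V W (\<beta> v (scal B c w)) x = s c (tlift V W (\<beta> v w) x)"
    by (intro tlift_fun_scale[OF V W s] in' is_vspace_scale[OF B] bilinear_onD(2)[OF out])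
next
  fix v v' w assume "v \<in> carr A" "v' \<in> carr A" "w \<in> carr B"
  then show "tlift V W (\<beta> (v + v') w) x = tlift V W (\<beta> v w) x + tlift V W (\<beta> v' w) x"
    by (intro tlift_fun_add[OF V W s] in' is_vspace_add[OF A] bilinear_onD(3)[OF out])
next
  fix v w c assume "v \<in> carr A" "w \<in> carr B"
  then show "tlift V W (\<beta> (scal A c v) w) x = s c (tlift V W (\<beta> v w) x)"
    by (intro tlift_fun_scale[OF V W s] in' is_vspace_scale[OF A] bilinear_onD(4)[OF out])
qed

text \<open>A resolution of the identity of \<open>U\<close> into functionals \<open>c i\<close> and
  vectors \<open>b i\<close> shows that an element of V \<otimes> U is determined by its
  contractions with the \<open>c i\<close>. All uniqueness statements for tensors below rest on this
  and its mirror image.\<close>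

lemma tprod_expand_right:
  assumes V: "is_vspace V" and U: "is_vspace U" and x: "x \<in> carr (tprod V U)"
    and c: "\<And>i. i \<in> I \<Longrightarrow> linear_on U (whole (*)) (c i)"
    and ex: "\<And>u. u \<in> carr U \<Longrightarrow> u = (\<Sum>i\<in>I. scal U (c i u) (b i))"
  shows "x = (\<Sum>i\<in>I. tensor V U (tlift V U (\<lambda>v u. scal V (c i u) v) x) (b i))"
proof -
  interpret v: vector_space "scal V" by (rule is_vspace_vs[OF V])
  have bl: "bilinear_on V U (scal V) (\<lambda>v u. scal V (c i u) v)" if "i \<in> I" for i
    using c[OF that] by (intro bilinear_onI)
      (auto simp: linear_on_def v.scale_left_distrib v.scale_right_distrib mult.commute)
  note tl = tlift_zero[OF V U v.vector_space_axioms bl] tlift_add[OF V U v.vector_space_axioms bl]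
    tlift_tensor[OF V U v.vector_space_axioms bl]
  show ?thesis using V U x
  proof (induction x rule: tprod_induct)
    case zero
    have "tensor V U 0 w = 0" for w using tensor_add_left[of V U 0 0 w] by simp
    then show ?case by (simp add: tl)
  next
    case (tensor v w)
    have "tensor V U v w = tensor V U v (\<Sum>i\<in>I. scal U (c i w) (b i))" using ex[OF tensor(2)] by simp
    also have "\<dots> = (\<Sum>i\<in>I. tensor V U v (scal U (c i w) (b i)))"
      by (rule lin_sum[of "scal U" "fscale (*)" "tensor V U v"])
        (simp add: lin_def tensor_add_right tensor_scale_right)
    also have "\<dots> = (\<Sum>i\<in>I. tensor V U (tlift V U (\<lambda>v u. scal V (c i u) v) (tensor V U v w)) (b i))"
      using tensor by (intro sum.cong) (simp_all add: tl tensor_scale_left tensor_scale_right)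
    finally show ?case .
  next
    case (add x y)
    have "x + y = (\<Sum>i\<in>I. tensor V U (tlift V U (\<lambda>v u. scal V (c i u) v) x) (b i))
       + (\<Sum>i\<in>I. tensor V U (tlift V U (\<lambda>v u. scal V (c i u) v) y) (b i))"
      using add(3,4) by simp
    also have "\<dots> = (\<Sum>i\<in>I. tensor V U (tlift V U (\<lambda>v u. scal V (c i u) v) (x + y)) (b i))"
      using add(1,2) by (simp add: tl tensor_add_left sum.distrib)
    finally show ?case .
  qed
qed

lemma tprod_expand_left:
  assumes V: "is_vspace V" and U: "is_vspace U" and x: "x \<in> carr (tprod U V)"
    and c: "\<And>i. i \<in> I \<Longrightarrow> linear_on U (whole (*)) (c i)"
    and ex: "\<And>u. u \<in> carr U \<Longrightarrow> u = (\<Sum>i\<in>I. scal U (c i u) (b i))"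
  shows "x = (\<Sum>i\<in>I. tensor U V (b i) (tlift U V (\<lambda>u v. scal V (c i u) v) x))"
proof -
  interpret v: vector_space "scal V" by (rule is_vspace_vs[OF V])
  have bl: "bilinear_on U V (scal V) (\<lambda>u v. scal V (c i u) v)" if "i \<in> I" for i
    using c[OF that] by (intro bilinear_onI)
      (auto simp: linear_on_def v.scale_left_distrib v.scale_right_distrib mult.commute)
  note tl = tlift_zero[OF U V v.vector_space_axioms bl] tlift_add[OF U V v.vector_space_axioms bl]
    tlift_tensor[OF U V v.vector_space_axioms bl]
  show ?thesis using U V x
  proof (induction x rule: tprod_induct)
    case zero
    have "tensor U V w 0 = 0" for w using tensor_add_right[of U V w 0 0] by simp
    then show ?case by (simp add: tl)
  next
    case (tensor w v)
    have "tensor U V w v = tensor U V (\<Sum>i\<in>I. scal U (c i w) (b i)) v" using ex[OF tensor(1)] by simp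
    also have "\<dots> = (\<Sum>i\<in>I. tensor U V (scal U (c i w) (b i)) v)"
      by (rule lin_sum[of "scal U" "fscale (*)" "\<lambda>w. tensor U V w v"])
        (simp add: lin_def tensor_add_left tensor_scale_left)
    also have "\<dots> = (\<Sum>i\<in>I. tensor U V (b i) (tlift U V (\<lambda>u v. scal V (c i u) v) (tensor U V w v)))"
      using tensor by (intro sum.cong) (simp_all add: tl tensor_scale_left tensor_scale_right)
    finally show ?case .
  next
    case (add x y)
    have "x + y = (\<Sum>i\<in>I. tensor U V (b i) (tlift U V (\<lambda>u v. scal V (c i u) v) x))
       + (\<Sum>i\<in>I. tensor U V (b i) (tlift U V (\<lambda>u v. scal V (c i u) v) y))"
      using add(3,4) by simp
    also have "\<dots> = (\<Sum>i\<in>I. tensor U V (b i) (tlift U V (\<lambda>u v. scal V (c i u) v) (x + y)))"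
      using add(1,2) by (simp add: tl tensor_add_right sum.distrib)
    finally show ?case .
  qed
qed

lemma vs_distrib:
  "vector_space t \<Longrightarrow> t (a + b) x = t a x + t b x" "vector_space t \<Longrightarrow> t a (x + y) = t a x + t a y"
  by (auto simp: vector_space_def)

context hopf_module begin

section \<open>Carriers, dual bases and the coaction on S\<close>

abbreviation "WW \<equiv> whole sW"
abbreviation "DD \<equiv> dual (hsp H)"
abbreviation "EW \<equiv> End WW"
abbreviation "MM \<equiv> tprod WW (hsp H)"
abbreviation "DW \<equiv> tprod DD WW"
abbreviation "TW \<equiv> tensor WW (hsp H)"
abbreviation "TD \<equiv> tensor DD WW"
abbreviation "TE \<equiv> tensor EW (hsp H)"
abbreviation "TL \<equiv> tensor DD EW"
abbreviation "S_alg \<equiv> to_modalg ss actS"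
abbreviation "S_comod \<equiv> module_to_comodule H S_alg"
abbreviation "WHa \<equiv> WH_act H WW S_comod actW"
abbreviation "KK \<equiv> Stab_right H WW S_comod actW"

lemma carr_DD [simp]: "carr DD = {\<alpha>. lin hs (*) \<alpha>}" and scal_DD [simp]: "scal DD = fscale (*)"
  by (auto simp: Hom_def linear_on_def lin_def)

lemma carr_EW [simp]: "carr EW = {f. lin sW sW f}" and scal_EW [simp]: "scal EW = fscale sW"
  by (auto simp: Hom_def linear_on_def lin_def)

lemma vsp_W [simp]: "is_vspace WW" by (rule is_vspace_whole) simp
lemma vsp_D [simp]: "is_vspace DD" by (intro is_vspace_Hom is_vspace_whole) simp_all
lemma vsp_E [simp]: "is_vspace EW" by (intro is_vspace_Hom) simp_all
lemma vs_ft [simp]: "vector_space (fscale ((*) :: 'k \<Rightarrow> 'k \<Rightarrow> 'k))" by (rule vs_fscale) simp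

lemma S_comod_simps [simp]: "carr S_comod = UNIV" "scal S_comod = ss" "amult S_comod = (*)" "aone S_comod = 1"
  by (auto simp: module_to_comodule_def to_modalg_def)

lemma S_alg_simps [simp]: "carr S_alg = UNIV" "scal S_alg = ss" "hact S_alg = actS" "amult S_alg = (*)" "aone S_alg = 1"
  by (auto simp: to_modalg_def)

lemma vsp_S_comod [simp]: "is_vspace S_comod" and vsp_S_alg [simp]: "is_vspace S_alg"
proof -
  interpret vector_space ss by (rule vs_ss)
  show "is_vspace S_comod" "is_vspace S_alg"
    by (simp_all add: is_vspace_def subspace_UNIV vector_space_axioms)
qed

lemma D_expand: assumes "lin hs (*) \<alpha>" shows "\<alpha> = (\<Sum>b\<in>HB. fscale (*) (\<alpha> b) (e b))"
proof
  fix x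
  have "\<alpha> x = (\<Sum>b\<in>HB. e b x * \<alpha> b)" by (rule HB.lin_crd[OF assms, symmetric])
  then show "\<alpha> x = (\<Sum>b\<in>HB. fscale (*) (\<alpha> b) (e b)) x"
    by (simp add: sum_apply mult.commute)
qed

lemma DV_expand:
  assumes V: "is_vspace V" and x: "x \<in> carr (tprod DD V)"
  shows "x = (\<Sum>b\<in>HB. tensor DD V (e b) (tlift DD V (\<lambda>\<alpha> v. scal V (\<alpha> b) v) x))"
  by (rule tprod_expand_left[OF V vsp_D x, where c = "\<lambda>b \<alpha>. \<alpha> b"])
    (auto simp: linear_on_def fun_apply intro: D_expand)

lemma VD_expand:
  assumes V: "is_vspace V" and x: "x \<in> carr (tprod V DD)"
  shows "x = (\<Sum>b\<in>HB. tensor V DD (tlift V DD (\<lambda>v \<alpha>. scal V (\<alpha> b) v) x) (e b))"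
  by (rule tprod_expand_right[OF V vsp_D x, where c = "\<lambda>b \<alpha>. \<alpha> b"])
    (auto simp: linear_on_def fun_apply intro: D_expand)

lemma VH_expand:
  assumes V: "is_vspace V" and x: "x \<in> carr (tprod V (hsp H))"
  shows "x = (\<Sum>b\<in>HB. tensor V (hsp H) (tlift V (hsp H) (\<lambda>v h. scal V (e b h) v) x) b)"
  by (rule tprod_expand_right[OF V vsp_H x, where c = "\<lambda>b. e b"])
    (auto simp: linear_on_def lin_add[OF lin_e] lin_scale[OF lin_e] HB.crd_expand)

text \<open>Uniqueness holds because an element of S \<otimes> DD is recovered from its evaluations
  at the basis of H, and these are prescribed to be b \<rhd> s.\<close>

lemma rcoact_S_comod: "rcoact S_comod s = (\<Sum>b\<in>HB. tensor S_comod DD (b \<rhd> s) (e b))"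
proof -
  let ?P = "\<lambda>x. x \<in> carr (tprod S_alg DD) \<and> (\<forall>h. h \<rhd> s = tlift S_alg DD (\<lambda>s0 \<alpha>. ss (\<alpha> h) s0) x)"
  have bl: "bilinear_on S_alg DD ss (\<lambda>s0 \<alpha>. ss (\<alpha> h) s0)" for h
    by (rule bilinear_onI) (auto simp: fun_apply vs_distrib[OF vs_ss] vs_simps mult.commute)
  note tl = tlift_zero[OF vsp_S_alg vsp_D vs_ss bl] tlift_add[OF vsp_S_alg vsp_D vs_ss bl]
    tlift_tensor[OF vsp_S_alg vsp_D vs_ss bl]
  have inS: "(\<Sum>b\<in>B. tensor S_alg DD (b \<rhd> s) (e b)) \<in> carr (tprod S_alg DD)" for B
    by (rule is_vspace_sum[OF is_vspace_tprod]) (auto intro!: tensor_in_tprod lin_e)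
  have tlS: "tlift S_alg DD (\<lambda>s0 \<alpha>. ss (\<alpha> h) s0) (\<Sum>b\<in>B. tensor S_alg DD (b \<rhd> s) (e b)) = (\<Sum>b\<in>B. ss (e b h) (b \<rhd> s))"
    if "finite B" for B h
    using that by (induction B) (auto simp: tl inS tensor_in_tprod lin_e)
  have "rcoact S_comod s = (THE x. ?P x)" by (simp add: module_to_comodule_def)
  also have "\<dots> = (\<Sum>b\<in>HB. tensor S_alg DD (b \<rhd> s) (e b))"
  proof (rule the_equality)
    show "?P (\<Sum>b\<in>HB. tensor S_alg DD (b \<rhd> s) (e b))"
      using inS tlS[OF HB.finB] HB.lin_crd[OF lin_act_left] by simp
    fix x assume x: "?P x"
    then have "x = (\<Sum>b\<in>HB. tensor S_alg DD (tlift S_alg DD (\<lambda>v \<alpha>. ss (\<alpha> b) v) x) (e b))"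
      using VD_expand[of S_alg x] by simp
    then show "x = (\<Sum>b\<in>HB. tensor S_alg DD (b \<rhd> s) (e b))" using x by simp
  qed
  also have "tensor S_alg DD = tensor S_comod DD" by (rule tensor_cong_scal) simp_all
  finally show ?thesis .
qed

lemma tlift_finsum:
  assumes "is_vspace V" "is_vspace W" "vector_space s" "bilinear_on V W s \<beta>"
    and "finite I" "\<And>i. i \<in> I \<Longrightarrow> v i \<in> carr V" "\<And>i. i \<in> I \<Longrightarrow> w i \<in> carr W"
  shows "tlift V W \<beta> (\<Sum>i\<in>I. tensor V W (v i) (w i)) = (\<Sum>i\<in>I. \<beta> (v i) (w i))"
  using assms(5-)
proof (induction I)
  case empty
  then show ?case by (simp add: tlift_zero[OF assms(1-4)])
next
  case (insert i I)
  have "(\<Sum>i\<in>I. tensor V W (v i) (w i)) \<in> carr (tprod V W)"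
    by (rule is_vspace_sum[OF is_vspace_tprod]) (auto intro!: tensor_in_tprod insert.prems)
  with insert show ?case
    by (simp add: tlift_add[OF assms(1-4)] tlift_tensor[OF assms(1-4)] tensor_in_tprod)
qed

section \<open>The action of S on W \<otimes> H\<close>

lemma lin_TW_left [linI]: "lin s sW f \<Longrightarrow> lin s (fscale (*)) (\<lambda>x. TW (f x) h)"
  by (rule lin_tensor_left) simp

lemma lin_TD_right [linI]: "lin s sW f \<Longrightarrow> lin s (fscale (*)) (\<lambda>x. TD \<beta> (f x))"
  by (rule lin_tensor_right) simp

lemma lharp_sw: "lin hs (*) \<alpha> \<Longrightarrow> lharp H \<alpha> h = sw h (\<lambda>a b. hs (\<alpha> (\<sigma> a)) b)"
proof -
  assume a: "lin hs (*) \<alpha>"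
  show ?thesis unfolding lharp_def
    by (rule sweedler_sw[OF vs_hs]) (intro blinI linI lin_comp[OF a])
qed

lemma bl_M: "(\<And>w. lin hs t (\<beta> w)) \<Longrightarrow> (\<And>h. lin sW t (\<lambda>w. \<beta> w h)) \<Longrightarrow> bilinear_on WW (hsp H) t \<beta>"
  by (rule bilinear_on_wholeI)

lemma bilinear_lharp:
  assumes "lin hs (*) s1"
  shows "bilinear_on WW (hsp H) (fscale (*)) (\<lambda>w h. TW (s0 \<odot> w) (lharp H s1 h))"
  using assms by (intro bl_M) (auto simp: lharp_sw intro!: linI lin_comp[OF assms])

lemma WH_act_expand:
  "WHa s x = (\<Sum>b\<in>HB. tlift WW (hsp H) (\<lambda>w h. TW ((b \<rhd> s) \<odot> w) (lharp H (e b) h)) x)"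
proof -
  let ?\<beta> = "\<lambda>s0 s1 w h. TW (s0 \<odot> w) (lharp H s1 h)"
  have out: "bilinear_on S_comod DD (fscale (*)) (\<lambda>s0 s1. ?\<beta> s0 s1 w h)" for w h
  proof (rule bilinear_onI)
    fix v v' assume "v \<in> carr DD" "v' \<in> carr DD"
    then have v: "lin hs (*) v" "lin hs (*) v'" "lin hs (*) (v + v')"
      by (auto intro: lin_plus_fun)
    have "lharp H (v + v') h = lharp H v h + lharp H v' h"
      by (simp add: lharp_sw v fun_apply vs_distrib[OF vs_hs] sw_add)
    then show "TW (s0 \<odot> w) (lharp H (v + v') h) = TW (s0 \<odot> w) (lharp H v h) + TW (s0 \<odot> w) (lharp H v' h)" for s0
      by (simp add: tensor_add_right)
  next
    fix v c assume "v \<in> carr DD"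
    then have v: "lin hs (*) v" "lin hs (*) (fscale (*) c v)" by (auto intro: lin_fscale)
    have "lharp H (fscale (*) c v) h = hs c (lharp H v h)"
      using sw_scale[OF vs_hs, of h c "\<lambda>a b. hs (v (\<sigma> a)) b"] by (simp add: lharp_sw v)
    then show "TW (s0 \<odot> w) (lharp H (scal DD c v) h) = fscale (*) c (TW (s0 \<odot> w) (lharp H v h))" for s0
      using tensor_scale_right[of WW "hsp H" "s0 \<odot> w" c] by simp
  next
    show "TW ((s0 + s0') \<odot> w) (lharp H s1 h) = TW (s0 \<odot> w) (lharp H s1 h) + TW (s0' \<odot> w) (lharp H s1 h)" for s0 s0' s1
      by (simp add: lin_add[OF lin_actW_left] tensor_add_left)
    show "TW (scal S_comod c s0 \<odot> w) (lharp H s1 h) = fscale (*) c (TW (s0 \<odot> w) (lharp H s1 h))" for s0 c s1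
      using tensor_scale_left[of WW "hsp H" c "s0 \<odot> w"] by (simp add: lin_scale[OF lin_actW_left])
  qed
  have bo: "bilinear_on S_comod DD (fscale (*)) (\<lambda>s0 s1. tlift WW (hsp H) (?\<beta> s0 s1) x)" for x
    by (rule bilinear_on_tlift) (auto intro: bilinear_lharp out)
  show ?thesis
    unfolding WH_act_def rcoact_S_comod
    by (rule tlift_finsum[OF _ _ _ bo]) (auto simp: HB.finB lin_e)
qed

text \<open>The dual bases introduced by the coaction disappear again, because h \<mapsto> h \<rhd>
  s is linear and only its value at \<sigma> a is needed.\<close>

lemma WH_act_tensor:
  "WHa s (TW w h) = sw h (\<lambda>a c. TW ((\<sigma> a \<rhd> s) \<odot> w) c)"
proof -
  let ?\<beta> = "\<lambda>s0 s1 w h. TW (s0 \<odot> w) (lharp H s1 h)"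
  have "WHa s (TW w h) = (\<Sum>b\<in>HB. ?\<beta> (b \<rhd> s) (e b) w h)"
    unfolding WH_act_expand
    by (intro sum.cong refl tlift_tensor[OF vsp_W vsp_H vs_ft bilinear_lharp]) (auto simp: lin_e)
  also have "\<dots> = (\<Sum>b\<in>HB. sw h (\<lambda>a c. TW (((ss (e b (\<sigma> a)) (b \<rhd> s))) \<odot> w) c))"
  proof (rule sum.cong[OF refl])
    fix b
    have l: "lin hs (fscale (*)) (TW u)" for u by (intro linI)
    have "TW u (hs k z) = TW (sW k u) z" for u k z
      using tensor_scale_right[of WW "hsp H" u k z] tensor_scale_left[of WW "hsp H" k u z] by simp
    then show "TW ((b \<rhd> s) \<odot> w) (lharp H (e b) h) = sw h (\<lambda>a c. TW ((ss (e b (\<sigma> a)) (b \<rhd> s)) \<odot> w) c)"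
      by (simp add: lharp_sw lin_e sw_pull[OF l] lin_scale[OF lin_actW_left])
  qed
  also have "\<dots> = sw h (\<lambda>a c. \<Sum>b\<in>HB. TW (((ss (e b (\<sigma> a)) (b \<rhd> s))) \<odot> w) c)"
    by (rule sw_sum[symmetric])
  also have "\<dots> = sw h (\<lambda>a c. TW ((\<sigma> a \<rhd> s) \<odot> w) c)"
  proof -
    have l: "lin ss (fscale (*)) (\<lambda>s. TW (s \<odot> w) c)" for c by (intro linI)
    show ?thesis by (simp add: lin_sum[OF l, symmetric] HB.lin_crd[OF lin_act_left])
  qed
  finally show ?thesis .
qed

lemma WH_act_zero: "WHa s 0 = 0"
  by (simp add: WH_act_expand tlift_zero[OF vsp_W vsp_H vs_ft bilinear_lharp] lin_e)

lemma WH_act_add: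
  "x \<in> carr MM \<Longrightarrow> y \<in> carr MM \<Longrightarrow>
    WHa s (x + y) = WHa s x + WHa s y"
  by (simp add: WH_act_expand tlift_add[OF vsp_W vsp_H vs_ft bilinear_lharp] lin_e sum.distrib)

lemma TW_in [simp]: "TW w h \<in> carr MM"
  by (rule tensor_in_tprod) simp_all

lemma WH_act_in: "x \<in> carr MM \<Longrightarrow> WHa s x \<in> carr MM"
  unfolding WH_act_expand
  by (intro is_vspace_sum[OF is_vspace_tprod] tlift_in[OF vsp_W vsp_H vs_ft bilinear_lharp])
    (auto simp: lin_e is_vspace_tprod)

lemma WH_act_sum_list:
  assumes "\<And>a b. (a, b) \<in> set xs \<Longrightarrow> g a b \<in> carr MM"
  shows "WHa s (\<Sum>(a, b)\<leftarrow>xs. g a b) = (\<Sum>(a, b)\<leftarrow>xs. WHa s (g a b))"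
  using assms
  by (induction xs) (auto simp: WH_act_zero WH_act_add is_vspace_sum_list[OF is_vspace_tprod])

text \<open>The slice map id \<otimes> \<alpha>, turning identities of tensors into identities in
  W.\<close>

definition contract :: "('h \<Rightarrow> 'k) \<Rightarrow> ('w, 'h, 'k) tensor \<Rightarrow> 'w"
  where "contract \<alpha> = tlift WW (hsp H) (\<lambda>w h. sW (\<alpha> h) w)"

lemma bilinear_contract: "lin hs (*) \<alpha> \<Longrightarrow> bilinear_on WW (hsp H) sW (\<lambda>w h. sW (\<alpha> h) w)"
  by (intro bl_M linI) (auto intro: linI lin_comp)

lemma contract_tensor: "lin hs (*) \<alpha> \<Longrightarrow> contract \<alpha> (TW w h) = sW (\<alpha> h) w"
  unfolding contract_def by (rule tlift_tensor[OF vsp_W vsp_H vs_sW bilinear_contract]) simp_all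

lemma contract_sum_list:
  assumes "lin hs (*) \<alpha>" "\<And>a b. (a, b) \<in> set xs \<Longrightarrow> g a b \<in> carr MM"
  shows "contract \<alpha> (\<Sum>(a, b)\<leftarrow>xs. g a b) = (\<Sum>(a, b)\<leftarrow>xs. contract \<alpha> (g a b))"
  unfolding contract_def by (rule tlift_sum_list[OF vsp_W vsp_H vs_sW bilinear_contract[OF assms(1)] assms(2)])

lemma contract_sw:
  assumes "lin hs (*) \<alpha>" "\<And>a b. g a b \<in> carr MM"
  shows "contract \<alpha> (sw h g) = sw h (\<lambda>a b. contract \<alpha> (g a b))"
  unfolding sw_def by (rule contract_sum_list[OF assms])

section \<open>\<open>R_map\<close> on explicit sums of pure tensors\<close>

definition R_factor :: "('w \<Rightarrow> 'w) \<Rightarrow> 'h \<Rightarrow> ('w, 'h, 'k) tensor \<Rightarrow> ('w, 'h, 'k) tensor"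
  where "R_factor f h = tlift WW (hsp H) (\<lambda>w t. TW (f w) (t * h))"

lemma bilinear_R_factor1: assumes "lin sW sW f" shows "bilinear_on WW (hsp H) (fscale (*)) (\<lambda>w t. TW (f w) (t * h))"
  by (intro bl_M linI lin_comp[OF assms])

lemma bilinear_R_factor: "bilinear_on EW (hsp H) (fscale (*)) (\<lambda>f h. R_factor f h x)"
  unfolding R_factor_def
proof (rule bilinear_on_tlift[OF vsp_W vsp_H vs_ft vsp_E vsp_H])
  fix f :: "'w \<Rightarrow> 'w" and h :: 'h
  assume "f \<in> carr EW" "h \<in> carr (hsp H)"
  then show "bilinear_on WW (hsp H) (fscale (*)) (\<lambda>w t. TW (f w) (t * h))"
    by (simp add: bilinear_R_factor1)
next
  fix w t
  show "bilinear_on EW (hsp H) (fscale (*)) (\<lambda>f h. TW (f w) (t * h))"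
  proof (rule bilinear_onI)
    have l: "lin hs (fscale (*)) (\<lambda>h. TW (f w) (t * h))" for f :: "'w \<Rightarrow> 'w" by (intro linI)
    show "TW (f w) (t * (h + h')) = TW (f w) (t * h) + TW (f w) (t * h')" for f :: "'w \<Rightarrow> 'w" and h h'
      by (rule lin_add[OF l])
    show "TW (f w) (t * scal (hsp H) c h) = fscale (*) c (TW (f w) (t * h))" for f :: "'w \<Rightarrow> 'w" and h c
      using lin_scale[OF l[of f], of c h] by simp
    show "TW ((f + f') w) (t * h) = TW (f w) (t * h) + TW (f' w) (t * h)" for f f' :: "'w \<Rightarrow> 'w" and h
      by (simp add: fun_apply tensor_add_left)
    show "TW (scal EW c f w) (t * h) = fscale (*) c (TW (f w) (t * h))" for f :: "'w \<Rightarrow> 'w" and h c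
      using tensor_scale_left[of WW "hsp H" c "f w" "t * h"] by simp
  qed
qed

lemma R_factor_tensor: "lin sW sW f \<Longrightarrow> R_factor f h (TW w t) = TW (f w) (t * h)"
  unfolding R_factor_def by (rule tlift_tensor[OF vsp_W vsp_H vs_ft bilinear_R_factor1]) simp_all

lemma R_factor_add: "lin sW sW f \<Longrightarrow> x \<in> carr MM \<Longrightarrow> y \<in> carr MM \<Longrightarrow> R_factor f h (x + y) = R_factor f h x + R_factor f h y"
  unfolding R_factor_def by (rule tlift_add[OF vsp_W vsp_H vs_ft bilinear_R_factor1])

lemma R_factor_scale: "lin sW sW f \<Longrightarrow> x \<in> carr MM \<Longrightarrow> R_factor f h (fscale (*) c x) = fscale (*) c (R_factor f h x)"
  unfolding R_factor_def by (rule tlift_scale[OF vsp_W vsp_H vs_ft bilinear_R_factor1])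

lemma R_factor_in: "lin sW sW f \<Longrightarrow> x \<in> carr MM \<Longrightarrow> R_factor f h x \<in> carr MM"
  unfolding R_factor_def by (rule tlift_in[OF vsp_W vsp_H vs_ft bilinear_R_factor1 _ is_vspace_tprod]) simp_all

text \<open>Elements of End(W) \<otimes> H are handled through lists of pure tensors representing
  them, so that the structure maps become finite sums. The representing list is not unique, and
  nothing requires it to be.\<close>

definition E_list :: "(('w \<Rightarrow> 'w) \<times> 'h) list \<Rightarrow> bool"
  where "E_list ys \<longleftrightarrow> (\<forall>(f, h)\<in>set ys. lin sW sW f)"

definition E_tensor :: "(('w \<Rightarrow> 'w) \<times> 'h) list \<Rightarrow> ('w \<Rightarrow> 'w, 'h, 'k) tensor"
  where "E_tensor ys = (\<Sum>(f, h)\<leftarrow>ys. TE f h)"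

abbreviation "RM \<equiv> R_map H WW"

lemma E_list_set: "E_list ys \<Longrightarrow> set ys \<subseteq> carr EW \<times> carr (hsp H)"
  by (auto simp: E_list_def)

lemma E_listD: "E_list ys \<Longrightarrow> (f, h) \<in> set ys \<Longrightarrow> lin sW sW f"
  by (auto simp: E_list_def)

lemma E_tensor_in: "E_list ys \<Longrightarrow> E_tensor ys \<in> carr (tprod EW (hsp H))"
  unfolding E_tensor_def by (rule tensor_sum_in_tprod[OF E_list_set])

lemma E_tensor_ex: assumes "y \<in> carr (tprod EW (hsp H))" obtains ys where "E_list ys" "y = E_tensor ys"
proof -
  obtain ys where "set ys \<subseteq> carr EW \<times> carr (hsp H)" "y = (\<Sum>(f, h)\<leftarrow>ys. TE f h)"
    using tprod_sumE[OF vsp_E vsp_H assms] .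
  then show thesis by (intro that[of ys]) (auto simp: E_list_def E_tensor_def)
qed

lemma RM_E_tensor: "E_list ys \<Longrightarrow> RM (E_tensor ys) x = (\<Sum>(f, h)\<leftarrow>ys. R_factor f h x)"
  unfolding R_map_def R_factor_def[symmetric] E_tensor_def
  by (rule tlift_sum[OF vsp_E vsp_H vs_ft bilinear_R_factor E_list_set])

lemma sum_list_cong_pair: "(\<And>a b. (a, b) \<in> set xs \<Longrightarrow> f a b = g a b) \<Longrightarrow> (\<Sum>(a, b)\<leftarrow>xs. f a b) = (\<Sum>(a, b)\<leftarrow>xs. g a b)"
  by (induction xs) auto

lemma sum_list_add_pair: "(\<Sum>(a, b)\<leftarrow>xs. f a b + g a b) = (\<Sum>(a, b)\<leftarrow>xs. f a b) + (\<Sum>(a, b)\<leftarrow>xs. g a b :: 'z::ab_group_add)"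
  by (induction xs) (auto simp: algebra_simps)

lemma RM_tensor: assumes "E_list ys" shows "RM (E_tensor ys) (TW w t) = (\<Sum>(f, h)\<leftarrow>ys. TW (f w) (t * h))"
  unfolding RM_E_tensor[OF assms] by (rule sum_list_cong_pair) (simp add: R_factor_tensor E_listD[OF assms])

lemma RM_add: assumes "E_list ys" "x \<in> carr MM" "y \<in> carr MM"
  shows "RM (E_tensor ys) (x + y) = RM (E_tensor ys) x + RM (E_tensor ys) y"
  unfolding RM_E_tensor[OF assms(1)] sum_list_add_pair[symmetric]
  by (rule sum_list_cong_pair) (simp add: R_factor_add E_listD[OF assms(1)] assms(2,3))

lemma RM_scale: assumes "E_list ys" "x \<in> carr MM"
  shows "RM (E_tensor ys) (fscale (*) c x) = fscale (*) c (RM (E_tensor ys) x)"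
proof -
  have l: "lin (fscale (*)) (fscale (*)) (fscale (*) c :: ('w, 'h, 'k) tensor \<Rightarrow> _)"
    by (rule lin_scale_const[OF vs_ft lin_id])
  show ?thesis unfolding RM_E_tensor[OF assms(1)] lin_sum_list[OF l]
    by (rule sum_list_cong_pair) (simp add: R_factor_scale E_listD[OF assms(1)] assms(2))
qed

lemma RM_in: assumes "E_list ys" "x \<in> carr MM" shows "RM (E_tensor ys) x \<in> carr MM"
  unfolding RM_E_tensor[OF assms(1)]
  by (rule is_vspace_sum_list[OF is_vspace_tprod]) (simp add: R_factor_in E_listD[OF assms(1)] assms(2))

lemma RM_outside: assumes "E_list ys" "x \<notin> carr MM" shows "RM (E_tensor ys) x = 0"
  unfolding RM_E_tensor[OF assms(1)] R_factor_def using assms(2)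
  by (simp add: tlift_outside case_prod_unfold)

lemma RM_zero: assumes "E_list ys" shows "RM (E_tensor ys) 0 = 0"
  using RM_add[OF assms is_vspace_0[OF is_vspace_tprod] is_vspace_0[OF is_vspace_tprod]] by simp

lemma RM_End: assumes "E_list ys" shows "RM (E_tensor ys) \<in> carr (End MM)"
  using assms by (auto simp: Hom_def linear_on_def RM_in RM_add RM_scale RM_outside)

lemma RM_sum_list:
  assumes "E_list ys" "\<And>a b. (a, b) \<in> set xs \<Longrightarrow> g a b \<in> carr MM"
  shows "RM (E_tensor ys) (\<Sum>(a, b)\<leftarrow>xs. g a b) = (\<Sum>(a, b)\<leftarrow>xs. RM (E_tensor ys) (g a b))"
  using assms(2)
  by (induction xs) (auto simp: RM_zero[OF assms(1)] RM_add[OF assms(1)] is_vspace_sum_list[OF is_vspace_tprod])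

lemma RM_append: assumes "E_list ys" "E_list zs" shows "RM (E_tensor (ys @ zs)) = RM (E_tensor ys) + RM (E_tensor zs)"
proof
  fix x
  have "E_list (ys @ zs)" using assms by (auto simp: E_list_def)
  then show "RM (E_tensor (ys @ zs)) x = (RM (E_tensor ys) + RM (E_tensor zs)) x"
    by (simp add: RM_E_tensor assms fun_apply)
qed

lemma fun_sum_list_apply: "(\<Sum>(a, b)\<leftarrow>xs. g a b) x = (\<Sum>(a, b)\<leftarrow>xs. g a b x)"
  by (induction xs) (auto simp: fun_apply)

lemma contract_RM: 
  assumes "E_list ys" "lin hs (*) \<alpha>"
  shows "contract \<alpha> (RM (E_tensor ys) (TW w t)) = (\<Sum>(f, h)\<leftarrow>ys. sW (\<alpha> (t * h)) (f w))"
  unfolding RM_tensor[OF assms(1)] by (simp add: contract_sum_list[OF assms(2)] contract_tensor[OF assms(2)])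

text \<open>The values on w \<otimes> 1, sliced by the coordinates of H, are the coefficients of the
  tensor with respect to the basis of H.\<close>

lemma RM_inj:
  assumes "E_list ys" "E_list zs" "RM (E_tensor ys) = RM (E_tensor zs)" shows "E_tensor ys = E_tensor zs"
proof -
  have bl: "bilinear_on EW (hsp H) (fscale sW) (\<lambda>f h. fscale sW (e b h) f)" for b
    by (rule bilinear_onI) (auto simp: fun_apply fun_eq_iff vs_distrib[OF vs_sW] vs_simps[OF vs_sW]
        lin_add[OF lin_e] lin_scale[OF lin_e] mult.commute)
  have c: "tlift EW (hsp H) (\<lambda>f h. fscale sW (e b h) f) (E_tensor xs) w = contract (e b) (RM (E_tensor xs) (TW w 1))"
    if "E_list xs" for xs b w
    unfolding E_tensor_def tlift_sum[OF vsp_E vsp_H vs_fscale[OF vs_sW] bl E_list_set[OF that]] 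
    by (simp add: contract_RM[OF that lin_e, unfolded E_tensor_def] fun_sum_list_apply fscale_apply)
  have c': "tlift EW (hsp H) (\<lambda>f h. fscale sW (e b h) f) (E_tensor ys) = tlift EW (hsp H) (\<lambda>f h. fscale sW (e b h) f) (E_tensor zs)" for b
    by (rule ext) (simp add: c assms)
  show ?thesis
    using VH_expand[OF vsp_E E_tensor_in[OF assms(1)]] VH_expand[OF vsp_E E_tensor_in[OF assms(2)]] c' by simp
qed

lemma R_inv_E_tensor: "E_list ys \<Longrightarrow> the_inv_into (carr (tprod EW (hsp H))) RM (RM (E_tensor ys)) = E_tensor ys"
proof (rule the_inv_into_f_f)
  show "inj_on RM (carr (tprod EW (hsp H)))"
    by (rule inj_onI) (metis E_tensor_ex RM_inj)
qed (rule E_tensor_in)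

text \<open>\<open>S\<close>-linearity of \<open>R_map\<close> of a tensor, tested on \<open>W \<otimes> 1\<close> and contracted with functionals.\<close>

definition stab_cond :: "(('w \<Rightarrow> 'w) \<times> 'h) list \<Rightarrow> bool"
  where "stab_cond ys \<longleftrightarrow> (\<forall>s w \<alpha>. lin hs (*) \<alpha> \<longrightarrow>
    (\<Sum>(f, h)\<leftarrow>ys. sw h (\<lambda>a c. sW (\<alpha> c) ((\<sigma> a \<rhd> s) \<odot> f w))) = (\<Sum>(f, h)\<leftarrow>ys. sW (\<alpha> h) (f (s \<odot> w))))"

text \<open>Only scalar functionals occur in \<open>stab_cond\<close>. A general bilinear
  \<open>\<Psi>\<close> is reduced to them by expanding its H-argument over the basis.\<close>

lemma stab_cond_bilinear:
  assumes c: "stab_cond ys" and t: "vector_space t"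
    and l1: "\<And>w. lin hs t (\<Psi> w)" and l2: "\<And>h. lin sW t (\<lambda>w. \<Psi> w h)"
  shows "(\<Sum>(f, h)\<leftarrow>ys. sw h (\<lambda>a c. \<Psi> ((\<sigma> a \<rhd> s) \<odot> f w) c)) = (\<Sum>(f, h)\<leftarrow>ys. \<Psi> (f (s \<odot> w)) h)"
proof -
  have ex: "\<Psi> u c = (\<Sum>b\<in>HB. \<Psi> (sW (e b c) u) b)" for u c
    using HB.lin_crd[OF l1, of c u] by (simp add: lin_scale[OF l2])
  have "(\<Sum>(f, h)\<leftarrow>ys. sw h (\<lambda>a c. \<Psi> ((\<sigma> a \<rhd> s) \<odot> f w) c))
    = (\<Sum>(f, h)\<leftarrow>ys. \<Sum>b\<in>HB. \<Psi> (sw h (\<lambda>a c. sW (e b c) ((\<sigma> a \<rhd> s) \<odot> f w))) b)"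
    by (subst ex) (simp only: sw_sum sw_pull[OF l2])
  also have "\<dots> = (\<Sum>b\<in>HB. \<Psi> (\<Sum>(f, h)\<leftarrow>ys. sw h (\<lambda>a c. sW (e b c) ((\<sigma> a \<rhd> s) \<odot> f w))) b)"
    by (simp only: sum_list_sum_swap lin_sum_list[OF l2])
  also have "\<dots> = (\<Sum>b\<in>HB. \<Psi> (\<Sum>(f, h)\<leftarrow>ys. sW (e b h) (f (s \<odot> w))) b)"
    using c lin_e unfolding stab_cond_def by simp
  also have "\<dots> = (\<Sum>(f, h)\<leftarrow>ys. \<Sum>b\<in>HB. \<Psi> (sW (e b h) (f (s \<odot> w))) b)"
    by (simp only: sum_list_sum_swap lin_sum_list[OF l2])
  also have "\<dots> = (\<Sum>(f, h)\<leftarrow>ys. \<Psi> (f (s \<odot> w)) h)"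
    by (simp only: ex[symmetric])
  finally show ?thesis .
qed

section \<open>Membership in the stabilizer\<close>

lemma sw_in_MM: "(\<And>a b. g a b \<in> carr MM) \<Longrightarrow> sw h g \<in> carr MM"
  by (rule sw_in[OF is_vspace_tprod])

lemma KK_carr: "carr KK = End_over UNIV MM (WHa) \<inter> RM ` carr (tprod EW (hsp H))"
  by (simp add: Stab_right_def)

lemma scal_KK [simp]: "scal KK = fscale (fscale (*))"
  by (simp add: Stab_right_def Hom_def)

text \<open>Testing on w \<otimes> 1 is enough: \<open>R_map\<close> multiplies the H-component on
  the right, so the condition on w \<otimes> t follows from the one for the elements \<sigma> t1
  \<rhd> s, by multiplicativity of the coproduct.\<close>

lemma K_iff: "F \<in> carr KK \<longleftrightarrow> (\<exists>ys. E_list ys \<and> stab_cond ys \<and> F = RM (E_tensor ys))"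
proof
  assume F: "F \<in> carr KK"
  then obtain ys where ys: "E_list ys" "F = RM (E_tensor ys)" unfolding KK_carr by (auto elim: E_tensor_ex)
  have "stab_cond ys" unfolding stab_cond_def
  proof (intro allI impI)
    fix s w \<alpha> assume \<alpha>: "lin hs (*) (\<alpha> :: 'h \<Rightarrow> 'k)"
    have "WHa s (TW w 1) = TW ((\<sigma> 1 \<rhd> s) \<odot> w) 1"
      unfolding WH_act_tensor by (rule sw_one[OF vs_ft]) (intro blinI linI)
    then have "F (TW (s \<odot> w) 1) = F (WHa s (TW w 1))" by simp
    also have "\<dots> = WHa s (F (TW w 1))"
      using F unfolding KK_carr End_over_def by simp
    finally have "contract \<alpha> (F (TW (s \<odot> w) 1)) = contract \<alpha> (WHa s (F (TW w 1)))" by simp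
    also have "WHa s (F (TW w 1)) = (\<Sum>(f, h)\<leftarrow>ys. sw h (\<lambda>a c. TW ((\<sigma> a \<rhd> s) \<odot> f w) c))"
      by (simp add: ys(2) RM_tensor[OF ys(1)] WH_act_sum_list WH_act_tensor)
    finally show "(\<Sum>(f, h)\<leftarrow>ys. sw h (\<lambda>a c. sW (\<alpha> c) ((\<sigma> a \<rhd> s) \<odot> f w))) = (\<Sum>(f, h)\<leftarrow>ys. sW (\<alpha> h) (f (s \<odot> w)))"
      by (simp add: ys(2) contract_RM[OF ys(1) \<alpha>] contract_sum_list[OF \<alpha>] contract_sw[OF \<alpha>] contract_tensor[OF \<alpha>] sw_in_MM)
  qed
  with ys show "\<exists>ys. E_list ys \<and> stab_cond ys \<and> F = RM (E_tensor ys)" by blast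
next
  assume "\<exists>ys. E_list ys \<and> stab_cond ys \<and> F = RM (E_tensor ys)"
  then obtain ys where ys: "E_list ys" "stab_cond ys" "F = RM (E_tensor ys)" by blast
  have "F (WHa s x) = WHa s (F x)" if "x \<in> carr MM" for s x
    using vsp_W vsp_H that
  proof (induction x rule: tprod_induct)
    case zero
    show ?case by (simp add: ys(3) RM_zero[OF ys(1)] WH_act_zero)
  next
    case (tensor w t)
    have "F (WHa s (TW w t)) = sw t (\<lambda>t1 t2. \<Sum>(f, h)\<leftarrow>ys. TW (f ((\<sigma> t1 \<rhd> s) \<odot> w)) (t2 * h))"
      unfolding WH_act_tensor sw_def ys(3) by (simp add: RM_sum_list[OF ys(1)] RM_tensor[OF ys(1)])
    also have "\<dots> = sw t (\<lambda>t1 t2. \<Sum>(f, h)\<leftarrow>ys. sw h (\<lambda>h1 h2. TW ((\<sigma> h1 \<rhd> (\<sigma> t1 \<rhd> s)) \<odot> f w) (t2 * h2)))"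
      by (rule sw_cong, rule stab_cond_bilinear[OF ys(2) vs_ft, symmetric]) (intro linI)+
    also have "\<dots> = (\<Sum>(f, h)\<leftarrow>ys. sw t (\<lambda>t1 t2. sw h (\<lambda>h1 h2. TW ((\<sigma> (t1 * h1) \<rhd> s) \<odot> f w) (t2 * h2))))"
      by (simp only: sw_sum_list sg_mult act_mult_left)
    also have "\<dots> = (\<Sum>(f, h)\<leftarrow>ys. sw (t * h) (\<lambda>a c. TW ((\<sigma> a \<rhd> s) \<odot> f w) c))"
      by (rule sum_list_cong_pair, rule sw_mult[OF vs_ft, symmetric]) (intro blinI linI)
    also have "\<dots> = WHa s (F (TW w t))"
      by (simp add: ys(3) RM_tensor[OF ys(1)] WH_act_sum_list WH_act_tensor)
    finally show ?case .
  next
    case (add x y)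
    then show ?case
      by (simp add: ys(3) WH_act_add WH_act_in RM_add[OF ys(1)] RM_in[OF ys(1)])
  qed
  then show "F \<in> carr KK" unfolding KK_carr End_over_def
    using RM_End[OF ys(1)] E_tensor_in[OF ys(1)] ys(3) by auto
qed

lemma stab_cond_append: "stab_cond ys \<Longrightarrow> stab_cond zs \<Longrightarrow> stab_cond (ys @ zs)"
  by (simp add: stab_cond_def)

lemma E_list_append: "E_list ys \<Longrightarrow> E_list zs \<Longrightarrow> E_list (ys @ zs)"
  by (auto simp: E_list_def)

definition scale_list :: "'k \<Rightarrow> (('w \<Rightarrow> 'w) \<times> 'h) list \<Rightarrow> (('w \<Rightarrow> 'w) \<times> 'h) list"
  where "scale_list c ys = map (\<lambda>(f, h). (fscale sW c f, h)) ys"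

lemma sum_list_scale_list: "(\<Sum>(f, h)\<leftarrow>scale_list c ys. G f h) = (\<Sum>(f, h)\<leftarrow>ys. G (fscale sW c f) h)"
proof (induction ys)
  case (Cons y ys)
  then show ?case by (cases y) (simp only: scale_list_def list.map case_prod_conv sum_list.Cons)
qed (simp add: scale_list_def)

lemma E_list_scale_list: "E_list ys \<Longrightarrow> E_list (scale_list c ys)"
  by (auto simp: E_list_def scale_list_def intro!: lin_fscale)

lemma stab_cond_scale_list:
  assumes "stab_cond ys" shows "stab_cond (scale_list c ys)"
  unfolding stab_cond_def
proof (intro allI impI)
  fix s w \<alpha> assume a: "lin hs (*) (\<alpha> :: 'h \<Rightarrow> 'k)"
  have l: "lin sW sW (sW c)" by (rule lin_scale_const[OF vs_sW lin_id])
  have sc: "sW k ((\<sigma> a \<rhd> s) \<odot> sW c u) = sW c (sW k ((\<sigma> a \<rhd> s) \<odot> u))" for k a u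
    by (simp add: lin_scale[OF lin_actW_right] vs_simps[OF vs_sW] mult.commute)
  have "(\<Sum>(f, h)\<leftarrow>scale_list c ys. sw h (\<lambda>a ca. sW (\<alpha> ca) ((\<sigma> a \<rhd> s) \<odot> f w)))
      = sW c (\<Sum>(f, h)\<leftarrow>ys. sw h (\<lambda>a ca. sW (\<alpha> ca) ((\<sigma> a \<rhd> s) \<odot> f w)))"
    unfolding sum_list_scale_list lin_sum_list[OF l] by (simp add: sc sw_scale[OF vs_sW])
  also have "\<dots> = sW c (\<Sum>(f, h)\<leftarrow>ys. sW (\<alpha> h) (f (s \<odot> w)))"
    using assms a by (simp add: stab_cond_def)
  also have "\<dots> = (\<Sum>(f, h)\<leftarrow>scale_list c ys. sW (\<alpha> h) (f (s \<odot> w)))"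
    unfolding sum_list_scale_list lin_sum_list[OF l] by (simp add: vs_simps[OF vs_sW] mult.commute)
  finally show "(\<Sum>(f, h)\<leftarrow>scale_list c ys. sw h (\<lambda>a ca. sW (\<alpha> ca) ((\<sigma> a \<rhd> s) \<odot> f w)))
      = (\<Sum>(f, h)\<leftarrow>scale_list c ys. sW (\<alpha> h) (f (s \<odot> w)))" .
qed

lemma RM_scale_list: assumes "E_list ys" shows "RM (E_tensor (scale_list c ys)) = fscale (fscale (*)) c (RM (E_tensor ys))"
proof
  fix x
  have l: "lin (fscale (*)) (fscale (*)) (fscale (*) c :: ('w, 'h, 'k) tensor \<Rightarrow> _)"
    by (rule lin_scale_const[OF vs_ft lin_id])
  have "R_factor (fscale sW c f) h x = fscale (*) c (R_factor f h x)" if "lin sW sW f" for f h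
    using bilinear_onD(4)[OF bilinear_R_factor, of f h c x] that by simp
  then show "RM (E_tensor (scale_list c ys)) x = fscale (fscale (*)) c (RM (E_tensor ys)) x"
    unfolding RM_E_tensor[OF E_list_scale_list[OF assms]] sum_list_scale_list
    by (simp add: RM_E_tensor[OF assms] lin_sum_list[OF l] cong: sum_list_cong_pair) (auto intro!: sum_list_cong_pair simp: E_listD[OF assms])
qed

lemma vsp_KK [simp]: "is_vspace KK"
proof (rule is_vspaceI)
  show vs: "vector_space (scal KK)" by (simp add: vector_space_fscale vector_space_field)
  interpret vector_space "scal KK" by (rule vs)
  show "subspace (carr KK)"
  proof (rule subspI)
    have "E_list []" "stab_cond []" by (auto simp: E_list_def stab_cond_def)
    moreover have "RM (E_tensor []) = 0" by (rule ext) (simp add: RM_E_tensor[OF \<open>E_list []\<close>] fun_apply)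
    ultimately show "0 \<in> carr KK" unfolding K_iff by metis
    show "x + y \<in> carr KK" if "x \<in> carr KK" "y \<in> carr KK" for x y
      using that unfolding K_iff by (metis RM_append stab_cond_append E_list_append)
    show "scal KK c x \<in> carr KK" if "x \<in> carr KK" for c x
      using that unfolding K_iff scal_KK by (metis RM_scale_list stab_cond_scale_list E_list_scale_list)
  qed
qed

section \<open>The action of the stabilizer on W and its coaction\<close>

abbreviation "KK_act \<equiv> Stab_right_act H WW"

lemma KK_act_E_tensor: assumes "E_list ys" shows "KK_act (RM (E_tensor ys)) w = (\<Sum>(f, h)\<leftarrow>ys. sW (\<epsilon> h) (f w))"
proof -
  have bl: "bilinear_on EW (hsp H) sW (\<lambda>f h. sW (\<epsilon> h) (f w))"
    by (rule bilinear_onI) (auto simp: fun_apply vs_distrib[OF vs_sW] vs_simps[OF vs_sW]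
        lin_add[OF lin_eps] lin_scale[OF lin_eps] mult.commute)
  show ?thesis unfolding Stab_right_act_def R_inv_E_tensor[OF assms] whole_simps unfolding E_tensor_def
    by (rule tlift_sum[OF vsp_E vsp_H vs_sW bl E_list_set[OF assms]])
qed

lemma lin_KK_act: assumes "E_list ys" shows "lin sW sW (KK_act (RM (E_tensor ys)))"
proof -
  have "lin sW sW (\<lambda>w. \<Sum>(f, h)\<leftarrow>zs. sW (\<epsilon> h) (f w))" if "E_list zs" for zs
    using that by (induction zs) (auto simp: E_list_def
        intro!: lin_const_zero[OF vs_sW] lin_plus[OF vs_sW] lin_scale_const[OF vs_sW])
  from this[OF assms] show ?thesis
    unfolding KK_act_E_tensor[OF assms, symmetric] .
qed

lemma lcoact_KK:
  assumes "E_list ys"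
  shows "lcoact KK (RM (E_tensor ys)) = (\<Sum>(f, h)\<leftarrow>ys. sw h (\<lambda>a b. tensor (hsp H) (End MM) (\<sigma> b) (RM (TE f a))))"
proof -
  let ?T = "tensor (hsp H) (End MM)"
  have one: "E_list [(f, a)]" "E_tensor [(f, a)] = TE f a" if "lin sW sW f" for f a
    using that by (auto simp: E_list_def E_tensor_def)
  have RM1: "RM (TE f a) x = R_factor f a x" if "lin sW sW f" for f a x
    using RM_E_tensor[OF one(1)[OF that], of a x] one(2)[OF that] by simp
  have RMa: "RM (TE f (a + a')) = RM (TE f a) + RM (TE f a')" "RM (TE f (hs c a)) = fscale (fscale (*)) c (RM (TE f a))"
    if "lin sW sW f" for f a a' c
    using that bilinear_onD(1,2)[OF bilinear_R_factor, of f a] 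
    by (auto simp: fun_eq_iff RM1 fun_apply)
  have RMf: "RM (TE (f + f') a) = RM (TE f a) + RM (TE f' a)" "RM (TE (fscale sW c f) a) = fscale (fscale (*)) c (RM (TE f a))"
    if "lin sW sW f" "lin sW sW f'" for f f' a c
    using that bilinear_onD(3,4)[OF bilinear_R_factor, of f] lin_plus_fun[OF vs_sW that] lin_fscale[OF vs_sW that(1)]
    by (auto simp: fun_eq_iff RM1 fun_apply)
  have scalE: "scal (End MM) = fscale (fscale (*))" by (simp add: Hom_def)
  have lR: "lin hs (scal (End MM)) (\<lambda>a. RM (TE f a))" if "lin sW sW f" for f
    using RMa[OF that] by (simp add: lin_def scalE)
  have bs: "blin hs (fscale (*)) (\<lambda>a b. ?T (\<sigma> b) (RM (TE f a)))" if "lin sW sW f" for f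
    by (intro blinI linI lin_tensor_right lR that)
  have sws: "sweedler H h (\<lambda>a b. ?T (\<sigma> b) (RM (TE f a))) = sw h (\<lambda>a b. ?T (\<sigma> b) (RM (TE f a)))"
    if "lin sW sW f" for f h by (rule sweedler_sw[OF vs_ft bs[OF that]])
  have bl: "bilinear_on EW (hsp H) (fscale (*)) (\<lambda>f h. sweedler H h (\<lambda>a b. ?T (\<sigma> b) (RM (TE f a))))"
  proof (rule bilinear_onI)
    fix f h h' c assume f: "f \<in> carr EW"
    have l: "lin hs (fscale (*)) (\<lambda>h. sw h (\<lambda>a b. ?T (\<sigma> b) (RM (TE f a))))"
      by (rule lin_sweedler[OF vs_ft bs]) (use f in simp)
    show "sweedler H (h + h') (\<lambda>a b. ?T (\<sigma> b) (RM (TE f a))) = sweedler H h (\<lambda>a b. ?T (\<sigma> b) (RM (TE f a))) + sweedler H h' (\<lambda>a b. ?T (\<sigma> b) (RM (TE f a)))"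
      using f by (simp add: sws lin_add[OF l])
    show "sweedler H (scal (hsp H) c h) (\<lambda>a b. ?T (\<sigma> b) (RM (TE f a))) = fscale (*) c (sweedler H h (\<lambda>a b. ?T (\<sigma> b) (RM (TE f a))))"
      using f by (simp add: sws lin_scale[OF l])
  next
    fix f f' h assume "f \<in> carr EW" "f' \<in> carr EW"
    then have f: "lin sW sW f" "lin sW sW f'" by simp_all
    show "sweedler H h (\<lambda>a b. ?T (\<sigma> b) (RM (TE (f + f') a))) = sweedler H h (\<lambda>a b. ?T (\<sigma> b) (RM (TE f a))) + sweedler H h (\<lambda>a b. ?T (\<sigma> b) (RM (TE f' a)))"
      unfolding sws[OF f(1)] sws[OF f(2)] sws[OF lin_plus_fun[OF vs_sW f]] unfolding RMf(1)[OF f] tensor_add_right sw_add ..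
  next
    fix f h c assume "f \<in> carr EW"
    then have f: "lin sW sW f" by simp
    have ts: "?T x (fscale (fscale (*)) c y) = fscale (*) c (?T x y)" for x y
      using tensor_scale_right[of "hsp H" "End MM" x c y] by (simp only: scalE)
    show "sweedler H h (\<lambda>a b. ?T (\<sigma> b) (RM (TE (scal EW c f) a))) = fscale (*) c (sweedler H h (\<lambda>a b. ?T (\<sigma> b) (RM (TE f a))))"
      unfolding scal_EW sws[OF f] sws[OF lin_fscale[OF vs_sW f]] unfolding RMf(2)[OF f f] ts sw_scale[OF vs_ft] ..
  qed
  have "lcoact KK (RM (E_tensor ys)) = tlift EW (hsp H) (\<lambda>f h. sweedler H h (\<lambda>a b. ?T (\<sigma> b) (RM (TE f a)))) (E_tensor ys)"
    by (simp add: Stab_right_def R_inv_E_tensor[OF assms])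
  also have "\<dots> = (\<Sum>(f, h)\<leftarrow>ys. sweedler H h (\<lambda>a b. ?T (\<sigma> b) (RM (TE f a))))"
    unfolding E_tensor_def by (rule tlift_sum[OF vsp_E vsp_H vs_ft bl E_list_set[OF assms]])
  also have "\<dots> = (\<Sum>(f, h)\<leftarrow>ys. sw h (\<lambda>a b. ?T (\<sigma> b) (RM (TE f a))))"
    by (rule sum_list_cong_pair) (rule sws[OF E_listD[OF assms]])
  finally show ?thesis .
qed

lemma RM_TE: "lin sW sW f \<Longrightarrow> RM (TE f a) x = R_factor f a x"
  using RM_E_tensor[of "[(f, a)]" x] by (simp add: E_list_def E_tensor_def)

lemma lin_RM_TE: "lin sW sW f \<Longrightarrow> lin hs (fscale (fscale (*))) (\<lambda>a. RM (TE f a))"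
  using bilinear_onD(1,2)[OF bilinear_R_factor, of f]
  by (auto simp: lin_def fun_eq_iff RM_TE fun_apply)

lemma RM_E_tensor_sum: "E_list ys \<Longrightarrow> RM (E_tensor ys) = (\<Sum>(f, h)\<leftarrow>ys. RM (TE f h))"
  by (rule ext) (auto simp: RM_E_tensor fun_sum_list_apply RM_TE E_listD intro!: sum_list_cong_pair)

text \<open>The component of the coaction along the basis element \<open>c\<close> of \<open>H\<close>.\<close>

definition coact_list :: "'h \<Rightarrow> (('w \<Rightarrow> 'w) \<times> 'h) list \<Rightarrow> (('w \<Rightarrow> 'w) \<times> 'h) list"
  where "coact_list c ys = map (\<lambda>(f, h). (f, sw h (\<lambda>a b. hs (e c (\<sigma> b)) a))) ys"

lemma sum_list_coact_list: "(\<Sum>(f, h)\<leftarrow>coact_list c ys. G f h) = (\<Sum>(f, h)\<leftarrow>ys. G f (sw h (\<lambda>a b. hs (e c (\<sigma> b)) a)))"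
proof (induction ys)
  case (Cons y ys)
  then show ?case by (cases y) (simp only: coact_list_def list.map case_prod_conv sum_list.Cons)
qed (simp add: coact_list_def)

lemma E_list_coact_list: "E_list ys \<Longrightarrow> E_list (coact_list c ys)"
  by (auto simp: E_list_def coact_list_def)

text \<open>Passing to a component of the coaction only replaces \<open>\<alpha>\<close> by the
  functional \<open>\<alpha>'\<close>, its convolution with \<open>e c\<close> composed with
  \<open>\<sigma>\<close>; the original condition holds for all functionals. This is why the
  coaction stays within the stabilizer.\<close>

lemma stab_cond_coact_list:
  assumes "stab_cond ys" shows "stab_cond (coact_list c ys)"
  unfolding stab_cond_def
proof (intro allI impI)
  fix s w \<alpha> assume \<alpha>: "lin hs (*) (\<alpha> :: 'h \<Rightarrow> 'k)"
  note L = linI lin_comp[OF \<alpha>]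
  define \<alpha>' where "\<alpha>' = (\<lambda>r. sw r (\<lambda>x y. e c (\<sigma> y) * \<alpha> x))"
  have \<alpha>': "lin hs (*) \<alpha>'" unfolding \<alpha>'_def by (intro L)
  have "(\<Sum>(f, h)\<leftarrow>coact_list c ys. sw h (\<lambda>a x. sW (\<alpha> x) ((\<sigma> a \<rhd> s) \<odot> f w)))
     = (\<Sum>(f, h)\<leftarrow>ys. sw h (\<lambda>a b. sW (\<alpha>' b) ((\<sigma> a \<rhd> s) \<odot> f w)))"
    unfolding sum_list_coact_list
  proof (rule sum_list_cong_pair)
    fix f :: "'w \<Rightarrow> 'w" and h
    have l: "lin hs sW (\<lambda>z. sw z (\<lambda>a x. sW (\<alpha> x) ((\<sigma> a \<rhd> s) \<odot> f w)))" by (intro L)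
    have "sw (sw h (\<lambda>a b. hs (e c (\<sigma> b)) a)) (\<lambda>a x. sW (\<alpha> x) ((\<sigma> a \<rhd> s) \<odot> f w))
      = sw h (\<lambda>u b. sw u (\<lambda>a x. sW (e c (\<sigma> b)) (sW (\<alpha> x) ((\<sigma> a \<rhd> s) \<odot> f w))))"
      by (simp only: sw_pull[OF l] lin_scale[OF l] sw_scale[OF vs_sW])
    also have "\<dots> = sw h (\<lambda>a r. sw r (\<lambda>x b. sW (e c (\<sigma> b)) (sW (\<alpha> x) ((\<sigma> a \<rhd> s) \<odot> f w))))"
      by (rule sw_assoc[OF vs_sW]) (intro tlinI L)
    also have "\<dots> = sw h (\<lambda>a r. sW (\<alpha>' r) ((\<sigma> a \<rhd> s) \<odot> f w))"
    proof -
      have l: "lin (*) sW (\<lambda>k. sW k u)" for u by (rule lin_scale_fun[OF vs_sW lin_id])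
      show ?thesis by (simp only: \<alpha>'_def sw_pull[OF l] vs_simps[OF vs_sW])
    qed
    finally show "sw (sw h (\<lambda>a b. hs (e c (\<sigma> b)) a)) (\<lambda>a x. sW (\<alpha> x) ((\<sigma> a \<rhd> s) \<odot> f w))
      = sw h (\<lambda>a b. sW (\<alpha>' b) ((\<sigma> a \<rhd> s) \<odot> f w))" .
  qed
  also have "\<dots> = (\<Sum>(f, h)\<leftarrow>ys. sW (\<alpha>' h) (f (s \<odot> w)))"
    using assms \<alpha>' by (simp add: stab_cond_def)
  also have "\<dots> = (\<Sum>(f, h)\<leftarrow>coact_list c ys. sW (\<alpha> h) (f (s \<odot> w)))"
    unfolding sum_list_coact_list by (simp only: \<alpha>'_def sw_pull[OF \<alpha>] lin_scale[OF \<alpha>])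
  finally show "(\<Sum>(f, h)\<leftarrow>coact_list c ys. sw h (\<lambda>a x. sW (\<alpha> x) ((\<sigma> a \<rhd> s) \<odot> f w)))
     = (\<Sum>(f, h)\<leftarrow>coact_list c ys. sW (\<alpha> h) (f (s \<odot> w)))" .
qed

text \<open>A tensor depends on the ambient scalar multiplication and not on the carriers, so the
  coaction, defined with values in H \<otimes> End, can be read in H \<otimes> K.\<close>

lemma tensor_KK: "tensor (hsp H) (End MM) = tensor (hsp H) KK"
  by (rule tensor_cong_scal) (simp_all add: Hom_def Stab_right_def)

text \<open>The single terms \<open>RM (TE f a)\<close> need not belong to the stabilizer. Collected
  along a basis of H the second legs do, as is needed to evaluate a lift over H \<otimes> K.\<close>

lemma lcoact_expand:
  assumes "E_list ys"
  shows "lcoact KK (RM (E_tensor ys)) = (\<Sum>c\<in>HB. tensor (hsp H) KK c (RM (E_tensor (coact_list c ys))))"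
proof -
  let ?T = "tensor (hsp H) KK"
  have lT: "lin (fscale (fscale (*))) (fscale (*)) (?T c)" for c
    by (rule lin_tensor_right[of _ KK "\<lambda>x. x"]) (simp add: lin_id)
  have sT: "fscale (*) k (?T c X) = ?T c (fscale (fscale (*)) k X)" for k c X
    by (simp add: lin_scale[OF lT])
  have ex: "?T (\<sigma> b) X = (\<Sum>c\<in>HB. fscale (*) (e c (\<sigma> b)) (?T c X))" for b X
    by (rule HB.lin_crd[where f = "\<lambda>z. ?T z X", symmetric]) (intro linI)
  have "lcoact KK (RM (E_tensor ys)) = (\<Sum>(f, h)\<leftarrow>ys. \<Sum>c\<in>HB. ?T c (RM (TE f (sw h (\<lambda>a b. hs (e c (\<sigma> b)) a)))))"
    unfolding lcoact_KK[OF assms] tensor_KK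
  proof (rule sum_list_cong_pair)
    fix f h assume "(f, h) \<in> set ys"
    then have f: "lin sW sW f" by (rule E_listD[OF assms])
    have "sw h (\<lambda>a b. ?T (\<sigma> b) (RM (TE f a))) = (\<Sum>c\<in>HB. sw h (\<lambda>a b. ?T c (RM (TE f (hs (e c (\<sigma> b)) a)))))"
      by (subst ex) (simp only: sw_sum sT lin_scale[OF lin_RM_TE[OF f]])
    then show "sw h (\<lambda>a b. ?T (\<sigma> b) (RM (TE f a))) = (\<Sum>c\<in>HB. ?T c (RM (TE f (sw h (\<lambda>a b. hs (e c (\<sigma> b)) a)))))"
      by (simp only: sw_pull[OF lT] sw_pull[OF lin_RM_TE[OF f]])
  qed
  also have "\<dots> = (\<Sum>c\<in>HB. \<Sum>(f, h)\<leftarrow>coact_list c ys. ?T c (RM (TE f h)))"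
    by (simp only: sum_list_sum_swap sum_list_coact_list)
  also have "\<dots> = (\<Sum>c\<in>HB. ?T c (RM (E_tensor (coact_list c ys))))"
    by (simp only: RM_E_tensor_sum[OF E_list_coact_list[OF assms]] lin_sum_list[OF lT])
  finally show ?thesis .
qed

section \<open>The action of the stabilizer on the dual of H tensored with W\<close>

lemma bl_D:
  assumes "\<And>w w' \<beta>. lin hs (*) \<beta> \<Longrightarrow> \<Psi> \<beta> (w + w') = \<Psi> \<beta> w + \<Psi> \<beta> w'"
    "\<And>w c \<beta>. lin hs (*) \<beta> \<Longrightarrow> \<Psi> \<beta> (sW c w) = t c (\<Psi> \<beta> w)"
    "\<And>w \<beta> \<beta>'. lin hs (*) \<beta> \<Longrightarrow> lin hs (*) \<beta>' \<Longrightarrow> \<Psi> (\<beta> + \<beta>') w = \<Psi> \<beta> w + \<Psi> \<beta>' w"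
    "\<And>w \<beta> c. lin hs (*) \<beta> \<Longrightarrow> \<Psi> (fscale (*) c \<beta>) w = t c (\<Psi> \<beta> w)"
  shows "bilinear_on DD WW t \<Psi>"
  using assms by (intro bilinear_onI) auto

lemma dharp_lin: "lin hs (*) \<beta> \<Longrightarrow> lin hs (*) (dharp H h \<beta>)"
proof -
  assume b: "lin hs (*) \<beta>"
  show ?thesis unfolding dharp_def by (intro linI lin_comp[OF b])
qed

lemma dharp_add: "dharp H h (\<beta> + \<beta>') = dharp H h \<beta> + dharp H h \<beta>'"
  and dharp_scale: "dharp H h (fscale (*) c \<beta>) = fscale (*) c (dharp H h \<beta>)"
  by (auto simp: dharp_def fun_eq_iff fun_apply)

lemma lin_dharp_left:
  assumes "lin hs (*) \<beta>" shows "lin hs (fscale (*)) (\<lambda>h. dharp H h \<beta>)"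
  unfolding dharp_def by (rule lin_funI) (intro linI lin_comp[OF assms])

lemma lin_TD_left: "lin s (fscale (*)) f \<Longrightarrow> lin s (fscale (*)) (\<lambda>x. TD (f x) w)"
  by (rule lin_tensor_left) simp

lemma bilinear_HW1:
  assumes "lin sW sW g" shows "bilinear_on DD WW (fscale (*)) (\<lambda>\<beta> w. TD (dharp H h \<beta>) (g w))"
proof -
  have l: "lin sW (fscale (*)) (\<lambda>w. TD \<beta> (g w))" for \<beta> by (intro linI lin_comp[OF assms])
  have l2: "lin (fscale (*)) (fscale (*)) (\<lambda>\<beta>. TD \<beta> w)" for w by (rule lin_TD_left[OF lin_id])
  show ?thesis
    by (rule bl_D) (simp_all add: lin_add[OF l] lin_scale[OF l] lin_add[OF l2] lin_scale[OF l2] dharp_add dharp_scale)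
qed

abbreviation "HWa \<equiv> HW_act H WW KK KK_act"

lemma HW_act_expand:
  assumes ys: "E_list ys" "stab_cond ys"
  shows "HWa (RM (E_tensor ys)) x =
    (\<Sum>c\<in>HB. tlift DD WW (\<lambda>\<beta> w. TD (dharp H c \<beta>) (KK_act (RM (E_tensor (coact_list c ys))) w)) x)"
proof -
  have bo: "bilinear_on (hsp H) KK (fscale (*)) (\<lambda>h k0. tlift DD WW (\<lambda>\<beta> w. TD (dharp H h \<beta>) (KK_act k0 w)) x)"
  proof (rule bilinear_on_tlift[OF vsp_D vsp_W vs_ft vsp_H vsp_KK])
    fix h :: 'h and k0 assume "k0 \<in> carr KK"
    then show "bilinear_on DD WW (fscale (*)) (\<lambda>\<beta> w. TD (dharp H h \<beta>) (KK_act k0 w))"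
      unfolding K_iff using bilinear_HW1 lin_KK_act by metis
  next
    fix \<beta> w assume "\<beta> \<in> carr DD"
    then have \<beta>: "lin hs (*) \<beta>" by simp
    have l: "lin hs (fscale (*)) (\<lambda>h. TD (dharp H h \<beta>) u)" for u
      by (rule lin_TD_left[OF lin_dharp_left[OF \<beta>]])
    have l2: "lin sW (fscale (*)) (TD \<gamma>)" for \<gamma> by (rule lin_TD_right[OF lin_id])
    have add: "KK_act (k + k') w = KK_act k w + KK_act k' w" if k: "k \<in> carr KK" "k' \<in> carr KK" for k k'
    proof -
      obtain ks ks' where "E_list ks" "k = RM (E_tensor ks)" "E_list ks'" "k' = RM (E_tensor ks')"
        using k unfolding K_iff by blast
      then show ?thesis by (simp add: RM_append[symmetric] KK_act_E_tensor E_list_append)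
    qed
    have scl: "KK_act (fscale (fscale (*)) c k) w = sW c (KK_act k w)" if k: "k \<in> carr KK" for k c
    proof -
      obtain ks where ks: "E_list ks" "k = RM (E_tensor ks)" using k unfolding K_iff by blast
      have l: "lin sW sW (sW c)" by (rule lin_scale_const[OF vs_sW lin_id])
      show ?thesis unfolding ks(2) RM_scale_list[OF ks(1), symmetric] KK_act_E_tensor[OF ks(1)] KK_act_E_tensor[OF E_list_scale_list[OF ks(1)]]
          sum_list_scale_list lin_sum_list[OF l]
        by (simp add: vs_simps[OF vs_sW] mult.commute)
    qed
    show "bilinear_on (hsp H) KK (fscale (*)) (\<lambda>h k0. TD (dharp H h \<beta>) (KK_act k0 w))"
      by (rule bilinear_onI)
        (simp_all add: lin_add[OF l] lin_scale[OF l] add scl lin_add[OF l2] lin_scale[OF l2])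
  qed
  show ?thesis unfolding HW_act_def lcoact_expand[OF ys(1)]
  proof (rule tlift_finsum[OF vsp_H vsp_KK vs_ft bo HB.finB])
    show "RM (E_tensor (coact_list c ys)) \<in> carr KK" for c
      unfolding K_iff using E_list_coact_list[OF ys(1)] stab_cond_coact_list[OF ys(2)] by blast
  qed simp
qed

text \<open>The counit in the action on W consumes the leg of h that stays in the stabilizer, so the
  other leg, which carries \<open>\<sigma>\<close>, becomes all of h.\<close>

lemma HW_act_tensor:
  assumes ys: "E_list ys" "stab_cond ys" and b: "lin hs (*) \<beta>"
  shows "HWa (RM (E_tensor ys)) (TD \<beta> w) = (\<Sum>(f, h)\<leftarrow>ys. TD (dharp H (\<sigma> h) \<beta>) (f w))"
proof -
  have "HWa (RM (E_tensor ys)) (TD \<beta> w) = (\<Sum>c\<in>HB. TD (dharp H c \<beta>) (KK_act (RM (E_tensor (coact_list c ys))) w))"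
    unfolding HW_act_expand[OF ys]
    by (intro sum.cong refl tlift_tensor[OF vsp_D vsp_W vs_ft bilinear_HW1] lin_KK_act E_list_coact_list ys) (simp_all add: b)
  also have "\<dots> = (\<Sum>c\<in>HB. \<Sum>(f, h)\<leftarrow>ys. fscale (*) (e c (\<sigma> h)) (TD (dharp H c \<beta>) (f w)))"
  proof (rule sum.cong[OF refl])
    fix c
    have l2: "lin sW (fscale (*)) (TD \<gamma>)" for \<gamma> by (rule lin_TD_right[OF lin_id])
    have eps: "\<epsilon> (sw h (\<lambda>a b. hs (e c (\<sigma> b)) a)) = e c (\<sigma> h)" for h
    proof -
      have l: "lin hs (*) (\<lambda>b. e c (\<sigma> b))" by (intro linI)
      have "\<epsilon> (sw h (\<lambda>a b. hs (e c (\<sigma> b)) a)) = sw h (\<lambda>a b. \<epsilon> a * e c (\<sigma> b))"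
        by (simp only: sw_pull[OF lin_eps] lin_scale[OF lin_eps] mult.commute)
      also have "\<dots> = e c (\<sigma> h)" by (rule sw_counit1[OF l])
      finally show ?thesis .
    qed
    show "TD (dharp H c \<beta>) (KK_act (RM (E_tensor (coact_list c ys))) w) = (\<Sum>(f, h)\<leftarrow>ys. fscale (*) (e c (\<sigma> h)) (TD (dharp H c \<beta>) (f w)))"
      unfolding KK_act_E_tensor[OF E_list_coact_list[OF ys(1)]] sum_list_coact_list eps lin_sum_list[OF l2] lin_scale[OF l2] ..
  qed
  also have "\<dots> = (\<Sum>(f, h)\<leftarrow>ys. \<Sum>c\<in>HB. fscale (*) (e c (\<sigma> h)) (TD (dharp H c \<beta>) (f w)))"
    by (simp only: sum_list_sum_swap)
  also have "\<dots> = (\<Sum>(f, h)\<leftarrow>ys. TD (dharp H (\<sigma> h) \<beta>) (f w))"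
    by (simp only: HB.lin_crd[OF lin_TD_left[OF lin_dharp_left[OF b]]])
  finally show ?thesis .
qed

section \<open>Tensors in the dual of H tensored with W as maps from H to W\<close>

definition ev_dual :: "('h \<Rightarrow> 'k, 'w, 'k) tensor \<Rightarrow> 'h \<Rightarrow> 'w"
  where "ev_dual x h = tlift DD WW (\<lambda>\<beta> w. sW (\<beta> h) w) x"

lemma bilinear_ev_dual: "bilinear_on DD WW sW (\<lambda>\<beta> w. sW (\<beta> h) w)"
  by (rule bl_D) (auto simp: fun_apply vs_distrib[OF vs_sW] vs_simps[OF vs_sW] mult.commute)

lemma ev_dual_tensor: "lin hs (*) \<beta> \<Longrightarrow> ev_dual (TD \<beta> w) h = sW (\<beta> h) w"
  unfolding ev_dual_def by (rule tlift_tensor[OF vsp_D vsp_W vs_sW bilinear_ev_dual]) simp_all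

lemma ev_dual_zero: "ev_dual 0 h = 0"
  unfolding ev_dual_def by (rule tlift_zero[OF vsp_D vsp_W vs_sW bilinear_ev_dual])

lemma ev_dual_add: "x \<in> carr DW \<Longrightarrow> y \<in> carr DW \<Longrightarrow> ev_dual (x + y) h = ev_dual x h + ev_dual y h"
  unfolding ev_dual_def by (rule tlift_add[OF vsp_D vsp_W vs_sW bilinear_ev_dual])

lemma ev_dual_sum_list:
  assumes "\<And>a b. (a, b) \<in> set xs \<Longrightarrow> g a b \<in> carr DW"
  shows "ev_dual (\<Sum>(a, b)\<leftarrow>xs. g a b) h = (\<Sum>(a, b)\<leftarrow>xs. ev_dual (g a b) h)"
  unfolding ev_dual_def by (rule tlift_sum_list[OF vsp_D vsp_W vs_sW bilinear_ev_dual assms])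

text \<open>By \<open>DV_expand\<close> the values at the basis of H already determine the tensor.
  Identities in \<open>DW\<close> are checked pointwise from here on.\<close>

lemma ev_dual_eqD: "x \<in> carr DW \<Longrightarrow> y \<in> carr DW \<Longrightarrow> (\<And>h. ev_dual x h = ev_dual y h) \<Longrightarrow> x = y"
  using DV_expand[OF vsp_W, of x] DV_expand[OF vsp_W, of y] by (simp add: ev_dual_def)

lemma TD_in: "lin hs (*) \<beta> \<Longrightarrow> TD \<beta> w \<in> carr DW"
  by (rule tensor_in_tprod) simp_all

lemma lin_ev_dual: assumes "x \<in> carr DW" shows "lin hs sW (ev_dual x)"
  using vsp_D vsp_W assms
proof (induction x rule: tprod_induct)
  case zero
  show ?case by (simp add: lin_def ev_dual_zero vector_space.scale_eq_0_iff[OF vs_sW])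
next
  case (tensor \<beta> w)
  then show ?case by (auto simp: lin_def ev_dual_tensor vs_distrib[OF vs_sW] vs_simps[OF vs_sW])
next
  case (add x y)
  then show ?case by (simp add: lin_def ev_dual_add vs_distrib[OF vs_sW] algebra_simps)
qed

lemma HW_act_in: assumes ys: "E_list ys" "stab_cond ys" and x: "x \<in> carr DW" shows "HWa (RM (E_tensor ys)) x \<in> carr DW"
  unfolding HW_act_expand[OF ys]
  by (intro is_vspace_sum[OF is_vspace_tprod] tlift_in[OF vsp_D vsp_W vs_ft bilinear_HW1 x is_vspace_tprod])
    (auto intro!: lin_KK_act E_list_coact_list ys TD_in dharp_lin)

text \<open>Of the two factors \<open>\<sigma>\<close>, one comes from the coaction of the
  stabilizer and the other from the action \<open>dharp\<close> on functionals.\<close>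

lemma ev_dual_HW_act:
  assumes ys: "E_list ys" "stab_cond ys" and x: "x \<in> carr DW"
  shows "ev_dual (HWa (RM (E_tensor ys)) x) a = (\<Sum>(f, h)\<leftarrow>ys. f (ev_dual x (\<sigma> (\<sigma> h) * a)))"
  using vsp_D vsp_W x
proof (induction x rule: tprod_induct)
  case zero
  have "HWa (RM (E_tensor ys)) 0 = 0"
    by (simp add: HW_act_expand[OF ys] tlift_zero[OF vsp_D vsp_W vs_ft bilinear_HW1] lin_KK_act E_list_coact_list ys)
  moreover have "(\<Sum>(f, h)\<leftarrow>ys. f (ev_dual 0 (\<sigma> (\<sigma> h) * a))) = (\<Sum>(f, h)\<leftarrow>ys. 0)"
    by (rule sum_list_cong_pair) (simp add: ev_dual_zero lin_zero[OF E_listD[OF ys(1)]])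
  ultimately show ?case by (simp add: ev_dual_zero case_prod_unfold)
next
  case (tensor \<beta> w)
  then have b: "lin hs (*) \<beta>" by simp
  have dh: "lin hs (*) (\<lambda>a. \<beta> (\<sigma> (\<sigma> z) * a))" for z by (intro linI lin_comp[OF b])
  show ?case unfolding HW_act_tensor[OF ys b]
    by (subst ev_dual_sum_list)
      (auto intro!: TD_in dharp_lin b dh sum_list_cong_pair simp: ev_dual_tensor[OF dh] ev_dual_tensor[OF b] dharp_def
        lin_scale[OF E_listD[OF ys(1)]])
next
  case (add x y)
  have "HWa (RM (E_tensor ys)) (x + y) = HWa (RM (E_tensor ys)) x + HWa (RM (E_tensor ys)) y"
    using add(1,2) by (simp add: HW_act_expand[OF ys] tlift_add[OF vsp_D vsp_W vs_ft bilinear_HW1] lin_KK_act E_list_coact_list ys sum.distrib)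
  then have "ev_dual (HWa (RM (E_tensor ys)) (x + y)) a = (\<Sum>(f, h)\<leftarrow>ys. f (ev_dual x (\<sigma> (\<sigma> h) * a)) + f (ev_dual y (\<sigma> (\<sigma> h) * a)))"
    using add by (simp add: ev_dual_add HW_act_in[OF ys] sum_list_add_pair)
  also have "\<dots> = (\<Sum>(f, h)\<leftarrow>ys. f (ev_dual (x + y) (\<sigma> (\<sigma> h) * a)))"
    by (rule sum_list_cong_pair) (simp add: ev_dual_add add(1,2) lin_add[OF E_listD[OF ys(1)]])
  finally show ?case .
qed

end

section \<open>The double stabilizer\<close>

lemma carr_Hom: "carr (Hom V W) = {f. linear_on V W f \<and> (\<forall>x. x \<notin> carr V \<longrightarrow> f x = 0)}"
  and scal_Hom: "scal (Hom V W) = fscale (scal W)"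
  by (simp_all add: Hom_def)

lemma vs_zero: "vector_space t \<Longrightarrow> t c 0 = 0"
  by (rule lin_zero[OF lin_scale_const[OF _ lin_id]])

context hopf_module begin

abbreviation "LM \<equiv> L_map H WW"

definition L_factor :: "('h \<Rightarrow> 'k) \<Rightarrow> ('w \<Rightarrow> 'w) \<Rightarrow> ('h \<Rightarrow> 'k, 'w, 'k) tensor \<Rightarrow> ('h \<Rightarrow> 'k, 'w, 'k) tensor"
  where "L_factor \<alpha> f = tlift DD WW (\<lambda>\<beta> w. TD (conv H \<alpha> \<beta>) (f w))"

lemma conv_sw:
  assumes "lin hs (*) \<alpha>" "lin hs (*) \<beta>"
  shows "conv H \<alpha> \<beta> = (\<lambda>h. sw h (\<lambda>a b. \<alpha> a * \<beta> b))"
  unfolding conv_def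
  by (rule ext, rule sweedler_sw[OF vs_field]) (intro blinI linI lin_comp[OF assms(1)] lin_comp[OF assms(2)])

lemma lin_conv:
  assumes "lin hs (*) \<alpha>" "lin hs (*) \<beta>" shows "lin hs (*) (conv H \<alpha> \<beta>)"
  unfolding conv_sw[OF assms] by (intro linI lin_comp[OF assms(1)] lin_comp[OF assms(2)])

lemma conv_add: 
  assumes "lin hs (*) \<alpha>" "lin hs (*) \<alpha>'" "lin hs (*) \<beta>"
  shows "conv H (\<alpha> + \<alpha>') \<beta> = conv H \<alpha> \<beta> + conv H \<alpha>' \<beta>" "conv H \<beta> (\<alpha> + \<alpha>') = conv H \<beta> \<alpha> + conv H \<beta> \<alpha>'"
  using assms by (auto simp: conv_sw lin_plus_fun fun_eq_iff fun_apply sw_add[symmetric] distrib_left distrib_right)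

lemma conv_scale: 
  assumes "lin hs (*) \<alpha>" "lin hs (*) \<beta>"
  shows "conv H (fscale (*) c \<alpha>) \<beta> = fscale (*) c (conv H \<alpha> \<beta>)" "conv H \<beta> (fscale (*) c \<alpha>) = fscale (*) c (conv H \<beta> \<alpha>)"
  using assms by (auto simp: conv_sw lin_fscale fun_eq_iff sw_mult_field[symmetric] mult_ac)

lemma lin_TD1: "lin (fscale (*)) (fscale (*)) (\<lambda>\<beta>. TD \<beta> w)" by (rule lin_TD_left[OF lin_id])
lemma lin_TD2: "lin sW (fscale (*)) (TD \<beta>)" by (rule lin_TD_right[OF lin_id])

lemma bilinear_L_factor1:
  assumes a: "lin hs (*) \<alpha>" and f: "lin sW sW f"
  shows "bilinear_on DD WW (fscale (*)) (\<lambda>\<beta> w. TD (conv H \<alpha> \<beta>) (f w))"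
  by (rule bl_D) (simp_all add: a lin_add[OF f] lin_scale[OF f] lin_add[OF lin_TD1] lin_scale[OF lin_TD1]
      lin_add[OF lin_TD2] lin_scale[OF lin_TD2] conv_add conv_scale)

lemma bilinear_L_factor: "bilinear_on DD EW (fscale (*)) (\<lambda>\<alpha> f. L_factor \<alpha> f x)"
  unfolding L_factor_def
proof (rule bilinear_on_tlift[OF vsp_D vsp_W vs_ft vsp_D vsp_E])
  fix \<alpha> f assume "\<alpha> \<in> carr DD" "f \<in> carr EW"
  then show "bilinear_on DD WW (fscale (*)) (\<lambda>\<beta> w. TD (conv H \<alpha> \<beta>) (f w))"
    by (simp add: bilinear_L_factor1)
next
  fix \<beta> w assume "\<beta> \<in> carr DD"
  then show "bilinear_on DD EW (fscale (*)) (\<lambda>\<alpha> f. TD (conv H \<alpha> \<beta>) (f w))"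
    by (intro bilinear_onI) (simp_all add: fun_apply lin_add[OF lin_TD1] lin_scale[OF lin_TD1]
      lin_add[OF lin_TD2] lin_scale[OF lin_TD2] conv_add conv_scale)
qed

lemma L_factor_in: "lin hs (*) \<alpha> \<Longrightarrow> lin sW sW f \<Longrightarrow> x \<in> carr DW \<Longrightarrow> L_factor \<alpha> f x \<in> carr DW"
  unfolding L_factor_def by (rule tlift_in[OF vsp_D vsp_W vs_ft bilinear_L_factor1 _ is_vspace_tprod]) (auto intro: TD_in lin_conv)

lemma L_factor_add: "lin hs (*) \<alpha> \<Longrightarrow> lin sW sW f \<Longrightarrow> x \<in> carr DW \<Longrightarrow> y \<in> carr DW \<Longrightarrow> L_factor \<alpha> f (x + y) = L_factor \<alpha> f x + L_factor \<alpha> f y"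
  unfolding L_factor_def by (rule tlift_add[OF vsp_D vsp_W vs_ft bilinear_L_factor1])

lemma L_factor_zero: "lin hs (*) \<alpha> \<Longrightarrow> lin sW sW f \<Longrightarrow> L_factor \<alpha> f 0 = 0"
  unfolding L_factor_def by (rule tlift_zero[OF vsp_D vsp_W vs_ft bilinear_L_factor1])

lemma L_factor_scale: "lin hs (*) \<alpha> \<Longrightarrow> lin sW sW f \<Longrightarrow> x \<in> carr DW \<Longrightarrow> L_factor \<alpha> f (fscale (*) c x) = fscale (*) c (L_factor \<alpha> f x)"
  unfolding L_factor_def by (rule tlift_scale[OF vsp_D vsp_W vs_ft bilinear_L_factor1])

lemma ev_dual_L_factor:
  assumes a: "lin hs (*) \<alpha>" and f: "lin sW sW f" and x: "x \<in> carr DW"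
  shows "ev_dual (L_factor \<alpha> f x) h = sw h (\<lambda>a b. sW (\<alpha> a) (f (ev_dual x b)))"
  using vsp_D vsp_W x
proof (induction x rule: tprod_induct)
  case zero
  show ?case by (simp add: L_factor_zero[OF a f] ev_dual_zero lin_zero[OF f] vs_zero[OF vs_sW])
next
  case (tensor \<beta> w)
  then have b: "lin hs (*) \<beta>" by simp
  have "L_factor \<alpha> f (TD \<beta> w) = TD (conv H \<alpha> \<beta>) (f w)"
    unfolding L_factor_def by (rule tlift_tensor[OF vsp_D vsp_W vs_ft bilinear_L_factor1[OF a f]]) (simp_all add: b)
  moreover have l: "lin (*) sW (\<lambda>k. sW k u)" for u by (rule lin_scale_fun[OF vs_sW lin_id])
  ultimately show ?case
    by (simp add: ev_dual_tensor lin_conv a b) (simp add: conv_sw[OF a b] sw_pull[OF l] lin_scale[OF f] vs_simps[OF vs_sW])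
next
  case (add x y)
  then show ?case
    by (simp add: L_factor_add[OF a f] ev_dual_add L_factor_in[OF a f] lin_add[OF f] vs_distrib[OF vs_sW] sw_add)
qed

definition L_list :: "(('h \<Rightarrow> 'k) \<times> ('w \<Rightarrow> 'w)) list \<Rightarrow> bool"
  where "L_list ys \<longleftrightarrow> (\<forall>(\<alpha>, f)\<in>set ys. lin hs (*) \<alpha> \<and> lin sW sW f)"

definition L_tensor :: "(('h \<Rightarrow> 'k) \<times> ('w \<Rightarrow> 'w)) list \<Rightarrow> ('h \<Rightarrow> 'k, 'w \<Rightarrow> 'w, 'k) tensor"
  where "L_tensor ys = (\<Sum>(\<alpha>, f)\<leftarrow>ys. TL \<alpha> f)"

text \<open>The map g : H \<rightarrow> End(W) represented by the list.\<close>

definition conv_fun :: "(('h \<Rightarrow> 'k) \<times> ('w \<Rightarrow> 'w)) list \<Rightarrow> 'h \<Rightarrow> 'w \<Rightarrow> 'w"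
  where "conv_fun ys h w = (\<Sum>(\<alpha>, f)\<leftarrow>ys. sW (\<alpha> h) (f w))"

lemma L_list_set: "L_list ys \<Longrightarrow> set ys \<subseteq> carr DD \<times> carr EW"
  by (auto simp: L_list_def)

lemma L_listD: "L_list ys \<Longrightarrow> (\<alpha>, f) \<in> set ys \<Longrightarrow> lin hs (*) \<alpha>" "L_list ys \<Longrightarrow> (\<alpha>, f) \<in> set ys \<Longrightarrow> lin sW sW f"
  by (auto simp: L_list_def)

lemma L_tensor_in: "L_list ys \<Longrightarrow> L_tensor ys \<in> carr (tprod DD EW)"
  unfolding L_tensor_def by (rule tensor_sum_in_tprod[OF L_list_set])

lemma L_tensor_ex: assumes "y \<in> carr (tprod DD EW)" obtains ys where "L_list ys" "y = L_tensor ys"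
proof -
  obtain ys where "set ys \<subseteq> carr DD \<times> carr EW" "y = (\<Sum>(f, h)\<leftarrow>ys. TL f h)"
    using tprod_sumE[OF vsp_D vsp_E assms] .
  then show thesis by (intro that[of ys]) (auto simp: L_list_def L_tensor_def)
qed

lemma lin_conv_fun_left:
  assumes "L_list ys" shows "lin hs sW (\<lambda>h. conv_fun ys h w)"
proof -
  have "lin hs sW (\<lambda>h. \<Sum>(\<alpha>, f)\<leftarrow>zs. sW (\<alpha> h) (f w))" if "L_list zs" for zs
    using that by (induction zs) (auto simp: L_list_def
        intro!: lin_const_zero[OF vs_sW] lin_plus[OF vs_sW] lin_scale_fun[OF vs_sW])
  from this[OF assms] show ?thesis by (simp only: conv_fun_def)
qed

lemma lin_conv_fun_right:
  assumes "L_list ys" shows "lin sW sW (conv_fun ys h)"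
proof -
  have "lin sW sW (\<lambda>w. \<Sum>(\<alpha>, f)\<leftarrow>zs. sW (\<alpha> h) (f w))" if "L_list zs" for zs
    using that by (induction zs) (auto simp: L_list_def
        intro!: lin_const_zero[OF vs_sW] lin_plus[OF vs_sW] lin_scale_const[OF vs_sW])
  from this[OF assms] show ?thesis by (simp only: conv_fun_def[abs_def])
qed

lemma LM_E_tensor: "L_list ys \<Longrightarrow> LM (L_tensor ys) x = (\<Sum>(\<alpha>, f)\<leftarrow>ys. L_factor \<alpha> f x)"
  unfolding L_map_def L_factor_def[symmetric] L_tensor_def
  by (rule tlift_sum[OF vsp_D vsp_E vs_ft bilinear_L_factor L_list_set])

lemma LM_in: assumes "L_list ys" "x \<in> carr DW" shows "LM (L_tensor ys) x \<in> carr DW"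
  unfolding LM_E_tensor[OF assms(1)]
  by (rule is_vspace_sum_list[OF is_vspace_tprod]) (simp add: L_factor_in L_listD[OF assms(1)] assms(2))

lemma ev_dual_LM:
  assumes ys: "L_list ys" and x: "x \<in> carr DW"
  shows "ev_dual (LM (L_tensor ys) x) h = sw h (\<lambda>a b. conv_fun ys a (ev_dual x b))"
proof -
  have "ev_dual (LM (L_tensor ys) x) h = (\<Sum>(\<alpha>, f)\<leftarrow>ys. ev_dual (L_factor \<alpha> f x) h)"
    unfolding LM_E_tensor[OF ys] by (rule ev_dual_sum_list) (simp add: L_factor_in L_listD[OF ys] x)
  also have "\<dots> = (\<Sum>(\<alpha>, f)\<leftarrow>ys. sw h (\<lambda>a b. sW (\<alpha> a) (f (ev_dual x b))))"
    by (rule sum_list_cong_pair) (simp add: ev_dual_L_factor L_listD[OF ys] x)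
  finally show ?thesis by (simp only: conv_fun_def sw_sum_list)
qed

lemma LM_outside: assumes "L_list ys" "x \<notin> carr DW" shows "LM (L_tensor ys) x = 0"
  unfolding LM_E_tensor[OF assms(1)] L_factor_def using assms(2)
  by (simp add: tlift_outside case_prod_unfold)

lemma LM_End: assumes "L_list ys" shows "LM (L_tensor ys) \<in> carr (End DW)"
proof -
  have "LM (L_tensor ys) (x + y) = LM (L_tensor ys) x + LM (L_tensor ys) y" if "x \<in> carr DW" "y \<in> carr DW" for x y
    unfolding LM_E_tensor[OF assms(1)] sum_list_add_pair[symmetric]
    by (rule sum_list_cong_pair) (simp add: L_factor_add L_listD[OF assms(1)] that)
  moreover have "LM (L_tensor ys) (fscale (*) c x) = fscale (*) c (LM (L_tensor ys) x)" if "x \<in> carr DW" for x c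
  proof -
    have l: "lin (fscale (*)) (fscale (*)) (fscale (*) c :: ('h \<Rightarrow> 'k, 'w, 'k) tensor \<Rightarrow> _)"
      by (rule lin_scale_const[OF vs_ft lin_id])
    show ?thesis unfolding LM_E_tensor[OF assms(1)] lin_sum_list[OF l]
      by (rule sum_list_cong_pair) (simp add: L_factor_scale L_listD[OF assms(1)] that)
  qed
  ultimately show ?thesis using assms by (auto simp: carr_Hom[of DW DW] linear_on_def LM_in LM_outside)
qed

lemma LM_eqI:
  assumes "L_list ys" "L_list zs" "\<And>h w. conv_fun ys h w = conv_fun zs h w" shows "LM (L_tensor ys) = LM (L_tensor zs)"
proof
  fix x
  show "LM (L_tensor ys) x = LM (L_tensor zs) x"
  proof (cases "x \<in> carr DW")
    case True
    show ?thesis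
      by (intro ev_dual_eqD LM_in assms(1,2) True) (simp only: ev_dual_LM[OF assms(1) True] ev_dual_LM[OF assms(2) True] assms(3))
  qed (simp add: LM_outside assms(1,2))
qed

text \<open>\<open>\<epsilon>\<close> is the unit for convolution, so applying the endomorphism to
  \<epsilon> \<otimes> w returns g itself. Injectivity of \<open>L_map\<close> follows.\<close>

lemma conv_fun_LM:
  assumes "L_list ys" shows "ev_dual (LM (L_tensor ys) (TD \<epsilon> w)) h = conv_fun ys h w"
proof -
  have "ev_dual (LM (L_tensor ys) (TD \<epsilon> w)) h = sw h (\<lambda>a b. sW (\<epsilon> b) (conv_fun ys a w))"
    by (simp add: ev_dual_LM[OF assms TD_in[OF lin_eps]] ev_dual_tensor[OF lin_eps] lin_scale[OF lin_conv_fun_right[OF assms]])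
  also have "\<dots> = conv_fun ys h w" by (rule sw_counit2) (rule lin_conv_fun_left[OF assms])
  finally show ?thesis .
qed

lemma L_tensor_eqI:
  assumes "L_list ys" "L_list zs" "\<And>h w. conv_fun ys h w = conv_fun zs h w" shows "L_tensor ys = L_tensor zs"
proof -
  have bl: "bilinear_on DD EW (fscale sW) (\<lambda>\<alpha> f. fscale sW (\<alpha> b) f)" for b
    by (rule bilinear_onI) (auto simp: fun_apply fun_eq_iff vs_distrib[OF vs_sW] vs_simps[OF vs_sW] mult.commute)
  have c: "tlift DD EW (\<lambda>\<alpha> f. fscale sW (\<alpha> b) f) (L_tensor xs) = conv_fun xs b" if "L_list xs" for xs b
    unfolding L_tensor_def tlift_sum[OF vsp_D vsp_E vs_fscale[OF vs_sW] bl L_list_set[OF that]] 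
    by (rule ext) (simp only: fun_sum_list_apply fscale_apply conv_fun_def)
  have "conv_fun ys = conv_fun zs" using assms(3) by (intro ext)
  then show ?thesis
    using DV_expand[OF vsp_E L_tensor_in[OF assms(1)]] DV_expand[OF vsp_E L_tensor_in[OF assms(2)]]
    by (simp add: c assms(1,2))
qed

lemma L_inv_E_tensor: "L_list ys \<Longrightarrow> the_inv_into (carr (tprod DD EW)) LM (LM (L_tensor ys)) = L_tensor ys"
proof (rule the_inv_into_f_f)
  show "inj_on LM (carr (tprod DD EW))"
  proof (rule inj_onI)
    fix y z assume "y \<in> carr (tprod DD EW)" "z \<in> carr (tprod DD EW)" "LM y = LM z"
    then obtain ys zs where "L_list ys" "y = L_tensor ys" "L_list zs" "z = L_tensor zs" "LM (L_tensor ys) = LM (L_tensor zs)"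
      by (metis L_tensor_ex)
    then show "y = z" using conv_fun_LM[of ys] conv_fun_LM[of zs] by (auto intro!: L_tensor_eqI)
  qed
qed (rule L_tensor_in)

abbreviation "Stab2 \<equiv> Stab_left H WW KK KK_act"

lemma Stab2_carr: "carr Stab2 = End_over (carr KK) DW HWa \<inter> LM ` carr (tprod DD EW)"
  by (simp add: Stab_left_def)

section \<open>Every element of the double stabilizer comes from S\<close>

definition rank_one_list :: "('w \<Rightarrow> 's) \<Rightarrow> 'w \<Rightarrow> 'h \<Rightarrow> (('w \<Rightarrow> 'w) \<times> 'h) list"
  where "rank_one_list \<pi> w0 c = map (\<lambda>(p, q). (\<lambda>w. (\<sigma> p \<rhd> \<pi> w) \<odot> w0, q)) (cop c)"

lemma sum_list_rank_one_list: "(\<Sum>(f, h)\<leftarrow>rank_one_list \<pi> w0 c. G f h) = sw c (\<lambda>p q. G (\<lambda>w. (\<sigma> p \<rhd> \<pi> w) \<odot> w0) q)"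
proof -
  have "(\<Sum>(f, h)\<leftarrow>map (\<lambda>(p, q). (\<lambda>w. (\<sigma> p \<rhd> \<pi> w) \<odot> w0, q)) xs. G f h) = (\<Sum>(p, q)\<leftarrow>xs. G (\<lambda>w. (\<sigma> p \<rhd> \<pi> w) \<odot> w0) q)" for xs
    by (induction xs) auto
  then show ?thesis by (simp add: rank_one_list_def sw_def)
qed

lemma E_list_rank_one_list: assumes "\<pi> \<in> HomWS" shows "E_list (rank_one_list \<pi> w0 c)"
  by (auto simp: E_list_def rank_one_list_def intro!: linI lin_comp[OF HomWS(1)[OF assms]])

text \<open>As \<open>\<sigma>\<close> reverses the coproduct, (\<sigma> a \<rhd> s) times (\<sigma>
  p \<rhd> \<pi> w) is assembled by the module algebra law into \<sigma> u \<rhd> (s * \<pi> w), and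
  S-linearity of \<open>\<pi>\<close> moves s to w.\<close>

lemma stab_cond_rank_one_list: assumes \<pi>: "\<pi> \<in> HomWS" shows "stab_cond (rank_one_list \<pi> w0 c)"
  unfolding stab_cond_def sum_list_rank_one_list
proof (intro allI impI)
  fix s w \<alpha> assume \<alpha>: "lin hs (*) (\<alpha> :: 'h \<Rightarrow> 'k)"
  note L = linI lin_comp[OF \<alpha>] lin_comp[OF HomWS(1)[OF \<pi>]]
  have "sw c (\<lambda>p q. sw q (\<lambda>a d. sW (\<alpha> d) ((\<sigma> a \<rhd> s) \<odot> ((\<sigma> p \<rhd> \<pi> w) \<odot> w0))))
     = sw c (\<lambda>u d. sw u (\<lambda>p a. sW (\<alpha> d) ((\<sigma> a \<rhd> s) \<odot> ((\<sigma> p \<rhd> \<pi> w) \<odot> w0))))"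
    by (rule sw_assoc[OF vs_sW, symmetric]) (intro tlinI L)
  also have "\<dots> = sw c (\<lambda>u d. sW (\<alpha> d) ((\<sigma> u \<rhd> \<pi> (s \<odot> w)) \<odot> w0))"
  proof (rule sw_cong)
    fix u d
    have l: "lin ss sW (\<lambda>x. sW (\<alpha> d) (x \<odot> w0))" by (intro L)
    have "sw (\<sigma> u) (\<lambda>m n. (m \<rhd> s) * (n \<rhd> \<pi> w)) = sw u (\<lambda>p a. (\<sigma> a \<rhd> s) * (\<sigma> p \<rhd> \<pi> w))"
      by (rule sw_sg[OF vs_ss]) (intro blinI L)
    then show "sw u (\<lambda>p a. sW (\<alpha> d) ((\<sigma> a \<rhd> s) \<odot> ((\<sigma> p \<rhd> \<pi> w) \<odot> w0))) = sW (\<alpha> d) ((\<sigma> u \<rhd> \<pi> (s \<odot> w)) \<odot> w0)"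
      by (simp add: HomWS(2)[OF \<pi>] act_mult sw_pull[OF l] actW_mult)
  qed
  finally show "sw c (\<lambda>p q. sw q (\<lambda>a d. sW (\<alpha> d) ((\<sigma> a \<rhd> s) \<odot> ((\<sigma> p \<rhd> \<pi> w) \<odot> w0))))
     = sw c (\<lambda>p q. sW (\<alpha> q) ((\<sigma> p \<rhd> \<pi> (s \<odot> w)) \<odot> w0))" .
qed

lemma Stab2_ex:
  assumes F: "F \<in> carr Stab2"
  obtains s ys where "L_list ys" "F = LM (L_tensor ys)" "\<And>a w. conv_fun ys a w = (a \<rhd> s) \<odot> w"
proof -
  obtain ys where ys: "L_list ys" "F = LM (L_tensor ys)" using F unfolding Stab2_carr by (auto elim: L_tensor_ex)
  note lg1 = lin_conv_fun_left[OF ys(1)] and lg2 = lin_conv_fun_right[OF ys(1)]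
  \<comment> \<open>Commutation is used on the vectors \<epsilon> \<otimes> w only, from which g is
    recovered; this is all that \<open>double_centralizer\<close> asks for.\<close>
  have comm: "(\<Sum>(f, h)\<leftarrow>ks. f (conv_fun ys (\<sigma> (\<sigma> h) * a) w)) = (\<Sum>(f, h)\<leftarrow>ks. sW (\<epsilon> h) (conv_fun ys a (f w)))"
    if ks: "E_list ks" "stab_cond ks" for ks a w
  proof -
    have x: "TD \<epsilon> w \<in> carr DW" by (rule TD_in[OF lin_eps])
    have "RM (E_tensor ks) \<in> carr KK" unfolding K_iff using ks by blast
    then have "F (HWa (RM (E_tensor ks)) (TD \<epsilon> w)) = HWa (RM (E_tensor ks)) (F (TD \<epsilon> w))"
      using F x unfolding Stab2_carr End_over_def by blast
    then have "ev_dual (F (HWa (RM (E_tensor ks)) (TD \<epsilon> w))) a = ev_dual (HWa (RM (E_tensor ks)) (F (TD \<epsilon> w))) a" by simp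
    also have "\<dots> = (\<Sum>(f, h)\<leftarrow>ks. f (conv_fun ys (\<sigma> (\<sigma> h) * a) w))"
      unfolding ys(2) ev_dual_HW_act[OF ks LM_in[OF ys(1) x]] conv_fun_LM[OF ys(1)] ..
    also have "ev_dual (F (HWa (RM (E_tensor ks)) (TD \<epsilon> w))) a = sw a (\<lambda>p q. conv_fun ys p (\<Sum>(f, h)\<leftarrow>ks. f (sW (\<epsilon> (\<sigma> (\<sigma> h) * q)) w)))"
      unfolding ys(2) ev_dual_LM[OF ys(1) HW_act_in[OF ks x]] ev_dual_HW_act[OF ks x] ev_dual_tensor[OF lin_eps] ..
    also have "\<dots> = sw a (\<lambda>p q. \<Sum>(f, h)\<leftarrow>ks. sW (\<epsilon> q) (sW (\<epsilon> h) (conv_fun ys p (f w))))"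
      unfolding lin_sum_list[OF lg2]
      by (intro sw_cong sum_list_cong_pair)
        (simp add: lin_scale[OF E_listD[OF ks(1)]] lin_scale[OF lg2] vs_simps[OF vs_sW] mult.commute)
    also have "\<dots> = (\<Sum>(f, h)\<leftarrow>ks. sw a (\<lambda>p q. sW (\<epsilon> q) (sW (\<epsilon> h) (conv_fun ys p (f w)))))"
      by (rule sw_sum_list)
    also have "\<dots> = (\<Sum>(f, h)\<leftarrow>ks. sW (\<epsilon> h) (conv_fun ys a (f w)))"
      by (intro sum_list_cong_pair sw_counit2 lin_scale_const[OF vs_sW] lg1)
    finally show ?thesis by simp
  qed
  have "\<exists>s. \<forall>a w. conv_fun ys a w = (a \<rhd> s) \<odot> w"
  proof (rule double_centralizer[OF lg1 lg2])
    fix \<pi> a b w w0 assume \<pi>: "\<pi> \<in> HomWS"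
    note L = linI lin_comp[OF HomWS(1)[OF \<pi>]] lin_comp[OF lg1] lin_comp[OF lg2]
    \<comment> \<open>Taking c = S b reverses the legs and cancels one \<open>\<sigma>\<close> in
      each of them, which produces hypothesis \<open>C\<close> of
      \<open>double_centralizer\<close>.\<close>
    have "sw (S b) (\<lambda>p q. (\<sigma> p \<rhd> \<pi> (conv_fun ys (\<sigma> (\<sigma> q) * a) w)) \<odot> w0) = sw (S b) (\<lambda>p q. sW (\<epsilon> q) (conv_fun ys a ((\<sigma> p \<rhd> \<pi> w) \<odot> w0)))"
      using comm[OF E_list_rank_one_list[OF \<pi>, of w0 "S b"] stab_cond_rank_one_list[OF \<pi>], of a w] by (simp only: sum_list_rank_one_list)
    also have "\<dots> = conv_fun ys a ((\<sigma> (S b) \<rhd> \<pi> w) \<odot> w0)"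
      by (rule sw_counit2) (intro L)
    also have "sw (S b) (\<lambda>p q. (\<sigma> p \<rhd> \<pi> (conv_fun ys (\<sigma> (\<sigma> q) * a) w)) \<odot> w0)
       = sw b (\<lambda>c d. (\<sigma> (S d) \<rhd> \<pi> (conv_fun ys (\<sigma> (\<sigma> (S c)) * a) w)) \<odot> w0)"
      by (rule sw_S[OF vs_sW]) (intro blinI L)
    finally show "sw b (\<lambda>c d. d \<rhd> \<pi> (conv_fun ys (\<sigma> c * a) w)) \<odot> w0 = conv_fun ys a ((b \<rhd> \<pi> w) \<odot> w0)"
      by (simp add: sw_pull[OF lin_actW_left])
  qed
  then show thesis using that ys by blast
qed

section \<open>The embedding of S into the double stabilizer\<close>

definition HB_list :: "'h list" where "HB_list = (SOME l. set l = HB \<and> distinct l)"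

lemma HB_list: "set HB_list = HB" "distinct HB_list"
  using someI_ex[OF finite_distinct_list[OF HB.finB]] by (auto simp: HB_list_def)

definition act_list :: "'s \<Rightarrow> (('h \<Rightarrow> 'k) \<times> ('w \<Rightarrow> 'w)) list"
  where "act_list s = map (\<lambda>b. (e b, \<lambda>w. (b \<rhd> s) \<odot> w)) HB_list"

lemma L_list_act_list: "L_list (act_list s)"
  by (auto simp: L_list_def act_list_def lin_e lin_actW_right)

lemma conv_fun_act_list: "conv_fun (act_list s) h w = (h \<rhd> s) \<odot> w"
proof -
  have "conv_fun (act_list s) h w = (\<Sum>b\<leftarrow>HB_list. sW (e b h) ((b \<rhd> s) \<odot> w))"
    by (simp add: conv_fun_def act_list_def o_def)
  also have "\<dots> = (\<Sum>b\<in>HB. sW (e b h) ((b \<rhd> s) \<odot> w))"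
    using HB_list by (simp add: sum_list_distinct_conv_sum_set)
  also have "\<dots> = (h \<rhd> s) \<odot> w"
    by (rule HB.lin_crd[where f = "\<lambda>b. (b \<rhd> s) \<odot> w"]) (intro linI)
  finally show ?thesis .
qed

definition stab_embed :: "'s \<Rightarrow> ('h \<Rightarrow> 'k, 'w, 'k) tensor \<Rightarrow> ('h \<Rightarrow> 'k, 'w, 'k) tensor"
  where "stab_embed s = LM (L_tensor (act_list s))"

lemma ev_dual_stab_embed: "x \<in> carr DW \<Longrightarrow> ev_dual (stab_embed s x) h = sw h (\<lambda>a b. (a \<rhd> s) \<odot> ev_dual x b)"
  unfolding stab_embed_def by (simp add: ev_dual_LM[OF L_list_act_list] conv_fun_act_list)

lemma stab_embed_in: "x \<in> carr DW \<Longrightarrow> stab_embed s x \<in> carr DW"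
  unfolding stab_embed_def by (rule LM_in[OF L_list_act_list])

lemma stab_embed_outside: "x \<notin> carr DW \<Longrightarrow> stab_embed s x = 0"
  unfolding stab_embed_def by (rule LM_outside[OF L_list_act_list])

text \<open>In \<open>stab_cond\<close> the elements s and w are fixed, here they vary with the legs
  of h. Expanding \<open>A\<close> and \<open>B\<close> over the basis puts this dependence into the
  functional \<open>k i j\<close>, the convolution of \<open>e i\<close> and \<open>e j\<close>, to
  which \<open>stab_cond\<close> applies with s = A i and w = B j.\<close>

lemma stab_cond_dual:
  assumes c: "stab_cond ys" "E_list ys" and A: "lin hs ss A" and B: "lin hs sW B"
  shows "(\<Sum>(f, h)\<leftarrow>ys. sw h (\<lambda>h1 h2. f (A h1 \<odot> B h2)))
    = (\<Sum>(f, h)\<leftarrow>ys. sw h (\<lambda>a c. sw c (\<lambda>h1 h2. (\<sigma> a \<rhd> A h1) \<odot> f (B h2))))"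
proof -
  define k where "k = (\<lambda>i j h. sw h (\<lambda>h1 h2. e i h1 * e j h2))"
  have lk: "lin hs (*) (k i j)" for i j unfolding k_def by (intro linI)
  have lf: "lin sW sW f" if "(f, h) \<in> set ys" for f h using E_listD[OF c(2) that] .
  have ex: "\<Phi> (A h1) (B h2) = (\<Sum>i\<in>HB. \<Sum>j\<in>HB. sW (e i h1 * e j h2) (\<Phi> (A i) (B j)))"
    if l1: "\<And>w. lin ss sW (\<lambda>s. \<Phi> s w)" and l2: "\<And>s. lin sW sW (\<Phi> s)" for \<Phi> h1 h2
  proof -
    have "\<Phi> (A h1) (B h2) = (\<Sum>i\<in>HB. sW (e i h1) (\<Phi> (A i) (B h2)))"
      by (rule HB.lin_crd[where f = "\<lambda>z. \<Phi> (A z) (B h2)", symmetric]) (rule lin_comp[OF l1 A])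
    also have "\<dots> = (\<Sum>i\<in>HB. sW (e i h1) (\<Sum>j\<in>HB. sW (e j h2) (\<Phi> (A i) (B j))))"
      by (intro sum.cong refl arg_cong[where f = "sW _"] HB.lin_crd[symmetric]) (rule lin_comp[OF l2 B])
    also have "\<dots> = (\<Sum>i\<in>HB. \<Sum>j\<in>HB. sW (e i h1 * e j h2) (\<Phi> (A i) (B j)))"
      by (simp add: lin_sum[OF lin_scale_const[OF vs_sW lin_id]] vs_simps[OF vs_sW])
    finally show ?thesis .
  qed
  have l: "lin (*) sW (\<lambda>k. sW k u)" for u by (rule lin_scale_fun[OF vs_sW lin_id])
  have exk: "sw h (\<lambda>h1 h2. \<Phi> (A h1) (B h2)) = (\<Sum>i\<in>HB. \<Sum>j\<in>HB. sW (k i j h) (\<Phi> (A i) (B j)))"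
    if l1: "\<And>w. lin ss sW (\<lambda>s. \<Phi> s w)" and l2: "\<And>s. lin sW sW (\<Phi> s)" for \<Phi> h
    unfolding k_def by (subst ex[OF l1 l2]) (simp only: sw_sum sw_pull[OF l])
  have "(\<Sum>(f, h)\<leftarrow>ys. sw h (\<lambda>h1 h2. f (A h1 \<odot> B h2)))
     = (\<Sum>(f, h)\<leftarrow>ys. \<Sum>i\<in>HB. \<Sum>j\<in>HB. sW (k i j h) (f (A i \<odot> B j)))"
  proof (rule sum_list_cong_pair)
    fix f h assume "(f, h) \<in> set ys"
    note L = linI lin_comp[OF lf[OF this]]
    show "sw h (\<lambda>h1 h2. f (A h1 \<odot> B h2)) = (\<Sum>i\<in>HB. \<Sum>j\<in>HB. sW (k i j h) (f (A i \<odot> B j)))"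
      by (rule exk[of "\<lambda>s w. f (s \<odot> w)"]) (intro L)+
  qed
  also have "\<dots> = (\<Sum>i\<in>HB. \<Sum>j\<in>HB. \<Sum>(f, h)\<leftarrow>ys. sW (k i j h) (f (A i \<odot> B j)))"
    by (simp only: sum_list_sum_swap)
  also have "\<dots> = (\<Sum>i\<in>HB. \<Sum>j\<in>HB. \<Sum>(f, h)\<leftarrow>ys. sw h (\<lambda>a c. sW (k i j c) ((\<sigma> a \<rhd> A i) \<odot> f (B j))))"
    using c(1) lk by (simp add: stab_cond_def)
  also have "\<dots> = (\<Sum>(f, h)\<leftarrow>ys. sw h (\<lambda>a c. \<Sum>i\<in>HB. \<Sum>j\<in>HB. sW (k i j c) ((\<sigma> a \<rhd> A i) \<odot> f (B j))))"
    by (simp only: sum_list_sum_swap sw_sum)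
  also have "\<dots> = (\<Sum>(f, h)\<leftarrow>ys. sw h (\<lambda>a c. sw c (\<lambda>h1 h2. (\<sigma> a \<rhd> A h1) \<odot> f (B h2))))"
  proof (rule sum_list_cong_pair)
    fix f h assume "(f, h) \<in> set ys"
    note L = linI lin_comp[OF lf[OF this]]
    show "sw h (\<lambda>a c. \<Sum>i\<in>HB. \<Sum>j\<in>HB. sW (k i j c) ((\<sigma> a \<rhd> A i) \<odot> f (B j)))
       = sw h (\<lambda>a c. sw c (\<lambda>h1 h2. (\<sigma> a \<rhd> A h1) \<odot> f (B h2)))"
      by (rule sw_cong, rule exk[of "\<lambda>s w. (\<sigma> _ \<rhd> s) \<odot> f w", symmetric]) (intro L)+
  qed
  finally show ?thesis .
qed

lemma stab_embed_carr: "stab_embed s \<in> carr Stab2"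
proof -
  have comm: "stab_embed s (HWa k x) = HWa k (stab_embed s x)" if "k \<in> carr KK" and x: "x \<in> carr DW" for k x
  proof -
    obtain ks where ks: "E_list ks" "stab_cond ks" "k = RM (E_tensor ks)" using \<open>k \<in> carr KK\<close> unfolding K_iff by blast
    have lf: "lin sW sW f" if "(f, h) \<in> set ks" for f h using E_listD[OF ks(1) that] .
    note Le = lin_comp[OF lin_ev_dual[OF x]]
    show ?thesis unfolding ks(3)
    proof (rule ev_dual_eqD)
      show "stab_embed s (HWa (RM (E_tensor ks)) x) \<in> carr DW" by (intro stab_embed_in HW_act_in ks x)
      show "HWa (RM (E_tensor ks)) (stab_embed s x) \<in> carr DW" by (intro stab_embed_in HW_act_in ks x)
      fix a
      \<comment> \<open>An element r can be pulled out to the left: \<open>stab_cond_dual\<close>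
        produces \<sigma> a acting after \<sigma> (\<sigma> h1), which is the action of \<sigma>
        (\<sigma> h1 * a), and adjacent legs cancel.\<close>
      have key: "(\<Sum>(f, h)\<leftarrow>ks. sw h (\<lambda>h1 h2. f ((\<sigma> (\<sigma> h1) \<rhd> r) \<odot> ev_dual x (\<sigma> (\<sigma> h2) * q))))
         = (\<Sum>(f, h)\<leftarrow>ks. r \<odot> f (ev_dual x (\<sigma> (\<sigma> h) * q)))" for r q
      proof -
        have "(\<Sum>(f, h)\<leftarrow>ks. sw h (\<lambda>h1 h2. f ((\<sigma> (\<sigma> h1) \<rhd> r) \<odot> ev_dual x (\<sigma> (\<sigma> h2) * q))))
          = (\<Sum>(f, h)\<leftarrow>ks. sw h (\<lambda>a c. sw c (\<lambda>h1 h2. (\<sigma> a \<rhd> (\<sigma> (\<sigma> h1) \<rhd> r)) \<odot> f (ev_dual x (\<sigma> (\<sigma> h2) * q)))))"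
          by (rule stab_cond_dual[OF ks(2,1)]) (intro linI Le)+
        also have "\<dots> = (\<Sum>(f, h)\<leftarrow>ks. r \<odot> f (ev_dual x (\<sigma> (\<sigma> h) * q)))"
        proof (rule sum_list_cong_pair)
          fix f h assume "(f, h) \<in> set ks"
          note L = linI Le lin_comp[OF lf[OF this]]
          have "sw h (\<lambda>a c. sw c (\<lambda>h1 h2. (\<sigma> a \<rhd> (\<sigma> (\<sigma> h1) \<rhd> r)) \<odot> f (ev_dual x (\<sigma> (\<sigma> h2) * q))))
            = sw h (\<lambda>a c. sw c (\<lambda>h1 h2. (\<sigma> (\<sigma> h1 * a) \<rhd> r) \<odot> f (ev_dual x (\<sigma> (\<sigma> h2) * q))))"
            by (simp only: sg_mult act_mult_left)
          also have "\<dots> = sw h (\<lambda>u h2. sw u (\<lambda>a h1. (\<sigma> (\<sigma> h1 * a) \<rhd> r) \<odot> f (ev_dual x (\<sigma> (\<sigma> h2) * q))))"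
            by (rule sw_assoc[OF vs_sW, symmetric]) (intro tlinI L)
          also have "\<dots> = sw h (\<lambda>u h2. sW (\<epsilon> u) ((\<sigma> 1 \<rhd> r) \<odot> f (ev_dual x (\<sigma> (\<sigma> h2) * q))))"
            by (rule sw_cong, rule sw_sg2[where f = "\<lambda>z. (\<sigma> z \<rhd> r) \<odot> f (ev_dual x (_ * q))"]) (intro L)
          also have "\<dots> = (\<sigma> 1 \<rhd> r) \<odot> f (ev_dual x (\<sigma> (\<sigma> h) * q))"
            by (rule sw_counit1) (intro L)
          finally show "sw h (\<lambda>a c. sw c (\<lambda>h1 h2. (\<sigma> a \<rhd> (\<sigma> (\<sigma> h1) \<rhd> r)) \<odot> f (ev_dual x (\<sigma> (\<sigma> h2) * q))))
            = r \<odot> f (ev_dual x (\<sigma> (\<sigma> h) * q))" by simp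
        qed
        finally show ?thesis .
      qed
      have "ev_dual (HWa (RM (E_tensor ks)) (stab_embed s x)) a = (\<Sum>(f, h)\<leftarrow>ks. f (sw (\<sigma> (\<sigma> h) * a) (\<lambda>u v. (u \<rhd> s) \<odot> ev_dual x v)))"
        unfolding ev_dual_HW_act[OF ks(1,2) stab_embed_in[OF x]] ev_dual_stab_embed[OF x] ..
      also have "\<dots> = (\<Sum>(f, h)\<leftarrow>ks. sw a (\<lambda>p q. sw h (\<lambda>h1 h2. f ((\<sigma> (\<sigma> h1) \<rhd> (p \<rhd> s)) \<odot> ev_dual x (\<sigma> (\<sigma> h2) * q)))))"
      proof (rule sum_list_cong_pair)
        fix f h assume "(f, h) \<in> set ks"
        note f = lf[OF this]
        note L = linI Le lin_comp[OF f]
        \<comment> \<open>\<open>\<sigma>\<close> reverses the coproduct, so its square preserves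
          it; the result has the left side of \<open>key\<close> with r = p \<rhd> s.\<close>
        have "sw (\<sigma> (\<sigma> h) * a) (\<lambda>u v. (u \<rhd> s) \<odot> ev_dual x v)
          = sw (\<sigma> (\<sigma> h)) (\<lambda>y z. sw a (\<lambda>p q. ((y * p) \<rhd> s) \<odot> ev_dual x (z * q)))"
          by (rule sw_mult[OF vs_sW]) (intro blinI L)
        also have "\<dots> = sw (\<sigma> h) (\<lambda>y z. sw a (\<lambda>p q. ((\<sigma> z * p) \<rhd> s) \<odot> ev_dual x (\<sigma> y * q)))"
          by (rule sw_sg[OF vs_sW]) (intro blinI L)
        also have "\<dots> = sw h (\<lambda>y z. sw a (\<lambda>p q. ((\<sigma> (\<sigma> y) * p) \<rhd> s) \<odot> ev_dual x (\<sigma> (\<sigma> z) * q)))"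
          by (rule sw_sg[OF vs_sW]) (intro blinI L)
        also have "\<dots> = sw a (\<lambda>p q. sw h (\<lambda>y z. ((\<sigma> (\<sigma> y) * p) \<rhd> s) \<odot> ev_dual x (\<sigma> (\<sigma> z) * q)))"
          by (rule sw_swap)
        finally show "f (sw (\<sigma> (\<sigma> h) * a) (\<lambda>u v. (u \<rhd> s) \<odot> ev_dual x v))
          = sw a (\<lambda>p q. sw h (\<lambda>h1 h2. f ((\<sigma> (\<sigma> h1) \<rhd> (p \<rhd> s)) \<odot> ev_dual x (\<sigma> (\<sigma> h2) * q))))"
          by (simp only: sw_pull[OF f] act_mult_left)
      qed
      also have "\<dots> = sw a (\<lambda>p q. \<Sum>(f, h)\<leftarrow>ks. sw h (\<lambda>h1 h2. f ((\<sigma> (\<sigma> h1) \<rhd> (p \<rhd> s)) \<odot> ev_dual x (\<sigma> (\<sigma> h2) * q))))"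
        by (rule sw_sum_list[symmetric])
      also have "\<dots> = sw a (\<lambda>p q. (p \<rhd> s) \<odot> (\<Sum>(f, h)\<leftarrow>ks. f (ev_dual x (\<sigma> (\<sigma> h) * q))))"
        by (simp only: key lin_sum_list[OF lin_actW_right])
      also have "\<dots> = ev_dual (stab_embed s (HWa (RM (E_tensor ks)) x)) a"
        unfolding ev_dual_stab_embed[OF HW_act_in[OF ks(1,2) x]] ev_dual_HW_act[OF ks(1,2) x] ..
      finally show "ev_dual (stab_embed s (HWa (RM (E_tensor ks)) x)) a = ev_dual (HWa (RM (E_tensor ks)) (stab_embed s x)) a" ..
    qed
  qed
  have "stab_embed s \<in> carr (End DW)" unfolding stab_embed_def by (rule LM_End[OF L_list_act_list])
  moreover have "stab_embed s \<in> LM ` carr (tprod DD EW)"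
    unfolding stab_embed_def by (rule imageI[OF L_tensor_in[OF L_list_act_list]])
  ultimately show ?thesis unfolding Stab2_carr End_over_def using comm by blast
qed

lemma stab_embed_inj: assumes "stab_embed s = stab_embed r" shows "s = r"
proof -
  let ?I = "{s. \<forall>h w. (h \<rhd> s) \<odot> w = 0}"
  have "(h \<rhd> s) \<odot> w = (h \<rhd> r) \<odot> w" for h w
    using conv_fun_LM[OF L_list_act_list, of s w h] conv_fun_LM[OF L_list_act_list, of r w h] assms by (simp add: stab_embed_def conv_fun_act_list)
  then have I: "s - r \<in> ?I" by (simp add: lin_diff[OF lin_act_right] lin_diff[OF lin_actW_left])
  have "s - r = 0"
  proof (rule H_simple_zero[of ?I, OF _ _ _ I])
    show "h \<rhd> x \<in> ?I" if "x \<in> ?I" for h x using that by (auto simp flip: act_mult_left)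
    obtain w :: 'w where w: "w \<noteq> 0" using W_nonzero by blast
    show "1 \<notin> ?I"
    proof
      assume "1 \<in> ?I"
      then have "(1 \<rhd> 1) \<odot> w = 0" by blast
      with w show False by (simp add: vs_simps[OF vs_ss])
    qed
    show "two_sided_ideal ?I" unfolding two_sided_ideal_def
    proof (intro conjI ballI allI)
      show "0 \<in> ?I" by (simp add: lin_zero[OF lin_act_right] lin_zero[OF lin_actW_left])
      show "x + y \<in> ?I" if "x \<in> ?I" "y \<in> ?I" for x y
        using that by (simp add: lin_add[OF lin_act_right] lin_add[OF lin_actW_left])
      fix x r assume x: "x \<in> ?I"
      show "r * x \<in> ?I" "x * r \<in> ?I"
        using x by (simp_all add: act_mult sw_pull[OF lin_actW_left] actW_mult lin_zero[OF lin_actW_right])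
    qed
  qed
  then show ?thesis by simp
qed

lemma stab_embed_surj: assumes "F \<in> carr Stab2" shows "\<exists>s. F = stab_embed s"
proof -
  obtain s ys where F: "L_list ys" "F = LM (L_tensor ys)" "\<And>a w. conv_fun ys a w = (a \<rhd> s) \<odot> w"
    using Stab2_ex[OF assms] by blast
  have "F = stab_embed s" unfolding stab_embed_def F(2) by (rule LM_eqI[OF F(1) L_list_act_list]) (simp only: conv_fun_act_list F(3))
  then show ?thesis ..
qed

section \<open>Compatibility with linear structure, product, unit and action of H\<close>

lemma stab_embed_eqI: "(\<And>x. x \<in> carr DW \<Longrightarrow> F x \<in> carr DW) \<Longrightarrow> (\<And>x. x \<notin> carr DW \<Longrightarrow> F x = 0) \<Longrightarrow>
   (\<And>x h. x \<in> carr DW \<Longrightarrow> ev_dual (F x) h = sw h (\<lambda>a b. (a \<rhd> s) \<odot> ev_dual x b)) \<Longrightarrow> stab_embed s = F"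
proof
  fix x assume F: "\<And>x. x \<in> carr DW \<Longrightarrow> F x \<in> carr DW" "\<And>x. x \<notin> carr DW \<Longrightarrow> F x = 0"
   "\<And>x h. x \<in> carr DW \<Longrightarrow> ev_dual (F x) h = sw h (\<lambda>a b. (a \<rhd> s) \<odot> ev_dual x b)"
  show "stab_embed s x = F x"
  proof (cases "x \<in> carr DW")
    case True
    then show ?thesis by (intro ev_dual_eqD stab_embed_in F(1)) (simp_all add: ev_dual_stab_embed F(3))
  qed (simp add: F(2) stab_embed_outside)
qed

lemma ev_dual_scale: "x \<in> carr DW \<Longrightarrow> ev_dual (fscale (*) c x) h = sW c (ev_dual x h)"
  unfolding ev_dual_def by (rule tlift_scale[OF vsp_D vsp_W vs_sW bilinear_ev_dual])

lemma DW_closed: "0 \<in> carr DW" "x \<in> carr DW \<Longrightarrow> y \<in> carr DW \<Longrightarrow> x + y \<in> carr DW"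
  "x \<in> carr DW \<Longrightarrow> fscale (*) c x \<in> carr DW"
  using is_vspace_0[OF is_vspace_tprod] is_vspace_add[OF is_vspace_tprod]
    is_vspace_scale[OF is_vspace_tprod[of DD WW]] by simp_all

lemma stab_embed_add: "stab_embed (s + r) = stab_embed s + stab_embed r"
  by (rule stab_embed_eqI) (simp_all add: fun_apply DW_closed stab_embed_in stab_embed_outside ev_dual_add ev_dual_stab_embed
      lin_add[OF lin_act_right] lin_add[OF lin_actW_left] sw_add)

lemma stab_embed_scale: "stab_embed (ss c s) = fscale (fscale (*)) c (stab_embed s)"
  by (rule stab_embed_eqI) (simp_all add: DW_closed stab_embed_in stab_embed_outside ev_dual_scale ev_dual_stab_embed fscale_field_zero
      lin_scale[OF lin_act_right] lin_scale[OF lin_actW_left] sw_scale[OF vs_sW])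

lemma stab_embed_mult: "stab_embed (s * r) = stab_embed s \<circ> stab_embed r"
proof (rule stab_embed_eqI)
  show "(stab_embed s \<circ> stab_embed r) x \<in> carr DW" if "x \<in> carr DW" for x using that by (simp add: stab_embed_in)
  have "stab_embed s 0 = 0"
    by (rule ev_dual_eqD) (simp_all add: stab_embed_in DW_closed ev_dual_stab_embed ev_dual_zero lin_zero[OF lin_actW_right])
  then show "(stab_embed s \<circ> stab_embed r) x = 0" if "x \<notin> carr DW" for x using that by (simp add: stab_embed_outside)
  fix x h assume x: "x \<in> carr DW"
  note L = linI lin_comp[OF lin_ev_dual[OF x]]
  have "ev_dual ((stab_embed s \<circ> stab_embed r) x) h = sw h (\<lambda>a b. sw b (\<lambda>c d. (a \<rhd> s) \<odot> ((c \<rhd> r) \<odot> ev_dual x d)))"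
    by (simp add: ev_dual_stab_embed stab_embed_in x sw_pull[OF lin_actW_right])
  also have "\<dots> = sw h (\<lambda>u d. sw u (\<lambda>a c. (a \<rhd> s) \<odot> ((c \<rhd> r) \<odot> ev_dual x d)))"
    by (rule sw_assoc[OF vs_sW, symmetric]) (intro tlinI L)
  also have "\<dots> = sw h (\<lambda>u d. (u \<rhd> (s * r)) \<odot> ev_dual x d)"
    by (simp add: act_mult sw_pull[OF lin_actW_left] actW_mult)
  finally show "ev_dual ((stab_embed s \<circ> stab_embed r) x) h = sw h (\<lambda>a b. (a \<rhd> (s * r)) \<odot> ev_dual x b)" .
qed

lemma stab_embed_one: "stab_embed 1 = ident DW"
proof (rule stab_embed_eqI)
  fix x h assume x: "x \<in> carr DW"
  have "sw h (\<lambda>a b. sW (\<epsilon> a) (ev_dual x b)) = ev_dual x h" by (rule sw_counit1[OF lin_ev_dual[OF x]])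
  then show "ev_dual (ident DW x) h = sw h (\<lambda>a b. (a \<rhd> 1) \<odot> ev_dual x b)"
    using x by (simp add: ident_def lin_scale[OF lin_actW_left])
qed (simp_all add: ident_def)

text \<open>\<open>uharp h\<close> translates the argument of g from a to a * h, and (a * h) \<rhd>
  s = a \<rhd> (h \<rhd> s).\<close>

lemma stab_embed_hact: "hact Stab2 h (stab_embed s) = stab_embed (h \<rhd> s)"
proof -
  define Zs where "Zs = map (\<lambda>(\<alpha>, f). (uharp h \<alpha>, f)) (act_list s)"
  have lu: "lin hs (*) (uharp h \<alpha>)" if "lin hs (*) \<alpha>" for \<alpha> :: "'h \<Rightarrow> 'k"
    unfolding uharp_def by (intro linI lin_comp[OF that])
  have Zs: "L_list Zs" using L_list_act_list[of s] lu by (auto simp: L_list_def Zs_def)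
  have lT: "lin (fscale (*)) (fscale (*)) (\<lambda>\<alpha>. TL \<alpha> f)" for f by (rule lin_tensor_left) (simp add: lin_id)
  have lT2: "lin (fscale sW) (fscale (*)) (TL \<alpha>)" for \<alpha> by (rule lin_tensor_right) (simp add: lin_id)
  have "uharp h (\<alpha> + \<beta>) = uharp h \<alpha> + uharp h \<beta>" "uharp h (fscale (*) c \<alpha>) = fscale (*) c (uharp h \<alpha>)"
    for \<alpha> \<beta> :: "'h \<Rightarrow> 'k" and c
    by (auto simp: uharp_def fun_eq_iff fun_apply)
  then have bl: "bilinear_on DD EW (fscale (*)) (\<lambda>\<alpha> f. TL (uharp h \<alpha>) f)"
    by (intro bilinear_onI) (simp_all add: lin_add[OF lT] lin_scale[OF lT] lin_add[OF lT2] lin_scale[OF lT2])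
  have sZ: "(\<Sum>(\<alpha>, f)\<leftarrow>Zs. G \<alpha> f) = (\<Sum>(\<alpha>, f)\<leftarrow>act_list s. G (uharp h \<alpha>) f)" for G :: "_ \<Rightarrow> _ \<Rightarrow> 'z::ab_group_add"
  proof -
    have "(\<Sum>(\<alpha>, f)\<leftarrow>map (\<lambda>(\<alpha>, f). (uharp h \<alpha>, f)) xs. G \<alpha> f) = (\<Sum>(\<alpha>, f)\<leftarrow>xs. G (uharp h \<alpha>) f)" for xs
      by (induction xs) auto
    then show ?thesis by (simp only: Zs_def)
  qed
  have "hact Stab2 h (stab_embed s) = LM (tlift DD EW (\<lambda>\<alpha> f. TL (uharp h \<alpha>) f) (L_tensor (act_list s)))"
    by (simp add: Stab_left_def stab_embed_def L_inv_E_tensor[OF L_list_act_list])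
  also have "tlift DD EW (\<lambda>\<alpha> f. TL (uharp h \<alpha>) f) (L_tensor (act_list s)) = L_tensor Zs"
    unfolding L_tensor_def sZ by (rule tlift_sum[OF vsp_D vsp_E vs_ft bl L_list_set[OF L_list_act_list]])
  also have "LM (L_tensor Zs) = stab_embed (h \<rhd> s)" unfolding stab_embed_def
  proof (rule LM_eqI[OF Zs L_list_act_list])
    fix a w
    have "conv_fun Zs a w = conv_fun (act_list s) (a * h) w" unfolding conv_fun_def sZ by (simp add: uharp_def)
    then show "conv_fun Zs a w = conv_fun (act_list (h \<rhd> s)) a w" by (simp add: conv_fun_act_list act_mult_left)
  qed
  finally show ?thesis .
qed

theorem Stab_Stab_iso: "modalg_isomorphic Stab2 S_alg"
proof -
  have surj: "stab_embed ` UNIV = carr Stab2" using stab_embed_carr stab_embed_surj by blast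
  have bij: "bij_betw stab_embed UNIV (carr Stab2)"
    unfolding bij_betw_def using surj stab_embed_inj by (auto intro: injI)
  \<comment> \<open>The isomorphism is to go from the double stabilizer to S, hence the inverse of
    the embedding; its properties are read off on the elements \<open>stab_embed s\<close>.\<close>
  define \<phi> where "\<phi> = the_inv_into UNIV stab_embed"
  have inj: "inj stab_embed" using stab_embed_inj by (auto intro: injI)
  have \<phi>: "\<phi> (stab_embed s) = s" for s unfolding \<phi>_def by (rule the_inv_into_f_f[OF inj]) simp
  have "bij_betw \<phi> (carr Stab2) UNIV" unfolding \<phi>_def by (rule bij_betw_the_inv_into[OF bij])
  moreover have "linear_on Stab2 S_alg \<phi>"
  proof -
    have "scal Stab2 = fscale (fscale (*))" by (simp add: Stab_left_def scal_Hom)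
    then show ?thesis unfolding linear_on_def
      using \<phi> by (auto dest!: stab_embed_surj simp flip: stab_embed_add stab_embed_scale)
  qed
  moreover have "\<phi> (amult Stab2 x y) = amult S_alg (\<phi> x) (\<phi> y)" if "x \<in> carr Stab2" "y \<in> carr Stab2" for x y
  proof -
    have "amult Stab2 = (\<circ>)" by (simp add: Stab_left_def)
    then show ?thesis using that \<phi> by (auto dest!: stab_embed_surj simp flip: stab_embed_mult)
  qed
  moreover have "\<phi> (aone Stab2) = aone S_alg"
    using \<phi>[of 1] by (simp add: Stab_left_def stab_embed_one)
  moreover have "\<phi> (hact Stab2 h x) = hact S_alg h (\<phi> x)" if "x \<in> carr Stab2" for h x
    using that \<phi> by (auto dest!: stab_embed_surj simp: stab_embed_hact)
  ultimately show ?thesis unfolding modalg_isomorphic_def by auto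
qed

end

theorem theorem2p14:
  fixes H :: "('k::{alg_closed_field, field_char_0}, 'h::ring_1) hopf"
    and scaleS :: "'k \<Rightarrow> 's::ring_1 \<Rightarrow> 's"
    and actS :: "'h \<Rightarrow> 's \<Rightarrow> 's"
    and scaleW :: "'k \<Rightarrow> 'w::ab_group_add \<Rightarrow> 'w"
    and actW :: "'s \<Rightarrow> 'w \<Rightarrow> 'w"
  assumes "hopf_algebra H" and "fin_dim (hscale H)"
    and "module_algebra H scaleS actS" and "fin_dim scaleS" and "H_simple actS"
    and "left_module scaleS scaleW actW" and "fin_dim scaleW" and "\<exists>w::'w. w \<noteq> 0"
  shows "let S = to_modalg scaleS actS;
             W = whole scaleW;
             K = Stab_right H W (module_to_comodule H S) actW
         in modalg_isomorphic (Stab_left H W K (Stab_right_act H W)) S"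
proof -
  interpret hopf_module H scaleS actS scaleW actW
    by unfold_locales (use assms in auto)
  show ?thesis unfolding Let_def by (rule Stab_Stab_iso)
qed

end
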